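(* There is an equivalence between the category of strict Bousfield $\Gamma$-spaces and the category of simplicial abelian groups.
   Context: $\Gamma$ is Segal's category: its objects are representatives of isomorphism classes of finite sets, and a morphism $S\to T$ is a map $\theta:S\to\mathcal{P}(T)$ (the power set of $T$) such that $\theta(\alpha)$ and $\theta(\beta)$ are disjoint whenever $\alpha\ne\beta$ (composition: $(\theta'\circ\theta)(\alpha)=\bigcup_{\beta\in\theta(\alpha)}\theta'(\beta)$). The opposite category $\Gamma^{op}$ is the category with objects $\mathbf{n}=\{0,1,\dots,n\}$, $n\ge0$, and morphisms the functions $\mathbf{m}\to\mathbf{n}$ with $0\mapsto0$ (here $\mathbf{n}$ corresponds to the finite set $\{1,\dots,n\}$ in $\Gamma$). For $0\le k\le n-1$ let $j^k:\mathbf{1}\to\mathbf{n}$ be the morphism of $\Gamma$ given by $j^k(1)=\{1,\dots,k+1\}$; the corresponding morphism $\mathbf{n}\to\mathbf{1}$ of $\Gamma^{op}$ sends $1,\dots,k+1$ to $1$ and all other elements to $0$. A strict Bousfield $\Gamma$-space is a functor $X:\Gamma^{op}\to\mathcal{SS}ets$ to simplicial sets such that $X(\mathbf{0})=\Delta[0]$ and, for all $n\ge2$, the map $X(\mathbf{n})\to X(\mathbf{1})^n$ induced by these $n$ morphisms $\mathbf{n}\to\mathbf{1}$ in $\Gamma^{op}$ is an isomorphism of simplicial sets. Morphisms are natural transformations. *)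

theory Defs
  imports "HOL-Library.FuncSet" "HOL-Algebra.Group"
begin

section \<open>Categories, functors and equivalences\<close>

record ('o, 'a) category =
  Obj :: "'o set"
  Arr :: "'a set"
  Dom :: "'a \<Rightarrow> 'o"
  Cod :: "'a \<Rightarrow> 'o"
  Idn :: "'o \<Rightarrow> 'a"
  Cmp :: "'a \<Rightarrow> 'a \<Rightarrow> 'a"  \<comment> \<open>\<open>Cmp C g f\<close> is g after f; only meaningful when \<open>Cod C f = Dom C g\<close>\<close>

locale category =
  fixes C :: "('o, 'a) category"
  assumes dom_in: "f \<in> Arr C \<Longrightarrow> Dom C f \<in> Obj C"
    and cod_in: "f \<in> Arr C \<Longrightarrow> Cod C f \<in> Obj C"
    and idn_in: "x \<in> Obj C \<Longrightarrow> Idn C x \<in> Arr C"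
    and dom_idn: "x \<in> Obj C \<Longrightarrow> Dom C (Idn C x) = x"
    and cod_idn: "x \<in> Obj C \<Longrightarrow> Cod C (Idn C x) = x"
    and cmp_in: "\<lbrakk>f \<in> Arr C; g \<in> Arr C; Cod C f = Dom C g\<rbrakk> \<Longrightarrow> Cmp C g f \<in> Arr C"
    and dom_cmp: "\<lbrakk>f \<in> Arr C; g \<in> Arr C; Cod C f = Dom C g\<rbrakk> \<Longrightarrow> Dom C (Cmp C g f) = Dom C f"
    and cod_cmp: "\<lbrakk>f \<in> Arr C; g \<in> Arr C; Cod C f = Dom C g\<rbrakk> \<Longrightarrow> Cod C (Cmp C g f) = Cod C g"
    and cmp_idn_right: "f \<in> Arr C \<Longrightarrow> Cmp C f (Idn C (Dom C f)) = f"
    and cmp_idn_left: "f \<in> Arr C \<Longrightarrow> Cmp C (Idn C (Cod C f)) f = f"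
    and cmp_assoc: "\<lbrakk>f \<in> Arr C; g \<in> Arr C; h \<in> Arr C; Cod C f = Dom C g; Cod C g = Dom C h\<rbrakk>
           \<Longrightarrow> Cmp C h (Cmp C g f) = Cmp C (Cmp C h g) f"

definition is_iso :: "('o, 'a) category \<Rightarrow> 'a \<Rightarrow> bool" where
  "is_iso C f \<longleftrightarrow> f \<in> Arr C \<and>
     (\<exists>g\<in>Arr C. Dom C g = Cod C f \<and> Cod C g = Dom C f \<and>
        Cmp C g f = Idn C (Dom C f) \<and> Cmp C f g = Idn C (Cod C f))"

definition opposite :: "('o, 'a) category \<Rightarrow> ('o, 'a) category" where
  "opposite C = \<lparr>Obj = Obj C, Arr = Arr C, Dom = Cod C, Cod = Dom C, Idn = Idn C,
                 Cmp = (\<lambda>g f. Cmp C f g)\<rparr>"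

definition full_subcategory :: "('o, 'a) category \<Rightarrow> ('o \<Rightarrow> bool) \<Rightarrow> ('o, 'a) category" where
  "full_subcategory C P =
     \<lparr>Obj = {x \<in> Obj C. P x}, Arr = {f \<in> Arr C. P (Dom C f) \<and> P (Cod C f)},
      Dom = Dom C, Cod = Cod C, Idn = Idn C, Cmp = Cmp C\<rparr>"

text \<open>Functors, and below the functions underlying arrows, are extensional (undefined outside
  their domain), so that equality in HOL is equality of functors and arrows.\<close>

record ('o, 'a, 'p, 'b) functr =
  on_obj :: "'o \<Rightarrow> 'p"
  on_arr :: "'a \<Rightarrow> 'b"

definition is_functor ::
    "('o, 'a) category \<Rightarrow> ('p, 'b) category \<Rightarrow> ('o, 'a, 'p, 'b) functr \<Rightarrow> bool" where
  "is_functor C D F \<longleftrightarrow>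
     on_obj F \<in> Obj C \<rightarrow>\<^sub>E Obj D \<and>
     on_arr F \<in> Arr C \<rightarrow>\<^sub>E Arr D \<and>
     (\<forall>f\<in>Arr C. Dom D (on_arr F f) = on_obj F (Dom C f) \<and> Cod D (on_arr F f) = on_obj F (Cod C f)) \<and>
     (\<forall>x\<in>Obj C. on_arr F (Idn C x) = Idn D (on_obj F x)) \<and>
     (\<forall>f\<in>Arr C. \<forall>g\<in>Arr C. Cod C f = Dom C g \<longrightarrow>
        on_arr F (Cmp C g f) = Cmp D (on_arr F g) (on_arr F f))"

definition id_functor :: "('o, 'a) category \<Rightarrow> ('o, 'a, 'o, 'a) functr" where
  "id_functor C = \<lparr>on_obj = (\<lambda>x\<in>Obj C. x), on_arr = (\<lambda>f\<in>Arr C. f)\<rparr>"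

definition comp_functor ::
    "('o, 'a) category \<Rightarrow> ('p, 'b, 'q, 'c) functr \<Rightarrow> ('o, 'a, 'p, 'b) functr \<Rightarrow> ('o, 'a, 'q, 'c) functr" where
  "comp_functor C G F = \<lparr>on_obj = compose (Obj C) (on_obj G) (on_obj F),
                         on_arr = compose (Arr C) (on_arr G) (on_arr F)\<rparr>"

text \<open>An arrow recorded together with its source and target; \<open>dat\<close> is the underlying function
  or, for a natural transformation, the family of components.\<close>

record ('o, 'd) arrow =
  src :: 'o
  dat :: 'd
  tgt :: 'o

type_synonym ('o, 'a, 'p, 'b) nat_trans = "(('o, 'a, 'p, 'b) functr, 'o \<Rightarrow> 'b) arrow"

definition is_nat_trans ::
    "('o, 'a) category \<Rightarrow> ('p, 'b) category \<Rightarrow> ('o, 'a, 'p, 'b) nat_trans \<Rightarrow> bool" where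
  "is_nat_trans C D \<tau> \<longleftrightarrow>
     is_functor C D (src \<tau>) \<and> is_functor C D (tgt \<tau>) \<and>
     dat \<tau> \<in> Obj C \<rightarrow>\<^sub>E Arr D \<and>
     (\<forall>x\<in>Obj C. Dom D (dat \<tau> x) = on_obj (src \<tau>) x \<and> Cod D (dat \<tau> x) = on_obj (tgt \<tau>) x) \<and>
     (\<forall>f\<in>Arr C. Cmp D (dat \<tau> (Cod C f)) (on_arr (src \<tau>) f) =
                 Cmp D (on_arr (tgt \<tau>) f) (dat \<tau> (Dom C f)))"

definition functor_category ::
    "('o, 'a) category \<Rightarrow> ('p, 'b) category \<Rightarrow>
     (('o, 'a, 'p, 'b) functr, ('o, 'a, 'p, 'b) nat_trans) category" where
  "functor_category C D =
     \<lparr>Obj = {F. is_functor C D F}, Arr = {\<tau>. is_nat_trans C D \<tau>}, Dom = src, Cod = tgt,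
      Idn = (\<lambda>F. \<lparr>src = F, dat = (\<lambda>x\<in>Obj C. Idn D (on_obj F x)), tgt = F\<rparr>),
      Cmp = (\<lambda>\<sigma> \<tau>. \<lparr>src = src \<tau>, dat = (\<lambda>x\<in>Obj C. Cmp D (dat \<sigma> x) (dat \<tau> x)), tgt = tgt \<sigma>\<rparr>)\<rparr>"

definition naturally_isomorphic ::
    "('o, 'a) category \<Rightarrow> ('p, 'b) category \<Rightarrow>
     ('o, 'a, 'p, 'b) functr \<Rightarrow> ('o, 'a, 'p, 'b) functr \<Rightarrow> bool" where
  "naturally_isomorphic C D F G \<longleftrightarrow>
     (\<exists>\<tau>. is_nat_trans C D \<tau> \<and> src \<tau> = F \<and> tgt \<tau> = G \<and> (\<forall>x\<in>Obj C. is_iso D (dat \<tau> x)))"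

definition equivalent_categories :: "('o, 'a) category \<Rightarrow> ('p, 'b) category \<Rightarrow> bool" where
  "equivalent_categories C D \<longleftrightarrow>
     category C \<and> category D \<and>
     (\<exists>F G. is_functor C D F \<and> is_functor D C G \<and>
        naturally_isomorphic C C (id_functor C) (comp_functor C G F) \<and>
        naturally_isomorphic D D (comp_functor D F G) (id_functor D))"

section \<open>The concrete categories\<close>

text \<open>The objects are the elements \<open>x\<close> of \<open>X\<close>, with underlying sets \<open>U x\<close>; the
  arrows from \<open>x\<close> to \<open>y\<close> are the functions \<open>U x \<rightarrow> U y\<close> that satisfy \<open>H x y\<close>.\<close>

definition concrete_category ::
    "'o set \<Rightarrow> ('o \<Rightarrow> 'v set) \<Rightarrow> ('o \<Rightarrow> 'o \<Rightarrow> ('v \<Rightarrow> 'v) \<Rightarrow> bool) \<Rightarrow>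
     ('o, ('o, 'v \<Rightarrow> 'v) arrow) category" where
  "concrete_category X U H =
     \<lparr>Obj = X,
      Arr = {f. src f \<in> X \<and> tgt f \<in> X \<and> dat f \<in> U (src f) \<rightarrow>\<^sub>E U (tgt f) \<and> H (src f) (tgt f) (dat f)},
      Dom = src, Cod = tgt,
      Idn = (\<lambda>x. \<lparr>src = x, dat = (\<lambda>a\<in>U x. a), tgt = x\<rparr>),
      Cmp = (\<lambda>g f. \<lparr>src = src f, dat = compose (U (src f)) (dat g) (dat f), tgt = tgt g\<rparr>)\<rparr>"

type_synonym nat_arrow = "(nat, nat \<Rightarrow> nat) arrow"

text \<open>The number \<open>n\<close> stands for the ordinal \<open>[n]\<close>, respectively for the pointed set with
  elements 0, ..., n and base point 0.\<close>

definition Delta :: "(nat, nat_arrow) category" where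
  "Delta = concrete_category UNIV (\<lambda>n. {..n}) (\<lambda>m n f. mono_on {..m} f)"

definition Gamma_op :: "(nat, nat_arrow) category" where
  "Gamma_op = concrete_category UNIV (\<lambda>n. {..n}) (\<lambda>m n f. f 0 = 0)"

text \<open>The type \<open>'u\<close> is the universe: sets and groups are those carried by subsets of \<open>'u\<close>.
  Group objects are only required to be well-behaved on their carriers, so there are several,
  isomorphic, objects with the same carrier and the same group structure on it.\<close>

definition set_cat :: "('u set, ('u set, 'u \<Rightarrow> 'u) arrow) category" where
  "set_cat = concrete_category UNIV (\<lambda>A. A) (\<lambda>A B f. True)"

definition ab_cat :: "('u monoid, ('u monoid, 'u \<Rightarrow> 'u) arrow) category" where
  "ab_cat = concrete_category {G. comm_group G} carrier (\<lambda>G H f. f \<in> hom G H)"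

type_synonym 'u sset = "(nat, nat_arrow, 'u set, ('u set, 'u \<Rightarrow> 'u) arrow) functr"
type_synonym 'u sset_map = "(nat, nat_arrow, 'u set, ('u set, 'u \<Rightarrow> 'u) arrow) nat_trans"

definition simplicial_sets :: "('u sset, 'u sset_map) category" where
  "simplicial_sets = functor_category (opposite Delta) set_cat"

type_synonym 'u sab = "(nat, nat_arrow, 'u monoid, ('u monoid, 'u \<Rightarrow> 'u) arrow) functr"
type_synonym 'u sab_map = "(nat, nat_arrow, 'u monoid, ('u monoid, 'u \<Rightarrow> 'u) arrow) nat_trans"

definition simplicial_abelian_groups :: "('u sab, 'u sab_map) category" where
  "simplicial_abelian_groups = functor_category (opposite Delta) ab_cat"

section \<open>Strict Bousfield Gamma-spaces\<close>

text \<open>There is exactly one monotone map from \<open>[m]\<close> to \<open>[0]\<close>; the element \<open>undefined\<close> of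
  the universe represents it.\<close>

definition Delta0 :: "'u sset" where
  "Delta0 = \<lparr>on_obj = (\<lambda>m. {undefined}),
     on_arr = (\<lambda>\<theta>\<in>Arr (opposite Delta).
       \<lparr>src = {undefined}, dat = (\<lambda>x\<in>{undefined}. x), tgt = {undefined}\<rparr>)\<rparr>"

text \<open>The n-fold power of a simplicial set. Its simplices are n-tuples, that is, functions on
  \<open>{..<n}\<close>, so they live in the type \<open>nat \<Rightarrow> 'u\<close> and not in \<open>'u\<close>. For this reason maps
  and isomorphisms between simplicial sets over two different universes are needed as well.\<close>

definition sset_power :: "'u sset \<Rightarrow> nat \<Rightarrow> (nat \<Rightarrow> 'u) sset" where
  "sset_power A n =
     \<lparr>on_obj = (\<lambda>m. {..<n} \<rightarrow>\<^sub>E on_obj A m),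
      on_arr = (\<lambda>\<theta>\<in>Arr (opposite Delta).
        \<lparr>src = {..<n} \<rightarrow>\<^sub>E on_obj A (Dom (opposite Delta) \<theta>),
         dat = (\<lambda>x\<in>{..<n} \<rightarrow>\<^sub>E on_obj A (Dom (opposite Delta) \<theta>). \<lambda>k\<in>{..<n}. dat (on_arr A \<theta>) (x k)),
         tgt = {..<n} \<rightarrow>\<^sub>E on_obj A (Cod (opposite Delta) \<theta>)\<rparr>)\<rparr>"

definition simplicial_map :: "'u sset \<Rightarrow> 'v sset \<Rightarrow> (nat \<Rightarrow> 'u \<Rightarrow> 'v) \<Rightarrow> bool" where
  "simplicial_map A B \<phi> \<longleftrightarrow>
     (\<forall>m. \<phi> m \<in> on_obj A m \<rightarrow> on_obj B m) \<and>
     (\<forall>\<theta>\<in>Arr (opposite Delta). \<forall>x\<in>on_obj A (Dom (opposite Delta) \<theta>).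
        \<phi> (Cod (opposite Delta) \<theta>) (dat (on_arr A \<theta>) x) =
        dat (on_arr B \<theta>) (\<phi> (Dom (opposite Delta) \<theta>) x))"

definition simplicial_iso :: "'u sset \<Rightarrow> 'v sset \<Rightarrow> (nat \<Rightarrow> 'u \<Rightarrow> 'v) \<Rightarrow> bool" where
  "simplicial_iso A B \<phi> \<longleftrightarrow>
     simplicial_map A B \<phi> \<and>
     (\<exists>\<psi>. simplicial_map B A \<psi> \<and>
        (\<forall>m. (\<forall>x\<in>on_obj A m. \<psi> m (\<phi> m x) = x) \<and> (\<forall>y\<in>on_obj B m. \<phi> m (\<psi> m y) = y)))"

type_synonym 'u gamma_space = "(nat, nat_arrow, 'u sset, 'u sset_map) functr"
type_synonym 'u gamma_map = "(nat, nat_arrow, 'u sset, 'u sset_map) nat_trans"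

text \<open>The morphism of \<open>\<Gamma>\<^sup>o\<^sup>p\<close> from \<open>n\<close> to \<open>1\<close> that corresponds to \<open>j\<^sup>k\<close>.\<close>

definition j_op :: "nat \<Rightarrow> nat \<Rightarrow> nat_arrow" where
  "j_op n k = \<lparr>src = n, dat = (\<lambda>i\<in>{..n}. if 1 \<le> i \<and> i \<le> k + 1 then 1 else 0), tgt = 1\<rparr>"

definition bousfield_map :: "'u gamma_space \<Rightarrow> nat \<Rightarrow> nat \<Rightarrow> 'u \<Rightarrow> (nat \<Rightarrow> 'u)" where
  "bousfield_map X n m x = (\<lambda>k\<in>{..<n}. dat (dat (on_arr X (j_op n k)) m) x)"

definition strict_bousfield :: "'u gamma_space \<Rightarrow> bool" where
  "strict_bousfield X \<longleftrightarrow>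
     on_obj X 0 = Delta0 \<and>
     (\<forall>n\<ge>2. simplicial_iso (on_obj X n) (sset_power (on_obj X 1) n) (bousfield_map X n))"

definition strict_bousfield_gamma_spaces :: "('u gamma_space, 'u gamma_map) category" where
  "strict_bousfield_gamma_spaces =
     full_subcategory (functor_category Gamma_op simplicial_sets) strict_bousfield"

end

theory Submission
  imports "HOL-Algebra.FiniteProduct" Defs
begin

text \<open>A strict Bousfield \<open>\<Gamma>\<close>-space \<open>X\<close> is determined in each simplicial degree by \<open>X(1)\<close>: an
  element \<open>x\<close> of \<open>X(n)\<close> has a value \<open>x\<^sub>T \<in> X(1)\<close> for every \<open>T \<subseteq> {1..n}\<close>, the image under the map
  \<open>n \<rightarrow> 1\<close> that sends \<open>T\<close> to 1 and its complement to 0, and the values on the initial segments can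
  be prescribed arbitrarily. For \<open>T \<subseteq> U\<close> the value at \<open>U - T\<close> is a function \<open>d\<close> of the values at
  \<open>T\<close> and \<open>U\<close>, and chains of subsets give the identities \<open>d a a = e\<close>, \<open>d e a = a\<close>,
  \<open>d (d a b) (d a c) = d b c\<close> and \<open>d (d a b) b = a\<close>, which characterise subtraction \<open>b - a\<close> in an
  abelian group. Hence \<open>X(1)\<close> is a simplicial abelian group. The resulting functor is fully
  faithful because \<open>T \<mapsto> x\<^sub>T\<close> is additive, so that it is determined by the initial segments. It is
  essentially surjective because the additive functions from the subsets of \<open>{1..n}\<close> to an abelian
  group \<open>A\<close> form a \<open>\<Gamma>\<close>-set whose group is \<open>A\<close>.\<close>

section \<open>Categories and equivalences\<close>

text \<open>Initial segments are what produces groups. Coordinates at singletons, as in Segal's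
  condition, would make the value at a union a function of the values at the parts and yield only
  commutative monoids. Here the coordinates are partial sums: the values at {1} and {1,2} are
  arbitrary, and the value at {2} must be their difference, so subtraction is the primitive
  operation. If d a b is read as a^-1 b, the first three identities hold in every group and the
  fourth is commutativity; it comes from interchanging {1} and {2} inside {1,2}. The other obstacle
  is size. All X(n) lie in the one universe \<open>'u\<close>, whereas additive functions have type
  \<open>nat set \<Rightarrow> 'u\<close>, so they are replaced by codes, which exist because an
  infinite set is equinumerous to its positive finite powers. In a finite universe with several
  elements, room for X(1)^n for all n would force X(1) to be a point in every degree, although
  nontrivial groups exist. Since codes are not the elements of the given group, that group is
  recovered only up to isomorphism.\<close>

lemma category_opposite: "category C \<Longrightarrow> category (opposite C)"
  unfolding category_def opposite_def by simp

lemma category_full_subcategory: "category C \<Longrightarrow> category (full_subcategory C P)"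
  unfolding category_def full_subcategory_def by auto

text \<open>Composing with an identity cuts a function down to its domain; the unit laws hold
  because arrows are already undefined outside it.\<close>

lemma category_concrete_category:
  assumes "\<And>x. x \<in> X \<Longrightarrow> H x x (\<lambda>a\<in>U x. a)"
    and "\<And>x y z f g. \<lbrakk>x \<in> X; y \<in> X; z \<in> X; f \<in> U x \<rightarrow>\<^sub>E U y; g \<in> U y \<rightarrow>\<^sub>E U z; H x y f; H y z g\<rbrakk>
            \<Longrightarrow> H x z (compose (U x) g f)"
  shows "category (concrete_category X U H)"
proof
  fix f assume "f \<in> Arr (concrete_category X U H)"
  then have f: "src f \<in> X" "tgt f \<in> X" "dat f \<in> U (src f) \<rightarrow>\<^sub>E U (tgt f)"
    by (auto simp: concrete_category_def)
  show "Cmp (concrete_category X U H) f (Idn (concrete_category X U H) (Dom (concrete_category X U H) f)) = f"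
    using f by (intro arrow.equality) (auto simp: concrete_category_def compose_def fun_eq_iff PiE_def extensional_def)
  show "Cmp (concrete_category X U H) (Idn (concrete_category X U H) (Cod (concrete_category X U H) f)) f = f"
    using f by (intro arrow.equality) (auto simp: concrete_category_def compose_def fun_eq_iff PiE_def extensional_def)
next
  fix f g h
  assume "f \<in> Arr (concrete_category X U H)" "g \<in> Arr (concrete_category X U H)"
    "Cod (concrete_category X U H) f = Dom (concrete_category X U H) g"
  then show "Cmp (concrete_category X U H) h (Cmp (concrete_category X U H) g f) =
      Cmp (concrete_category X U H) (Cmp (concrete_category X U H) h g) f"
    by (intro arrow.equality) (auto simp: concrete_category_def compose_def fun_eq_iff PiE_def Pi_def)
qed (use assms in \<open>auto simp: concrete_category_def compose_def PiE_def Pi_def extensional_def\<close>)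

lemma category_functor_category:
  assumes "category C" "category D"
  shows "category (functor_category C D)"
proof -
  interpret C: category C by fact
  interpret D: category D by fact
  show ?thesis
  proof
    fix \<tau> \<sigma> assume a: "\<tau> \<in> Arr (functor_category C D)" "\<sigma> \<in> Arr (functor_category C D)"
      "Cod (functor_category C D) \<tau> = Dom (functor_category C D) \<sigma>"
    then have t: "is_nat_trans C D \<tau>" "is_nat_trans C D \<sigma>" "src \<sigma> = tgt \<tau>"
      by (auto simp: functor_category_def)
    have 1: "dat \<tau> x \<in> Arr D \<and> dat \<sigma> x \<in> Arr D \<and> Cod D (dat \<tau> x) = Dom D (dat \<sigma> x)" if "x \<in> Obj C" for x
      using t that by (auto simp: is_nat_trans_def)
    have 2: "Cmp D (Cmp D (dat \<sigma> (Cod C f)) (dat \<tau> (Cod C f))) (on_arr (src \<tau>) f) =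
                 Cmp D (on_arr (tgt \<sigma>) f) (Cmp D (dat \<sigma> (Dom C f)) (dat \<tau> (Dom C f)))" 
      if f: "f \<in> Arr C" for f
    proof -
      have T: "on_arr (src \<tau>) f \<in> Arr D" "on_arr (tgt \<tau>) f \<in> Arr D" "on_arr (tgt \<sigma>) f \<in> Arr D"
        "Dom D (on_arr (src \<tau>) f) = on_obj (src \<tau>) (Dom C f)"
        "Cod D (on_arr (src \<tau>) f) = on_obj (src \<tau>) (Cod C f)"
        "Dom D (on_arr (tgt \<tau>) f) = on_obj (tgt \<tau>) (Dom C f)"
        "Cod D (on_arr (tgt \<tau>) f) = on_obj (tgt \<tau>) (Cod C f)"
        "Dom D (on_arr (tgt \<sigma>) f) = on_obj (tgt \<sigma>) (Dom C f)"
        using t f by (auto simp: is_nat_trans_def is_functor_def)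
      have N: "Cmp D (dat \<tau> (Cod C f)) (on_arr (src \<tau>) f) = Cmp D (on_arr (tgt \<tau>) f) (dat \<tau> (Dom C f))"
        "Cmp D (dat \<sigma> (Cod C f)) (on_arr (tgt \<tau>) f) = Cmp D (on_arr (tgt \<sigma>) f) (dat \<sigma> (Dom C f))"
        using t f by (auto simp: is_nat_trans_def)
      have O: "dat \<tau> x \<in> Arr D" "dat \<sigma> x \<in> Arr D" "Dom D (dat \<tau> x) = on_obj (src \<tau>) x"
        "Cod D (dat \<tau> x) = on_obj (tgt \<tau>) x" "Dom D (dat \<sigma> x) = on_obj (tgt \<tau>) x"
        "Cod D (dat \<sigma> x) = on_obj (tgt \<sigma>) x" if "x \<in> Obj C" for x
        using t that by (auto simp: is_nat_trans_def)
      note O' = O[OF C.dom_in[OF f]] O[OF C.cod_in[OF f]]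
      \<comment> \<open>Pasting of two squares: associated to the right, the square of \<tau>
        applies; associated to the left, that of \<sigma>.\<close>
      show ?thesis
        by (simp add: D.cmp_assoc[symmetric] T O' N) (simp add: D.cmp_assoc T O' N)
    qed
    show "Cmp (functor_category C D) \<sigma> \<tau> \<in> Arr (functor_category C D)"
      using t 1 2 C.dom_in C.cod_in
      by (auto simp: functor_category_def is_nat_trans_def D.cmp_in D.dom_cmp D.cod_cmp)
    show "Dom (functor_category C D) (Cmp (functor_category C D) \<sigma> \<tau>) = Dom (functor_category C D) \<tau>"
      "Cod (functor_category C D) (Cmp (functor_category C D) \<sigma> \<tau>) = Cod (functor_category C D) \<sigma>"
      by (simp_all add: functor_category_def)
    fix \<rho> assume "\<rho> \<in> Arr (functor_category C D)" "Cod (functor_category C D) \<sigma> = Dom (functor_category C D) \<rho>"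
    then have r: "is_nat_trans C D \<rho>" "tgt \<sigma> = src \<rho>"
      by (auto simp: functor_category_def)
    have 3: "dat \<rho> x \<in> Arr D \<and> Cod D (dat \<sigma> x) = Dom D (dat \<rho> x)" if "x \<in> Obj C" for x
      using r t that by (auto simp: is_nat_trans_def)
    show "Cmp (functor_category C D) \<rho> (Cmp (functor_category C D) \<sigma> \<tau>) =
       Cmp (functor_category C D) (Cmp (functor_category C D) \<rho> \<sigma>) \<tau>"
      using 1 3 by (auto simp: functor_category_def fun_eq_iff D.cmp_assoc)
  next
    fix F assume "F \<in> Obj (functor_category C D)"
    then have F: "is_functor C D F" by (simp add: functor_category_def)
    have O: "on_obj F x \<in> Obj D" if "x \<in> Obj C" for x
      using F that by (auto simp: is_functor_def)
    have A: "on_arr F f \<in> Arr D" "Dom D (on_arr F f) = on_obj F (Dom C f)"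
      "Cod D (on_arr F f) = on_obj F (Cod C f)" if "f \<in> Arr C" for f
      using F that by (auto simp: is_functor_def)
    have "Cmp D (Idn D (on_obj F (Cod C f))) (on_arr F f) = Cmp D (on_arr F f) (Idn D (on_obj F (Dom C f)))"
      if "f \<in> Arr C" for f
      using A[OF that] D.cmp_idn_left D.cmp_idn_right by metis
    then show "Idn (functor_category C D) F \<in> Arr (functor_category C D)"
      using F O D.idn_in D.dom_idn D.cod_idn C.dom_in C.cod_in
      by (auto simp: functor_category_def is_nat_trans_def)
  next
    fix \<tau> assume "\<tau> \<in> Arr (functor_category C D)"
    then have t: "is_nat_trans C D \<tau>" by (simp add: functor_category_def)
    have "dat \<tau> x \<in> Arr D" "Dom D (dat \<tau> x) = on_obj (src \<tau>) x" "Cod D (dat \<tau> x) = on_obj (tgt \<tau>) x"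
      if "x \<in> Obj C" for x
      using t that by (auto simp: is_nat_trans_def)
    note 1 = this D.cmp_idn_left D.cmp_idn_right
    have 2: "dat \<tau> x = undefined" if "x \<notin> Obj C" for x
      using t that by (auto simp: is_nat_trans_def)
    show "Cmp (functor_category C D) \<tau> (Idn (functor_category C D) (Dom (functor_category C D) \<tau>)) = \<tau>"
      by (intro arrow.equality) (auto simp: functor_category_def fun_eq_iff 2, metis 1)
    show "Cmp (functor_category C D) (Idn (functor_category C D) (Cod (functor_category C D) \<tau>)) \<tau> = \<tau>"
      by (intro arrow.equality) (auto simp: functor_category_def fun_eq_iff 2, metis 1)
  qed (auto simp: functor_category_def is_nat_trans_def)
qed

section \<open>Hom-sets and a criterion for equivalence\<close>

text \<open>Bundles the side conditions of \<open>Cmp\<close> into one fact, so that composability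
  can be passed on by \<open>OF\<close>.\<close>

definition in_hom :: "('o, 'a) category \<Rightarrow> 'o \<Rightarrow> 'o \<Rightarrow> 'a \<Rightarrow> bool" where
  "in_hom C x y f \<longleftrightarrow> f \<in> Arr C \<and> Dom C f = x \<and> Cod C f = y"

context category
begin

lemma in_hom_cmp: "in_hom C x y f \<Longrightarrow> in_hom C y z g \<Longrightarrow> in_hom C x z (Cmp C g f)"
  by (auto simp: in_hom_def cmp_in dom_cmp cod_cmp)

lemma in_hom_idn: "x \<in> Obj C \<Longrightarrow> in_hom C x x (Idn C x)"
  by (auto simp: in_hom_def idn_in dom_idn cod_idn)

lemma in_hom_assoc:
  "in_hom C w x f \<Longrightarrow> in_hom C x y g \<Longrightarrow> in_hom C y z h \<Longrightarrow> Cmp C h (Cmp C g f) = Cmp C (Cmp C h g) f"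
  by (auto simp: in_hom_def cmp_assoc)

lemma in_hom_idn_left: "in_hom C x y f \<Longrightarrow> Cmp C (Idn C y) f = f"
  using cmp_idn_left by (auto simp: in_hom_def)

lemma in_hom_idn_right: "in_hom C x y f \<Longrightarrow> Cmp C f (Idn C x) = f"
  using cmp_idn_right by (auto simp: in_hom_def)

lemma in_hom_ObjD: "in_hom C x y f \<Longrightarrow> x \<in> Obj C \<and> y \<in> Obj C"
  by (auto simp: in_hom_def dom_in cod_in)

lemma in_hom_cancel_left:
  assumes "in_hom C x y f" "in_hom C y z g" "in_hom C z y g'" "Cmp C g' g = Idn C y"
  shows "Cmp C g' (Cmp C g f) = f"
  using assms by (simp add: in_hom_assoc in_hom_idn_left)

end

lemma is_functor_in_hom:
  "is_functor C D F \<Longrightarrow> in_hom C x y f \<Longrightarrow> in_hom D (on_obj F x) (on_obj F y) (on_arr F f)"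
  by (auto simp: is_functor_def in_hom_def)

lemma is_functor_obj: "is_functor C D F \<Longrightarrow> x \<in> Obj C \<Longrightarrow> on_obj F x \<in> Obj D"
  by (auto simp: is_functor_def)

lemma is_functor_idn: "is_functor C D F \<Longrightarrow> x \<in> Obj C \<Longrightarrow> on_arr F (Idn C x) = Idn D (on_obj F x)"
  by (auto simp: is_functor_def)

lemma is_functor_cmp:
  "is_functor C D F \<Longrightarrow> in_hom C x y f \<Longrightarrow> in_hom C y z g \<Longrightarrow>
     on_arr F (Cmp C g f) = Cmp D (on_arr F g) (on_arr F f)"
  by (auto simp: is_functor_def in_hom_def)

lemma is_functor_id_functor: "category C \<Longrightarrow> is_functor C C (id_functor C)"
  by (auto simp: is_functor_def id_functor_def category_def)

lemma is_functor_comp_functor: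
  assumes "category C" "is_functor C D F" "is_functor D E G"
  shows "is_functor C E (comp_functor C G F)"
  using assms unfolding category_def is_functor_def comp_functor_def by (auto simp: compose_def PiE_def Pi_def)

lemma is_isoI:
  assumes "in_hom C x y f" "in_hom C y x g" "Cmp C g f = Idn C x" "Cmp C f g = Idn C y"
  shows "is_iso C f"
  using assms unfolding in_hom_def is_iso_def by auto

text \<open>A quasi-inverse is chosen: \<open>K d\<close> is a preimage of \<open>d\<close> up to
  the isomorphism \<open>\<epsilon> d\<close>, and an arrow \<open>g\<close> goes to the lift of its
  conjugate \<open>T g\<close>. Equations between arrows of \<open>C\<close> are proved by applying
  the faithful \<open>F\<close>.\<close>

theorem equivalent_categoriesI:
  assumes C: "category C" and D: "category D" and F: "is_functor C D F"
    and full: "\<And>x y g. \<lbrakk>x \<in> Obj C; y \<in> Obj C; in_hom D (on_obj F x) (on_obj F y) g\<rbrakk>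
           \<Longrightarrow> \<exists>f. in_hom C x y f \<and> on_arr F f = g"
    and faithful: "\<And>x y f f'. \<lbrakk>in_hom C x y f; in_hom C x y f'; on_arr F f = on_arr F f'\<rbrakk> \<Longrightarrow> f = f'"
    and surj: "\<And>d. d \<in> Obj D \<Longrightarrow> \<exists>x\<in>Obj C. \<exists>g. is_iso D g \<and> in_hom D (on_obj F x) d g"
  shows "equivalent_categories C D"
proof -
  interpret C: category C by fact
  interpret D: category D by fact
  have "\<exists>x g g'. x \<in> Obj C \<and> in_hom D (on_obj F x) d g \<and> in_hom D d (on_obj F x) g' \<and>
      Cmp D g' g = Idn D (on_obj F x) \<and> Cmp D g g' = Idn D d" if "d \<in> Obj D" for d
    using surj[OF that] unfolding is_iso_def in_hom_def by metis
  then have "\<exists>K \<epsilon> \<epsilon>'. \<forall>d\<in>Obj D. K d \<in> Obj C \<and> in_hom D (on_obj F (K d)) d (\<epsilon> d) \<and>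
      in_hom D d (on_obj F (K d)) (\<epsilon>' d) \<and>
      Cmp D (\<epsilon>' d) (\<epsilon> d) = Idn D (on_obj F (K d)) \<and> Cmp D (\<epsilon> d) (\<epsilon>' d) = Idn D d"
    by metis
  then obtain K \<epsilon> \<epsilon>' where K: "\<And>d. d \<in> Obj D \<Longrightarrow> K d \<in> Obj C"
    and e: "\<And>d. d \<in> Obj D \<Longrightarrow> in_hom D (on_obj F (K d)) d (\<epsilon> d)"
    and e': "\<And>d. d \<in> Obj D \<Longrightarrow> in_hom D d (on_obj F (K d)) (\<epsilon>' d)"
    and e'e: "\<And>d. d \<in> Obj D \<Longrightarrow> Cmp D (\<epsilon>' d) (\<epsilon> d) = Idn D (on_obj F (K d))"
    and ee': "\<And>d. d \<in> Obj D \<Longrightarrow> Cmp D (\<epsilon> d) (\<epsilon>' d) = Idn D d"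
    by blast
  define L where "L x y g = (SOME f. in_hom C x y f \<and> on_arr F f = g)" for x y g
  have L: "in_hom C x y (L x y g)" "on_arr F (L x y g) = g"
    if "x \<in> Obj C" "y \<in> Obj C" "in_hom D (on_obj F x) (on_obj F y) g" for x y g
    using someI_ex[OF full[OF that]] unfolding L_def by auto
  define T where "T g = Cmp D (\<epsilon>' (Cod D g)) (Cmp D g (\<epsilon> (Dom D g)))" for g
  have TT: "in_hom D (on_obj F (K x)) (on_obj F (K y)) (T g)" if "in_hom D x y g" for x y g
  proof -
    have o: "x \<in> Obj D" "y \<in> Obj D" "Dom D g = x" "Cod D g = y"
      using D.in_hom_ObjD[OF that] that by (auto simp: in_hom_def)
    show ?thesis
      unfolding T_def o by (rule D.in_hom_cmp[OF D.in_hom_cmp[OF e[OF o(1)] that] e'[OF o(2)]])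
  qed
  have eT: "Cmp D (\<epsilon> y) (T g) = Cmp D g (\<epsilon> x)" if g: "in_hom D x y g" for x y g
  proof -
    have o: "x \<in> Obj D" "y \<in> Obj D" "Dom D g = x" "Cod D g = y"
      using D.in_hom_ObjD[OF g] g by (auto simp: in_hom_def)
    show ?thesis unfolding T_def o
      using D.in_hom_cancel_left[OF D.in_hom_cmp[OF e[OF o(1)] g] e'[OF o(2)] e[OF o(2)] ee'[OF o(2)]] .
  qed
  \<comment> \<open>The square with \<epsilon> characterises \<open>T g\<close>, so that
    \<open>T\<close> respects identities and composition as soon as the corresponding squares
    commute.\<close>
  have T_uniq: "h = T g" if g: "in_hom D x y g" and h: "in_hom D (on_obj F (K x)) (on_obj F (K y)) h"
    "Cmp D (\<epsilon> y) h = Cmp D g (\<epsilon> x)" for x y g h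
  proof -
    have o: "x \<in> Obj D" "y \<in> Obj D" "Dom D g = x" "Cod D g = y"
      using D.in_hom_ObjD[OF g] g by (auto simp: in_hom_def)
    have "h = Cmp D (\<epsilon>' y) (Cmp D (\<epsilon> y) h)"
      using D.in_hom_cancel_left[OF h(1) e[OF o(2)] e'[OF o(2)] e'e[OF o(2)]] by simp
    then show ?thesis by (simp add: h(2) T_def o)
  qed
  define G where "G = \<lparr>on_obj = (\<lambda>d\<in>Obj D. K d),
    on_arr = (\<lambda>g\<in>Arr D. L (K (Dom D g)) (K (Cod D g)) (T g))\<rparr>"
  have Gh: "in_hom C (K x) (K y) (on_arr G g)" "on_arr F (on_arr G g) = T g" if g: "in_hom D x y g" for x y g
  proof -
    have o: "x \<in> Obj D" "y \<in> Obj D" "Dom D g = x" "Cod D g = y" "g \<in> Arr D"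
      using D.in_hom_ObjD[OF g] g by (auto simp: in_hom_def)
    show "in_hom C (K x) (K y) (on_arr G g)" "on_arr F (on_arr G g) = T g"
      using L[OF K[OF o(1)] K[OF o(2)] TT[OF g]] o by (simp_all add: G_def)
  qed
  have Go: "on_obj G d = K d" if "d \<in> Obj D" for d
    using that by (simp add: G_def)
  have G_id: "on_arr G (Idn D d) = Idn C (K d)" if d: "d \<in> Obj D" for d
  proof (rule faithful)
    show "in_hom C (K d) (K d) (on_arr G (Idn D d))" using Gh(1)[OF D.in_hom_idn[OF d]] .
    show i: "in_hom C (K d) (K d) (Idn C (K d))" using C.in_hom_idn[OF K[OF d]] .
    have "on_arr F (Idn C (K d)) = T (Idn D d)"
      using e[OF d] by (intro T_uniq[OF D.in_hom_idn[OF d] is_functor_in_hom[OF F i]])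
        (simp add: is_functor_idn[OF F K[OF d]] D.in_hom_idn_left D.in_hom_idn_right)
    then show "on_arr F (on_arr G (Idn D d)) = on_arr F (Idn C (K d))"
      by (simp add: Gh[OF D.in_hom_idn[OF d]])
  qed
  have G_cmp: "on_arr G (Cmp D g f) = Cmp C (on_arr G g) (on_arr G f)"
    if f: "in_hom D x y f" and g: "in_hom D y z g" for x y z f g
  proof (rule faithful)
    note gf = D.in_hom_cmp[OF f g]
    show "in_hom C (K x) (K z) (on_arr G (Cmp D g f))" using Gh(1)[OF gf] .
    show i: "in_hom C (K x) (K z) (Cmp C (on_arr G g) (on_arr G f))" using C.in_hom_cmp[OF Gh(1)[OF f] Gh(1)[OF g]] .
    have o: "x \<in> Obj D" "y \<in> Obj D" "z \<in> Obj D"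
      using D.in_hom_ObjD[OF f] D.in_hom_ObjD[OF g] by auto
    have "Cmp D (T g) (T f) = T (Cmp D g f)"
      using D.in_hom_assoc[OF TT[OF f] TT[OF g] e[OF o(3)]] D.in_hom_assoc[OF TT[OF f] e[OF o(2)] g]
        D.in_hom_assoc[OF e[OF o(1)] f g] eT[OF f] eT[OF g]
      by (intro T_uniq[OF gf D.in_hom_cmp[OF TT[OF f] TT[OF g]]]) simp
    then show "on_arr F (on_arr G (Cmp D g f)) = on_arr F (Cmp C (on_arr G g) (on_arr G f))"
      by (simp add: is_functor_cmp[OF F Gh(1)[OF f] Gh(1)[OF g]] Gh(2)[OF gf] Gh(2)[OF f] Gh(2)[OF g])
  qed
  have hom: "in_hom D (Dom D g) (Cod D g) g" if "g \<in> Arr D" for g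
    using that by (simp add: in_hom_def)
  have homC: "in_hom C (Dom C g) (Cod C g) g" if "g \<in> Arr C" for g
    using that by (simp add: in_hom_def)
  have G: "is_functor D C G"
    unfolding is_functor_def
  proof (intro conjI ballI impI)
    show "on_obj G \<in> Obj D \<rightarrow>\<^sub>E Obj C" using K by (auto simp: G_def)
    show "on_arr G \<in> Arr D \<rightarrow>\<^sub>E Arr C"
      using Gh(1)[OF hom] by (auto simp: G_def in_hom_def)
    fix f assume f: "f \<in> Arr D"
    show "Dom C (on_arr G f) = on_obj G (Dom D f)" "Cod C (on_arr G f) = on_obj G (Cod D f)"
      using Gh(1)[OF hom[OF f]] f by (auto simp: in_hom_def Go D.dom_in D.cod_in)
    fix g assume g: "g \<in> Arr D" "Cod D f = Dom D g"
    show "on_arr G (Cmp D g f) = Cmp C (on_arr G g) (on_arr G f)"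
      using G_cmp f g by (auto simp: in_hom_def)
  qed (simp add: G_id Go)
  \<comment> \<open>The unit at \<open>x\<close> is the lift of the inverse of the counit at
    \<open>F x\<close>, as a triangle identity demands.\<close>
  define \<eta> where "\<eta> x = L x (K (on_obj F x)) (\<epsilon>' (on_obj F x))" for x
  define \<eta>' where "\<eta>' x = L (K (on_obj F x)) x (\<epsilon> (on_obj F x))" for x
  have Fo: "on_obj F x \<in> Obj D" if "x \<in> Obj C" for x using is_functor_obj[OF F that] .
  have h: "in_hom C x (K (on_obj F x)) (\<eta> x)" "on_arr F (\<eta> x) = \<epsilon>' (on_obj F x)"
    "in_hom C (K (on_obj F x)) x (\<eta>' x)" "on_arr F (\<eta>' x) = \<epsilon> (on_obj F x)" if "x \<in> Obj C" for x
    using L[OF that K[OF Fo[OF that]] e'[OF Fo[OF that]]] L[OF K[OF Fo[OF that]] that e[OF Fo[OF that]]]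
    unfolding \<eta>_def \<eta>'_def by auto
  have h_iso: "is_iso C (\<eta> x)" if x: "x \<in> Obj C" for x
  proof (rule is_isoI[OF h(1)[OF x] h(3)[OF x]])
    show "Cmp C (\<eta>' x) (\<eta> x) = Idn C x"
      using x by (intro faithful[OF C.in_hom_cmp[OF h(1)[OF x] h(3)[OF x]] C.in_hom_idn[OF x]])
        (simp add: is_functor_cmp[OF F h(1) h(3)] is_functor_idn[OF F] h ee' Fo)
    show "Cmp C (\<eta> x) (\<eta>' x) = Idn C (K (on_obj F x))"
      using x by (intro faithful[OF C.in_hom_cmp[OF h(3)[OF x] h(1)[OF x]] C.in_hom_idn[OF K[OF Fo[OF x]]]])
        (simp add: is_functor_cmp[OF F h(3) h(1)] is_functor_idn[OF F] K h e'e Fo)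
  qed
  have h_nat: "Cmp C (\<eta> y) f = Cmp C (on_arr G (on_arr F f)) (\<eta> x)" if f: "in_hom C x y f" for x y f
  proof (rule faithful)
    have o: "x \<in> Obj C" "y \<in> Obj C" using C.in_hom_ObjD[OF f] by auto
    note Ff = is_functor_in_hom[OF F f]
    note GFf = Gh[OF Ff]
    show "in_hom C x (K (on_obj F y)) (Cmp C (\<eta> y) f)" using C.in_hom_cmp[OF f h(1)[OF o(2)]] .
    show "in_hom C x (K (on_obj F y)) (Cmp C (on_arr G (on_arr F f)) (\<eta> x))"
      using C.in_hom_cmp[OF h(1)[OF o(1)] GFf(1)] .
    have d: "Dom D (on_arr F f) = on_obj F x" "Cod D (on_arr F f) = on_obj F y"
      using Ff by (auto simp: in_hom_def)
    have "Cmp D (T (on_arr F f)) (\<epsilon>' (on_obj F x)) = Cmp D (\<epsilon>' (on_obj F y)) (on_arr F f)"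
      unfolding T_def d
      using D.in_hom_assoc[OF e'[OF Fo[OF o(1)]] D.in_hom_cmp[OF e[OF Fo[OF o(1)]] Ff] e'[OF Fo[OF o(2)]]]
        D.in_hom_assoc[OF e'[OF Fo[OF o(1)]] e[OF Fo[OF o(1)]] Ff] ee'[OF Fo[OF o(1)]]
        D.in_hom_idn_right[OF Ff]
      by simp
    then show "on_arr F (Cmp C (\<eta> y) f) = on_arr F (Cmp C (on_arr G (on_arr F f)) (\<eta> x))"
      by (simp add: is_functor_cmp[OF F f h(1)[OF o(2)]] is_functor_cmp[OF F h(1)[OF o(1)] GFf(1)] GFf(2) h o)
  qed
  have "is_nat_trans C C \<lparr>src = id_functor C, dat = (\<lambda>x\<in>Obj C. \<eta> x), tgt = comp_functor C G F\<rparr>"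
    unfolding is_nat_trans_def
  proof (intro conjI ballI)
    fix x assume x: "x \<in> Obj C"
    show "Dom C (dat \<lparr>src = id_functor C, dat = (\<lambda>x\<in>Obj C. \<eta> x), tgt = comp_functor C G F\<rparr> x)
        = on_obj (src \<lparr>src = id_functor C, dat = (\<lambda>x\<in>Obj C. \<eta> x), tgt = comp_functor C G F\<rparr>) x"
      using h(1)[OF x] x by (simp add: in_hom_def id_functor_def)
    show "Cod C (dat \<lparr>src = id_functor C, dat = (\<lambda>x\<in>Obj C. \<eta> x), tgt = comp_functor C G F\<rparr> x)
        = on_obj (tgt \<lparr>src = id_functor C, dat = (\<lambda>x\<in>Obj C. \<eta> x), tgt = comp_functor C G F\<rparr>) x"
      using h(1)[OF x] x by (simp add: in_hom_def comp_functor_def compose_def Go Fo)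
  next
    show "dat \<lparr>src = id_functor C, dat = (\<lambda>x\<in>Obj C. \<eta> x), tgt = comp_functor C G F\<rparr> \<in> Obj C \<rightarrow>\<^sub>E Arr C"
      using h(1) by (auto simp: in_hom_def)
  qed (use is_functor_id_functor[OF C] is_functor_comp_functor[OF C F G] h_nat[OF homC] in
        \<open>simp_all add: C.dom_in C.cod_in id_functor_def comp_functor_def compose_def\<close>)
  then have n1: "naturally_isomorphic C C (id_functor C) (comp_functor C G F)"
    unfolding naturally_isomorphic_def
    by (intro exI[of _ "\<lparr>src = id_functor C, dat = (\<lambda>x\<in>Obj C. \<eta> x), tgt = comp_functor C G F\<rparr>"])
      (simp add: h_iso)
  have "is_nat_trans D D \<lparr>src = comp_functor D F G, dat = (\<lambda>x\<in>Obj D. \<epsilon> x), tgt = id_functor D\<rparr>"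
    unfolding is_nat_trans_def
  proof (intro conjI ballI)
    fix x assume x: "x \<in> Obj D"
    show "Dom D (dat \<lparr>src = comp_functor D F G, dat = (\<lambda>x\<in>Obj D. \<epsilon> x), tgt = id_functor D\<rparr> x)
        = on_obj (src \<lparr>src = comp_functor D F G, dat = (\<lambda>x\<in>Obj D. \<epsilon> x), tgt = id_functor D\<rparr>) x"
      using e[OF x] x by (simp add: in_hom_def comp_functor_def compose_def Go)
    show "Cod D (dat \<lparr>src = comp_functor D F G, dat = (\<lambda>x\<in>Obj D. \<epsilon> x), tgt = id_functor D\<rparr> x)
        = on_obj (tgt \<lparr>src = comp_functor D F G, dat = (\<lambda>x\<in>Obj D. \<epsilon> x), tgt = id_functor D\<rparr>) x"
      using e[OF x] x by (simp add: in_hom_def id_functor_def)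
  next
    show "dat \<lparr>src = comp_functor D F G, dat = (\<lambda>x\<in>Obj D. \<epsilon> x), tgt = id_functor D\<rparr> \<in> Obj D \<rightarrow>\<^sub>E Arr D"
      using e by (auto simp: in_hom_def)
  qed (use is_functor_id_functor[OF D] is_functor_comp_functor[OF D G F] eT[OF hom] Gh(2)[OF hom] in
        \<open>simp_all add: D.dom_in D.cod_in id_functor_def comp_functor_def compose_def\<close>)
  then have n2: "naturally_isomorphic D D (comp_functor D F G) (id_functor D)"
    unfolding naturally_isomorphic_def
    by (intro exI[of _ "\<lparr>src = comp_functor D F G, dat = (\<lambda>x\<in>Obj D. \<epsilon> x), tgt = id_functor D\<rparr>"])
      (simp add: is_isoI[OF e e' e'e ee'])
  show ?thesis
    unfolding equivalent_categories_def using C D F G n1 n2 by blast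
qed

section \<open>Abelian groups from Bousfield \<open>\<Gamma>\<close>-sets\<close>

text \<open>The product is a - (0 - b).\<close>

definition subtraction_group :: "'a set \<Rightarrow> ('a \<Rightarrow> 'a \<Rightarrow> 'a) \<Rightarrow> 'a \<Rightarrow> 'a monoid" where
  "subtraction_group A d e = \<lparr>carrier = A, mult = (\<lambda>a b. d (d b e) a), one = e\<rparr>"

text \<open>\<open>d a b\<close> stands for \<open>b - a\<close>.\<close>

locale subtraction =
  fixes A :: "'a set" and d :: "'a \<Rightarrow> 'a \<Rightarrow> 'a" and e :: 'a
  assumes e_in: "e \<in> A"
    and d_in: "\<lbrakk>a \<in> A; b \<in> A\<rbrakk> \<Longrightarrow> d a b \<in> A"
    and d_self: "a \<in> A \<Longrightarrow> d a a = e"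
    and d_e_left: "a \<in> A \<Longrightarrow> d e a = a"
    and d_d_d: "\<lbrakk>a \<in> A; b \<in> A; c \<in> A\<rbrakk> \<Longrightarrow> d (d a b) (d a c) = d b c"
    and d_d_right: "\<lbrakk>a \<in> A; b \<in> A\<rbrakk> \<Longrightarrow> d (d a b) b = a"
begin

lemma add_d: "\<lbrakk>a \<in> A; b \<in> A\<rbrakk> \<Longrightarrow> d (d a e) (d a b) = b"
  by (simp add: d_d_d d_e_left e_in)

lemma d_left_cancel:
  assumes "a \<in> A" "b \<in> A" "b' \<in> A" "d a b = d a b'" shows "b = b'"
proof -
  have "b = d (d a e) (d a b)" by (rule add_d[OF assms(1,2), symmetric])
  also have "\<dots> = b'" unfolding assms(4) by (rule add_d[OF assms(1,3)])
  finally show ?thesis .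
qed

lemma d_swap: "\<lbrakk>a \<in> A; b \<in> A\<rbrakk> \<Longrightarrow> d (d a b) e = d b a"
  using d_d_d[of a b a] by (simp add: d_self)

text \<open>In any group, d a b = a^-1 b satisfies all axioms of the locale except
  \<open>d_d_right\<close>, which then reads b^-1 a b = a. Commutativity therefore has to be drawn
  from that axiom.\<close>

lemma comm_group_subtraction_group: "comm_group (subtraction_group A d e)"
proof (intro comm_groupI; simp only: subtraction_group_def partial_object.simps monoid.simps)
  fix a b c assume abc: "a \<in> A" "b \<in> A" "c \<in> A"
  \<comment> \<open>\<open>y\<close> is -(b + c). Translation by b carries \<open>y\<close> to -c
    and \<open>a\<close> to a + b, and by \<open>d_d_d\<close> differences are invariant under
    translation.\<close>
  define y where "y = d b (d c e)"
  have "d (d b e) y = d c e"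
    using abc by (simp add: y_def d_d_d d_in e_in d_e_left)
  then have "d (d c e) (d (d b e) a) = d y a"
    using abc d_d_d[of "d b e" y a] by (simp add: y_def d_in e_in)
  moreover have "d (d (d c e) b) e = y"
    using abc by (simp add: d_swap y_def d_in e_in)
  ultimately show "d (d c e) (d (d b e) a) = d (d (d (d c e) b) e) a" by simp
next
  fix a b assume ab: "a \<in> A" "b \<in> A"
  \<comment> \<open>\<open>z\<close> is a + b. From z - b = a, \<open>d_d_right\<close> gives z - a
    = b, so that \<open>z\<close> is also b + a.\<close>
  define z where "z = d (d b e) a"
  have z: "z \<in> A" using ab by (simp add: z_def d_in e_in)
  have "d b z = a"
    using ab d_d_d[of "d b e" e a] by (simp add: z_def d_in e_in d_e_left d_d_right)
  then have "d a z = b" using d_d_right[of b z] ab z by simp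
  then have "d (d a e) b = z" using add_d[of a z] ab z by simp
  then show "d (d b e) a = d (d a e) b" by (simp add: z_def)
next
  fix a assume a: "a \<in> A"
  show "\<exists>b\<in>A. d (d a e) b = e" using a by (intro bexI[of _ "d a e"]) (simp_all add: d_self d_in e_in)
qed (auto simp: d_in e_in d_d_right)

text \<open>Additivity over disjoint unions, expressed by subtraction: \<open>U\<close> is the
  disjoint union of \<open>T\<close> and \<open>U - T\<close>.\<close>

definition additive :: "nat \<Rightarrow> (nat set \<Rightarrow> 'a) \<Rightarrow> bool" where
  "additive n P \<longleftrightarrow> (\<forall>T\<subseteq>{1..n}. P T \<in> A) \<and> (\<forall>T U. T \<subseteq> U \<longrightarrow> U \<subseteq> {1..n} \<longrightarrow> d (P T) (P U) = P (U - T))"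

lemma additive_in: "additive n P \<Longrightarrow> T \<subseteq> {1..n} \<Longrightarrow> P T \<in> A"
  by (simp add: additive_def)

lemma additive_diff: "additive n P \<Longrightarrow> T \<subseteq> U \<Longrightarrow> U \<subseteq> {1..n} \<Longrightarrow> d (P T) (P U) = P (U - T)"
  by (simp add: additive_def)

lemma additive_empty: "additive n P \<Longrightarrow> P {} = e"
  using additive_diff[of n P "{}" "{}"] additive_in[of n P "{}"] by (simp add: d_self)

text \<open>Singletons are differences of consecutive initial segments, and adjoining one element to
  a set changes the value by that of a singleton. Since \<open>d\<close> is cancellable, agreement
  spreads from initial segments to all subsets.\<close>

lemma additive_eqI:
  assumes P: "additive n P" and Q: "additive n Q"
    and eq: "\<And>k. k < n \<Longrightarrow> P {1..k+1} = Q {1..k+1}" and T: "T \<subseteq> {1..n}"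
  shows "P T = Q T"
proof -
  \<comment> \<open>The hypothesis starts at {1}; the empty segment is also needed, because {1} is
    {1} minus the empty set, and has value \<open>e\<close>.\<close>
  have init: "P {1..k} = Q {1..k}" if "k \<le> n" for k
    using that eq[of "k - 1"] additive_empty[OF P] additive_empty[OF Q] by (cases k) auto
  have single: "P {i} = Q {i}" if "i \<in> {1..n}" for i
  proof -
    have *: "{i} = {1..i} - {1..i-1}" using that by auto
    show ?thesis
      unfolding * using that additive_diff[OF P, of "{1..i-1}" "{1..i}"]
        additive_diff[OF Q, of "{1..i-1}" "{1..i}"] init[of i] init[of "i-1"] by auto
  qed
  have "finite T" using T finite_subset by blast
  then show ?thesis
    using T
  proof (induction T)
    case empty
    then show ?case using additive_empty[OF P] additive_empty[OF Q] by simp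
  next
    case (insert i T)
    then have *: "insert i T - T = {i}" by auto
    have "d (P T) (P (insert i T)) = P {i}" "d (Q T) (Q (insert i T)) = Q {i}"
      using additive_diff[OF P, of T "insert i T"] additive_diff[OF Q, of T "insert i T"] insert.prems
      by (auto simp: *)
    moreover have "P T = Q T" "P {i} = Q {i}" using insert.IH insert.prems single[of i] by simp_all
    ultimately have "d (P T) (P (insert i T)) = d (P T) (Q (insert i T))" by simp
    then show ?case
      using insert.prems by (intro d_left_cancel[OF additive_in[OF P] additive_in[OF P] additive_in[OF Q]]) auto
  qed
qed

end

text \<open>Makes \<open>additive\<close> and \<open>additive_eqI\<close> available for functions
  with values in a given abelian group.\<close>

lemma (in comm_group) subtraction_carrier: "subtraction (carrier G) (\<lambda>a b. b \<otimes> inv a) \<one>"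
proof
  fix a b c assume abc: "a \<in> carrier G" "b \<in> carrier G" "c \<in> carrier G"
  have "inv a \<otimes> (a \<otimes> inv b) = inv b" using abc m_assoc[of "inv a" a "inv b"] by simp
  then show "c \<otimes> inv a \<otimes> inv (b \<otimes> inv a) = c \<otimes> inv b"
    using abc by (simp add: inv_mult_group m_assoc)
next
  fix a b assume ab: "a \<in> carrier G" "b \<in> carrier G"
  then show "b \<otimes> inv (b \<otimes> inv a) = a"
    using m_lcomm[of b a "inv b"] by (simp add: inv_mult_group)
qed simp_all

section \<open>Pointed maps and Bousfield \<Gamma>-sets\<close>

lemma mem_Arr_Gamma_op:
  "f \<in> Arr Gamma_op \<longleftrightarrow> dat f \<in> {..src f} \<rightarrow>\<^sub>E {..tgt f} \<and> dat f 0 = 0"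
  by (simp add: Gamma_op_def concrete_category_def)

text \<open>The base point goes to 0, which does not lie in \<open>T\<close>.\<close>

lemma preimage_subset:
  assumes "f \<in> Arr Gamma_op" "T \<subseteq> {1..tgt f}"
  shows "{i \<in> {..src f}. dat f i \<in> T} \<subseteq> {1..src f}"
proof
  fix i assume i: "i \<in> {i \<in> {..src f}. dat f i \<in> T}"
  then have "i \<noteq> 0" using assms by (auto simp: mem_Arr_Gamma_op intro: ccontr)
  then show "i \<in> {1..src f}" using i by simp
qed

text \<open>For \<open>T \<subseteq> {1..n}\<close> this corresponds to the morphism of \<Gamma>
  from 1 to n with 1 sent to \<open>T\<close>; all arrows from \<open>n\<close> to 1 have this
  form.\<close>

definition indicator_arrow :: "nat \<Rightarrow> nat set \<Rightarrow> nat_arrow" where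
  "indicator_arrow n T = \<lparr>src = n, dat = (\<lambda>i\<in>{..n}. if i \<in> T then 1 else 0), tgt = 1\<rparr>"

lemma indicator_arrow_simps [simp]:
  "src (indicator_arrow n T) = n" "tgt (indicator_arrow n T) = 1"
  "i \<le> n \<Longrightarrow> dat (indicator_arrow n T) i = (if i \<in> T then 1 else 0)"
  by (simp_all add: indicator_arrow_def)

lemma indicator_arrow_in: "T \<subseteq> {1..n} \<Longrightarrow> indicator_arrow n T \<in> Arr Gamma_op"
  by (auto simp: mem_Arr_Gamma_op indicator_arrow_def)

lemma j_op_eq: "j_op n k = indicator_arrow n {1..k+1}"
  by (simp add: j_op_def indicator_arrow_def)

lemma Cmp_indicator_arrow:
  assumes "f \<in> Arr Gamma_op"
  shows "Cmp Gamma_op (indicator_arrow (tgt f) T) f = indicator_arrow (src f) {i \<in> {..src f}. dat f i \<in> T}"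
  using assms
  by (auto simp: mem_Arr_Gamma_op Gamma_op_def concrete_category_def indicator_arrow_def compose_def fun_eq_iff)

text \<open>A strict Bousfield \<Gamma>-space in a single simplicial degree. Simplicial operators
  enter later, as maps between such \<Gamma>-sets.\<close>

locale gamma_set =
  fixes S :: "nat \<Rightarrow> 'a set" and act :: "nat_arrow \<Rightarrow> 'a \<Rightarrow> 'a"
  assumes act_in: "\<lbrakk>f \<in> Arr Gamma_op; x \<in> S (src f)\<rbrakk> \<Longrightarrow> act f x \<in> S (tgt f)"
    and act_idn: "x \<in> S n \<Longrightarrow> act (Idn Gamma_op n) x = x"
    and act_cmp: "\<lbrakk>f \<in> Arr Gamma_op; g \<in> Arr Gamma_op; tgt f = src g; x \<in> S (src f)\<rbrakk>
                    \<Longrightarrow> act (Cmp Gamma_op g f) x = act g (act f x)"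
    and S_0: "\<exists>p. S 0 = {p}"
    and bousfield: "2 \<le> n \<Longrightarrow> bij_betw (\<lambda>x. \<lambda>k\<in>{..<n}. act (j_op n k) x) (S n) ({..<n} \<rightarrow>\<^sub>E S 1)"
begin

definition val :: "nat \<Rightarrow> nat set \<Rightarrow> 'a \<Rightarrow> 'a" where
  "val n T = act (indicator_arrow n T)"

definition unit :: 'a where
  "unit = val 0 {} (the_elem (S 0))"

lemma val_in: "\<lbrakk>x \<in> S n; T \<subseteq> {1..n}\<rbrakk> \<Longrightarrow> val n T x \<in> S 1"
  unfolding val_def using act_in[OF indicator_arrow_in, of T n x] by simp

text \<open>An indicator after \<open>f\<close> is the indicator of the preimage. In terms of
  values, \<open>f\<close> therefore acts by reindexing along preimages.\<close>

lemma val_act: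
  assumes "f \<in> Arr Gamma_op" "T \<subseteq> {1..tgt f}" "x \<in> S (src f)"
  shows "val (tgt f) T (act f x) = val (src f) {i \<in> {..src f}. dat f i \<in> T} x"
  using assms act_cmp[of f "indicator_arrow (tgt f) T" x] indicator_arrow_in[of T "tgt f"]
  by (simp add: val_def Cmp_indicator_arrow)

text \<open>The indicator of the empty set factors through the object 0, and \<open>S 0\<close> is a
  point.\<close>

lemma val_empty:
  assumes "x \<in> S n" shows "val n {} x = unit"
proof -
  define z :: nat_arrow where "z = \<lparr>src = n, dat = (\<lambda>i\<in>{..n}. 0), tgt = 0\<rparr>"
  have z: "z \<in> Arr Gamma_op" "src z = n" "tgt z = 0" by (auto simp: z_def mem_Arr_Gamma_op)
  have "act z x \<in> S 0" using act_in[OF z(1)] assms z by simp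
  then have "act z x = the_elem (S 0)" using S_0 by auto
  then show ?thesis using val_act[OF z(1), of "{}" x] assms by (simp add: z unit_def)
qed

lemma unit_in: "unit \<in> S 1"
proof -
  obtain p where "S 0 = {p}" using S_0 by blast
  then have "the_elem (S 0) \<in> S 0" by simp
  from val_in[OF this] show ?thesis by (simp add: unit_def)
qed

lemma val_one:
  assumes "x \<in> S 1" shows "val 1 {1} x = x"
proof -
  have "Idn Gamma_op 1 = indicator_arrow 1 {1}"
    by (auto simp: Gamma_op_def concrete_category_def indicator_arrow_def fun_eq_iff restrict_def)
  then show ?thesis using act_idn[OF assms] by (simp add: val_def)
qed

text \<open>Injectivity in the Bousfield condition, extended to all \<open>n\<close>: for 0 there is
  just one element, and for 1 the indicator of {1} is the identity. \<open>ex_val\<close> does the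
  same for surjectivity.\<close>

lemma eqI:
  assumes "x \<in> S n" "y \<in> S n" "\<And>k. k < n \<Longrightarrow> val n {1..k+1} x = val n {1..k+1} y"
  shows "x = y"
proof -
  consider "n = 0" | "n = 1" | "2 \<le> n" by linarith
  then show ?thesis
  proof cases
    case 1 then show ?thesis using assms S_0 by auto
  next
    case 2 then show ?thesis using assms(3)[of 0] val_one assms(1,2) by simp
  next
    case 3
    have "(\<lambda>k\<in>{..<n}. act (j_op n k) x) = (\<lambda>k\<in>{..<n}. act (j_op n k) y)"
      using assms(3) by (auto simp: j_op_eq val_def fun_eq_iff restrict_def)
    then show ?thesis using bousfield[OF 3] assms(1,2) by (auto simp: bij_betw_def dest: inj_onD)
  qed
qed

lemma ex_val:
  assumes c: "\<And>k. k < n \<Longrightarrow> c k \<in> S 1"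
  shows "\<exists>x\<in>S n. \<forall>k<n. val n {1..k+1} x = c k"
proof -
  consider "n = 0" | "n = 1" | "2 \<le> n" by linarith
  then show ?thesis
  proof cases
    case 1 then show ?thesis using S_0 by auto
  next
    case 2 then show ?thesis using c[of 0] val_one by auto
  next
    case 3
    have "(\<lambda>k\<in>{..<n}. c k) \<in> (\<lambda>x. \<lambda>k\<in>{..<n}. act (j_op n k) x) ` S n"
      using bousfield[OF 3] c by (auto simp: bij_betw_def)
    then obtain x where x: "x \<in> S n" "(\<lambda>k\<in>{..<n}. c k) = (\<lambda>k\<in>{..<n}. act (j_op n k) x)" by auto
    have "val n {1..k+1} x = c k" if "k < n" for k
      using fun_cong[OF x(2), of k] that by (simp add: j_op_eq val_def)
    then show ?thesis using x(1) by auto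
  qed
qed

text \<open>The element described has partial sums \<open>a\<close> and \<open>b\<close>; its second
  summand is b - a.\<close>

definition diff :: "'a \<Rightarrow> 'a \<Rightarrow> 'a" where
  "diff a b = val 2 {2} (THE x. x \<in> S 2 \<and> val 2 {1} x = a \<and> val 2 {1,2} x = b)"

lemma initial_segments: "{1..0+1::nat} = {1}" "{1..1+1::nat} = {1,2}" "{1..2+1::nat} = {1,2,3}"
  by auto

lemma set_diffs: "{1,2} - {1} = {2::nat}" "{1,2} - {2} = {1::nat}" "{1,2,3} - {1} = {2,3::nat}"
    "{1,2,3} - {1,2} = {3::nat}" "{2,3} - {2} = {3::nat}"
  by auto

lemma eqI_2:
  assumes "x \<in> S 2" "y \<in> S 2" "val 2 {1} x = val 2 {1} y" "val 2 {1,2} x = val 2 {1,2} y"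
  shows "x = y"
proof (rule eqI[OF assms(1,2)])
  fix k :: nat assume "k < 2"
  then have "{1..k+1} = {1} \<or> {1..k+1} = {1,2}" by (cases k) (auto simp: less_Suc_eq)
  then show "val 2 {1..k+1} x = val 2 {1..k+1} y" using assms by auto
qed

text \<open>Collapsing \<open>T\<close> to 1, \<open>U - T\<close> to 2 and the rest to the base
  point turns any chain \<open>T \<subseteq> U\<close> into the chain {1}, {1,2} that defines
  \<open>diff\<close>.\<close>

lemma diff_val:
  assumes x: "x \<in> S n" and T: "T \<subseteq> U" "U \<subseteq> {1..n}"
  shows "diff (val n T x) (val n U x) = val n (U - T) x"
proof -
  define f :: nat_arrow where
    "f = \<lparr>src = n, dat = (\<lambda>i\<in>{..n}. if i \<in> T then 1 else if i \<in> U then 2 else 0), tgt = 2\<rparr>"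
  have f: "f \<in> Arr Gamma_op" "src f = n" "tgt f = 2"
    using T by (auto simp: f_def mem_Arr_Gamma_op)
  have y: "act f x \<in> S 2" using act_in[OF f(1)] x f by simp
  have "{i \<in> {..n}. dat f i \<in> {1}} = T" "{i \<in> {..n}. dat f i \<in> {1,2}} = U" "{i \<in> {..n}. dat f i \<in> {2}} = U - T"
    using T by (auto simp: f_def split: if_splits)
  then have v: "val 2 {1} (act f x) = val n T x" "val 2 {1,2} (act f x) = val n U x"
     "val 2 {2} (act f x) = val n (U - T) x"
    using val_act[OF f(1), of _ x] x f by (auto simp: subset_iff)
  have "(THE z. z \<in> S 2 \<and> val 2 {1} z = val n T x \<and> val 2 {1,2} z = val n U x) = act f x"
    by (rule the_equality) (use y v eqI_2 in auto)
  then show ?thesis by (simp add: diff_def v)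
qed

lemma ex_2:
  assumes "a \<in> S 1" "b \<in> S 1" shows "\<exists>x\<in>S 2. val 2 {1} x = a \<and> val 2 {1,2} x = b"
proof -
  have c: "[a,b] ! k \<in> S 1" if "k < 2" for k
    using that assms by (auto simp: less_Suc_eq numeral_2_eq_2)
  obtain x where x: "x \<in> S 2" "\<And>k. k < 2 \<Longrightarrow> val 2 {1..k+1} x = [a,b] ! k"
    using ex_val[of 2 "\<lambda>k. [a,b] ! k", OF c] by blast
  show ?thesis
    using x(2)[of 0] x(2)[of 1] x(1) unfolding initial_segments by auto
qed

lemma ex_3:
  assumes "a \<in> S 1" "b \<in> S 1" "c \<in> S 1"
  shows "\<exists>x\<in>S 3. val 3 {1} x = a \<and> val 3 {1,2} x = b \<and> val 3 {1,2,3} x = c"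
proof -
  have d: "[a,b,c] ! k \<in> S 1" if "k < 3" for k
    using that assms by (auto simp: less_Suc_eq numeral_3_eq_3)
  obtain x where x: "x \<in> S 3" "\<And>k. k < 3 \<Longrightarrow> val 3 {1..k+1} x = [a,b,c] ! k"
    using ex_val[of 3 "\<lambda>k. [a,b,c] ! k", OF d] by blast
  show ?thesis
    using x(2)[of 0] x(2)[of 1] x(2)[of 2] x(1) unfolding initial_segments by auto
qed

text \<open>Each identity is \<open>diff_val\<close> for a chain of subsets, in an element whose
  values at initial segments are the given \<open>a\<close>, \<open>b\<close>, \<open>c\<close>. In
  \<open>S 2\<close>, passing from the chain {1}, {1,2} to {2}, {1,2} gives
  \<open>d_d_right\<close>; in \<open>S 3\<close> the chain {2}, {2,3} gives
  \<open>d_d_d\<close>.\<close>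

lemma subtraction_diff: "subtraction (S 1) diff unit"
proof
  show "unit \<in> S 1" by (rule unit_in)
next
  fix a assume a: "a \<in> S 1"
  show "diff a a = unit" using diff_val[of a 1 "{1}" "{1}"] val_one a val_empty by simp
  show "diff unit a = a" using diff_val[of a 1 "{}" "{1}"] val_one a val_empty by simp
next
  fix a b assume "a \<in> S 1" "b \<in> S 1"
  then obtain x where x: "x \<in> S 2" "val 2 {1} x = a" "val 2 {1,2} x = b" using ex_2 by blast
  have 1: "diff a b = val 2 {2} x"
    using diff_val[OF x(1), of "{1}" "{1,2}"] by (simp add: x(2,3) set_diffs del: One_nat_def)
  show "diff a b \<in> S 1" unfolding 1 by (rule val_in[OF x(1)]) simp
  show "diff (diff a b) b = a"
    unfolding 1 using diff_val[OF x(1), of "{2}" "{1,2}"] by (simp add: x(2,3) set_diffs del: One_nat_def)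
next
  fix a b c assume "a \<in> S 1" "b \<in> S 1" "c \<in> S 1"
  then obtain x where x: "x \<in> S 3" "val 3 {1} x = a" "val 3 {1,2} x = b" "val 3 {1,2,3} x = c"
    using ex_3 by blast
  have 1: "diff a b = val 3 {2} x" "diff a c = val 3 {2,3} x" "diff b c = val 3 {3} x"
    using diff_val[OF x(1), of "{1}" "{1,2}"] diff_val[OF x(1), of "{1}" "{1,2,3}"]
      diff_val[OF x(1), of "{1,2}" "{1,2,3}"] by (simp_all add: x(2-4) set_diffs del: One_nat_def)
  show "diff (diff a b) (diff a c) = diff b c"
    unfolding 1 using diff_val[OF x(1), of "{2}" "{2,3}"] by (simp add: set_diffs del: One_nat_def)
qed

sublocale subtraction "S 1" diff unit by (rule subtraction_diff)

lemma additive_val: "x \<in> S n \<Longrightarrow> additive n (\<lambda>T. val n T x)"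
  unfolding additive_def using val_in diff_val by blast

definition grp :: "'a monoid" where
  "grp = subtraction_group (S 1) diff unit"

lemma comm_group_grp: "comm_group grp"
  unfolding grp_def by (rule comm_group_subtraction_group)

lemma carrier_grp [simp]: "carrier grp = S 1"
  by (simp add: grp_def subtraction_group_def)

lemma diff_grp:
  assumes "a \<in> S 1" "b \<in> S 1" shows "diff a b = b \<otimes>\<^bsub>grp\<^esub> inv\<^bsub>grp\<^esub> a"
proof -
  interpret comm_group grp by (rule comm_group_grp)
  have "diff a b \<otimes>\<^bsub>grp\<^esub> a = b"
    using assms add_d[of a b] by (simp add: grp_def subtraction_group_def)
  then show ?thesis using assms d_in by (metis carrier_grp inv_solve_right')
qed

end

lemma group_hom_minus:
  assumes "group G" "group H" "h \<in> hom G H" "a \<in> carrier G" "b \<in> carrier G"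
  shows "h (b \<otimes>\<^bsub>G\<^esub> inv\<^bsub>G\<^esub> a) = h b \<otimes>\<^bsub>H\<^esub> inv\<^bsub>H\<^esub> (h a)"
proof -
  interpret group_hom G H h using assms by (simp add: group_hom_def group_hom_axioms_def)
  show ?thesis using assms by simp
qed

text \<open>Respecting differences gives in turn the unit, inverses, and products as a (b^-1)^-1. It
  is needed because maps of \<Gamma>-sets respect \<open>diff\<close> directly.\<close>

lemma hom_if_minus:
  assumes "group G" "group H" "h \<in> carrier G \<rightarrow> carrier H"
    and h: "\<And>a b. \<lbrakk>a \<in> carrier G; b \<in> carrier G\<rbrakk> \<Longrightarrow> h (b \<otimes>\<^bsub>G\<^esub> inv\<^bsub>G\<^esub> a) = h b \<otimes>\<^bsub>H\<^esub> inv\<^bsub>H\<^esub> (h a)"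
  shows "h \<in> hom G H"
proof (rule homI)
  interpret G: group G by fact
  interpret H: group H by fact
  have hin: "\<And>a. a \<in> carrier G \<Longrightarrow> h a \<in> carrier H" using assms by auto
  then show "\<And>a. a \<in> carrier G \<Longrightarrow> h a \<in> carrier H" .
  have one: "h \<one>\<^bsub>G\<^esub> = \<one>\<^bsub>H\<^esub>" using h[of "\<one>\<^bsub>G\<^esub>" "\<one>\<^bsub>G\<^esub>"] hin by simp
  have inv: "h (inv\<^bsub>G\<^esub> a) = inv\<^bsub>H\<^esub> (h a)" if "a \<in> carrier G" for a
    using h[of a "\<one>\<^bsub>G\<^esub>"] hin that by (simp add: one)
  fix a b assume "a \<in> carrier G" "b \<in> carrier G"
  then show "h (a \<otimes>\<^bsub>G\<^esub> b) = h a \<otimes>\<^bsub>H\<^esub> h b"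
    using h[of "inv\<^bsub>G\<^esub> b" a] hin by (simp add: inv)
qed

section \<open>Maps of Bousfield \<Gamma>-sets and homomorphisms\<close>

locale gamma_set_pair = X: gamma_set S act + Y: gamma_set S' act'
  for S :: "nat \<Rightarrow> 'a set" and act and S' :: "nat \<Rightarrow> 'b set" and act'
begin

lemma hom_iff_diff:
  assumes "h \<in> S 1 \<rightarrow> S' 1"
  shows "h \<in> hom X.grp Y.grp \<longleftrightarrow> (\<forall>a\<in>S 1. \<forall>b\<in>S 1. h (X.diff a b) = Y.diff (h a) (h b))"
proof -
  have g: "group X.grp" "group Y.grp" using X.comm_group_grp Y.comm_group_grp by (auto dest: comm_group.axioms)
  have h: "\<And>a. a \<in> S 1 \<Longrightarrow> h a \<in> S' 1" using assms by auto
  show ?thesis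
  proof
    assume "h \<in> hom X.grp Y.grp"
    then show "\<forall>a\<in>S 1. \<forall>b\<in>S 1. h (X.diff a b) = Y.diff (h a) (h b)"
      using group_hom_minus[OF g] by (simp add: X.diff_grp Y.diff_grp h del: One_nat_def)
  next
    assume "\<forall>a\<in>S 1. \<forall>b\<in>S 1. h (X.diff a b) = Y.diff (h a) (h b)"
    then show "h \<in> hom X.grp Y.grp"
      using assms by (intro hom_if_minus[OF g]) (simp_all add: X.diff_grp Y.diff_grp h del: One_nat_def)
  qed
qed

lemma natural_val:
  assumes nat: "\<And>f x. \<lbrakk>f \<in> Arr Gamma_op; x \<in> S (src f)\<rbrakk> \<Longrightarrow> t (tgt f) (act f x) = act' f (t (src f) x)"
    and "x \<in> S n" "T \<subseteq> {1..n}"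
  shows "Y.val n T (t n x) = t 1 (X.val n T x)"
  using nat[OF indicator_arrow_in] assms by (simp add: X.val_def Y.val_def)

text \<open>Naturality for three indicators: \<open>t 2\<close> carries an element with values a, b,
  b - a at {1}, {1,2}, {2} to one with their images as values. This serves both for simplicial
  operators and for maps of \<Gamma>-spaces.\<close>

lemma natural_diff:
  assumes t: "\<And>n. t n \<in> S n \<rightarrow> S' n"
    and nat: "\<And>f x. \<lbrakk>f \<in> Arr Gamma_op; x \<in> S (src f)\<rbrakk> \<Longrightarrow> t (tgt f) (act f x) = act' f (t (src f) x)"
    and ab: "a \<in> S 1" "b \<in> S 1"
  shows "t 1 (X.diff a b) = Y.diff (t 1 a) (t 1 b)"
proof -
  obtain x where x: "x \<in> S 2" "X.val 2 {1} x = a" "X.val 2 {1,2} x = b" using X.ex_2 ab by blast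
  then have tx: "t 2 x \<in> S' 2" using t by auto
  note v = natural_val[of t, OF nat x(1)]
  show ?thesis
    using v[of "{1}"] v[of "{1,2}"] v[of "{2}"] x X.diff_val[OF x(1), of "{1}" "{1,2}"]
      Y.diff_val[OF tx, of "{1}" "{1,2}"] by (simp add: insert_Diff_if)
qed

text \<open>Only values at initial segments are prescribed, since these are what the Bousfield
  condition allows to be prescribed freely.\<close>

definition extension :: "('a \<Rightarrow> 'b) \<Rightarrow> nat \<Rightarrow> 'a \<Rightarrow> 'b" where
  "extension h n x = (THE y. y \<in> S' n \<and> (\<forall>k<n. Y.val n {1..k+1} y = h (X.val n {1..k+1} x)))"

lemma extension_unique:
  assumes "y \<in> S' n" "\<And>k. k < n \<Longrightarrow> Y.val n {1..k+1} y = h (X.val n {1..k+1} x)"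
  shows "extension h n x = y"
  unfolding extension_def
proof (rule the_equality)
  fix z assume "z \<in> S' n \<and> (\<forall>k<n. Y.val n {1..k+1} z = h (X.val n {1..k+1} x))"
  then show "z = y" using assms by (intro Y.eqI[of z n]) auto
qed (use assms in auto)

lemma
  assumes h: "h \<in> S 1 \<rightarrow> S' 1" and x: "x \<in> S n"
  shows extension_in: "extension h n x \<in> S' n"
    and val_extension_initial: "\<And>k. k < n \<Longrightarrow> Y.val n {1..k+1} (extension h n x) = h (X.val n {1..k+1} x)"
proof -
  have c: "h (X.val n {1..k+1} x) \<in> S' 1" if "k < n" for k
    by (rule funcset_mem[OF h X.val_in[OF x]]) (use that in auto)
  obtain y where y: "y \<in> S' n" "\<forall>k<n. Y.val n {1..k+1} y = h (X.val n {1..k+1} x)"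
    using Y.ex_val[of n "\<lambda>k. h (X.val n {1..k+1} x)", OF c] by blast
  have *: "extension h n x = y" by (rule extension_unique[OF y(1)]) (use y(2) in blast)
  show "extension h n x \<in> S' n" unfolding * by (rule y(1))
  show "\<And>k. k < n \<Longrightarrow> Y.val n {1..k+1} (extension h n x) = h (X.val n {1..k+1} x)"
    unfolding * using y(2) by blast
qed

text \<open>Both sides are additive in \<open>T\<close>, the right one because \<open>h\<close> is a
  homomorphism, and they agree at initial segments by construction.\<close>

lemma val_extension:
  assumes h: "h \<in> hom X.grp Y.grp" and x: "x \<in> S n" and T: "T \<subseteq> {1..n}"
  shows "Y.val n T (extension h n x) = h (X.val n T x)"
proof -
  have hin: "h \<in> S 1 \<rightarrow> S' 1" using h by (simp add: hom_def)
  have "\<forall>a\<in>S 1. \<forall>b\<in>S 1. h (X.diff a b) = Y.diff (h a) (h b)" using h hom_iff_diff[OF hin] by simp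
  then have "Y.additive n (\<lambda>T. h (X.val n T x))"
    unfolding Y.additive_def
    using funcset_mem[OF hin] X.val_in[OF x] X.diff_val[OF x] by (metis subset_trans)
  from Y.additive_eqI[OF Y.additive_val[OF extension_in[OF hin x]] this val_extension_initial[OF hin x] T]
  show ?thesis .
qed

lemma extension_one:
  assumes h: "h \<in> hom X.grp Y.grp" and x: "x \<in> S 1"
  shows "extension h 1 x = h x"
proof (rule extension_unique)
  show hx: "h x \<in> S' 1" using h x by (auto simp: hom_def)
  fix k :: nat assume "k < 1"
  then have "{1..k+1} = {1}" by auto
  then show "Y.val 1 {1..k+1} (h x) = h (X.val 1 {1..k+1} x)"
    using X.val_one[OF x] Y.val_one[OF hx] by simp
qed

text \<open>Comparing values at initial segments is enough. Their preimages under \<open>f\<close>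
  need not be initial segments, hence \<open>val_extension\<close>, and with it the homomorphism
  property, is required.\<close>

lemma extension_natural:
  assumes h: "h \<in> hom X.grp Y.grp" and f: "f \<in> Arr Gamma_op" and x: "x \<in> S (src f)"
  shows "extension h (tgt f) (act f x) = act' f (extension h (src f) x)"
proof (rule extension_unique)
  have hin: "h \<in> S 1 \<rightarrow> S' 1" using h by (simp add: hom_def)
  note e = extension_in[OF hin x]
  show "act' f (extension h (src f) x) \<in> S' (tgt f)" using Y.act_in[OF f e] .
  fix k assume "k < tgt f"
  then have T: "{1..k+1} \<subseteq> {1..tgt f}" by auto
  note U = preimage_subset[OF f T]
  show "Y.val (tgt f) {1..k+1} (act' f (extension h (src f) x)) = h (X.val (tgt f) {1..k+1} (act f x))"
    by (simp only: Y.val_act[OF f T e] X.val_act[OF f T x] val_extension[OF h x U])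
qed

text \<open>By naturality for the indicators of initial segments, \<open>t 1\<close> determines
  \<open>t\<close>. This is faithfulness in a fixed degree.\<close>

lemma natural_eq_extension:
  assumes t: "\<And>n. t n \<in> S n \<rightarrow> S' n"
    and nat: "\<And>f x. \<lbrakk>f \<in> Arr Gamma_op; x \<in> S (src f)\<rbrakk> \<Longrightarrow> t (tgt f) (act f x) = act' f (t (src f) x)"
    and x: "x \<in> S n"
  shows "t n x = extension (t 1) n x"
proof (rule extension_unique[symmetric])
  show "t n x \<in> S' n" using t x by blast
  fix k assume "k < n"
  then show "Y.val n {1..k+1} (t n x) = t 1 (X.val n {1..k+1} x)"
    by (intro natural_val[of t, OF nat x]) auto
qed

end

section \<open>Functors into concrete categories\<close>

text \<open>Statements below use arrows of \<open>Delta\<close> itself, so a simplicial operator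
  \<theta> leads from degree \<open>tgt \<theta>\<close> to degree
  \<open>src \<theta>\<close>.\<close>

lemma Delta_simps [simp]:
  "Obj (opposite Delta) = UNIV" "Arr (opposite Delta) = Arr Delta"
  "Dom (opposite Delta) = tgt" "Cod (opposite Delta) = src" "Idn (opposite Delta) = Idn Delta"
  "Cmp (opposite Delta) = (\<lambda>g f. Cmp Delta f g)"
  by (simp_all add: opposite_def Delta_def concrete_category_def)

lemma Gamma_op_simps [simp]: "Obj Gamma_op = UNIV" "Dom Gamma_op = src" "Cod Gamma_op = tgt"
  by (simp_all add: Gamma_op_def concrete_category_def)

lemma category_Delta: "category Delta"
  unfolding Delta_def
proof (rule category_concrete_category)
  fix m n k :: nat and f g :: "nat \<Rightarrow> nat"
  assume "f \<in> {..m} \<rightarrow>\<^sub>E {..n}" "mono_on {..m} f" "mono_on {..n} g"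
  then show "mono_on {..m} (compose {..m} g f)"
    by (auto simp: mono_on_def compose_def PiE_def Pi_def)
qed (auto simp: mono_on_def)

lemma category_Gamma_op: "category Gamma_op"
  unfolding Gamma_op_def by (rule category_concrete_category) (auto simp: compose_def)

lemma category_set_cat: "category set_cat"
  unfolding set_cat_def by (rule category_concrete_category) auto

lemma category_ab_cat: "category ab_cat"
  unfolding ab_cat_def by (rule category_concrete_category) (auto simp: hom_def compose_def Pi_def comm_group_def comm_monoid_def monoid.m_closed)

lemma category_opposite_Delta: "category (opposite Delta)"
  using category_opposite category_Delta .

lemma category_simplicial_sets: "category simplicial_sets"
  unfolding simplicial_sets_def
  by (intro category_functor_category category_opposite_Delta category_set_cat)

lemma category_simplicial_abelian_groups: "category simplicial_abelian_groups"
  unfolding simplicial_abelian_groups_def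
  by (intro category_functor_category category_opposite_Delta category_ab_cat)

lemma category_strict_bousfield_gamma_spaces: "category strict_bousfield_gamma_spaces"
  unfolding strict_bousfield_gamma_spaces_def
  by (intro category_full_subcategory category_functor_category category_Gamma_op category_simplicial_sets)

text \<open>Underlying functions are extensional, so equations between arrows can be checked at
  elements. The lemma is stated once to serve both \<open>set_cat\<close> and
  \<open>ab_cat\<close>.\<close>

lemma is_functor_concrete_category_iff:
  assumes "category C"
  shows "is_functor C (concrete_category Y U H) F \<longleftrightarrow>
    on_obj F \<in> Obj C \<rightarrow>\<^sub>E Y \<and> on_arr F \<in> extensional (Arr C) \<and>
    (\<forall>f\<in>Arr C. src (on_arr F f) = on_obj F (Dom C f) \<and> tgt (on_arr F f) = on_obj F (Cod C f) \<and>
       dat (on_arr F f) \<in> U (on_obj F (Dom C f)) \<rightarrow>\<^sub>E U (on_obj F (Cod C f)) \<and>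
       H (on_obj F (Dom C f)) (on_obj F (Cod C f)) (dat (on_arr F f))) \<and>
    (\<forall>x\<in>Obj C. \<forall>a\<in>U (on_obj F x). dat (on_arr F (Idn C x)) a = a) \<and>
    (\<forall>f\<in>Arr C. \<forall>g\<in>Arr C. Cod C f = Dom C g \<longrightarrow> (\<forall>a\<in>U (on_obj F (Dom C f)).
       dat (on_arr F (Cmp C g f)) a = dat (on_arr F g) (dat (on_arr F f) a)))"
    (is "?L \<longleftrightarrow> ?R")
proof -
  interpret category C by fact
  show ?thesis
  proof
    assume ?L
    then show ?R
      by (auto simp: is_functor_def concrete_category_def compose_def dom_in cod_in dom_cmp cod_cmp PiE_iff)
  next
    assume R: ?R
    have arr: "src (on_arr F f) = on_obj F (Dom C f)" "tgt (on_arr F f) = on_obj F (Cod C f)"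
       "dat (on_arr F f) \<in> U (on_obj F (Dom C f)) \<rightarrow>\<^sub>E U (on_obj F (Cod C f))"
       if "f \<in> Arr C" for f using R that by auto
    show ?L
      unfolding is_functor_def
    proof (intro conjI ballI impI)
      fix x assume x: "x \<in> Obj C"
      note a = arr[OF idn_in[OF x]]
      have "dat (on_arr F (Idn C x)) = (\<lambda>a\<in>U (on_obj F x). a)"
        using a(3) R x by (auto simp: fun_eq_iff dom_idn cod_idn PiE_def extensional_def)
      then show "on_arr F (Idn C x) = Idn (concrete_category Y U H) (on_obj F x)"
        using a x by (intro arrow.equality) (simp_all add: concrete_category_def dom_idn cod_idn)
    next
      fix f g assume fg: "f \<in> Arr C" "g \<in> Arr C" "Cod C f = Dom C g"
      note a = arr[OF cmp_in[OF fg]]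
      have "dat (on_arr F (Cmp C g f)) = compose (U (on_obj F (Dom C f))) (dat (on_arr F g)) (dat (on_arr F f))"
        using a(3) R fg by (auto simp: fun_eq_iff dom_cmp cod_cmp PiE_def extensional_def compose_def)
      then show "on_arr F (Cmp C g f) = Cmp (concrete_category Y U H) (on_arr F g) (on_arr F f)"
        using a arr fg by (intro arrow.equality) (simp_all add: concrete_category_def dom_cmp cod_cmp)
    qed (use R in \<open>auto simp: concrete_category_def dom_in cod_in PiE_iff\<close>)
  qed
qed

lemma is_nat_trans_concrete_category_iff:
  assumes "category C"
  shows "is_nat_trans C (concrete_category Y U H) \<tau> \<longleftrightarrow>
    is_functor C (concrete_category Y U H) (src \<tau>) \<and> is_functor C (concrete_category Y U H) (tgt \<tau>) \<and>
    dat \<tau> \<in> extensional (Obj C) \<and>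
    (\<forall>x\<in>Obj C. src (dat \<tau> x) = on_obj (src \<tau>) x \<and> tgt (dat \<tau> x) = on_obj (tgt \<tau>) x \<and>
       dat (dat \<tau> x) \<in> U (on_obj (src \<tau>) x) \<rightarrow>\<^sub>E U (on_obj (tgt \<tau>) x) \<and>
       H (on_obj (src \<tau>) x) (on_obj (tgt \<tau>) x) (dat (dat \<tau> x))) \<and>
    (\<forall>f\<in>Arr C. \<forall>a\<in>U (on_obj (src \<tau>) (Dom C f)).
       dat (dat \<tau> (Cod C f)) (dat (on_arr (src \<tau>) f) a) = dat (on_arr (tgt \<tau>) f) (dat (dat \<tau> (Dom C f)) a))"
    (is "?L \<longleftrightarrow> ?R")
proof -
  interpret category C by fact
  \<comment> \<open>\<open>compose\<close> cuts both composites down to the same domain, so they are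
    equal once they agree there.\<close>
  have eq: "Cmp (concrete_category Y U H) (dat \<tau> (Cod C f)) (on_arr (src \<tau>) f) =
        Cmp (concrete_category Y U H) (on_arr (tgt \<tau>) f) (dat \<tau> (Dom C f)) \<longleftrightarrow>
     (\<forall>a\<in>U (on_obj (src \<tau>) (Dom C f)).
       dat (dat \<tau> (Cod C f)) (dat (on_arr (src \<tau>) f) a) = dat (on_arr (tgt \<tau>) f) (dat (dat \<tau> (Dom C f)) a))"
    if "src (on_arr (src \<tau>) f) = on_obj (src \<tau>) (Dom C f)" "src (dat \<tau> (Dom C f)) = on_obj (src \<tau>) (Dom C f)"
      "tgt (dat \<tau> (Cod C f)) = tgt (on_arr (tgt \<tau>) f)" for f
    using that by (auto simp: concrete_category_def compose_def fun_eq_iff restrict_def)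
  show ?thesis
  proof
    assume L: ?L
    then have F: "is_functor C (concrete_category Y U H) (src \<tau>)" "is_functor C (concrete_category Y U H) (tgt \<tau>)"
      by (auto simp: is_nat_trans_def)
    have d: "src (dat \<tau> x) = on_obj (src \<tau>) x \<and> tgt (dat \<tau> x) = on_obj (tgt \<tau>) x \<and>
       dat (dat \<tau> x) \<in> U (on_obj (src \<tau>) x) \<rightarrow>\<^sub>E U (on_obj (tgt \<tau>) x) \<and>
       H (on_obj (src \<tau>) x) (on_obj (tgt \<tau>) x) (dat (dat \<tau> x))" if "x \<in> Obj C" for x
      using L that unfolding is_nat_trans_def concrete_category_def by (auto simp: PiE_iff)
    have "src (on_arr (src \<tau>) f) = on_obj (src \<tau>) (Dom C f)" "src (dat \<tau> (Dom C f)) = on_obj (src \<tau>) (Dom C f)"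
      "tgt (dat \<tau> (Cod C f)) = tgt (on_arr (tgt \<tau>) f)" if "f \<in> Arr C" for f
      using F that d[OF dom_in[OF that]] d[OF cod_in[OF that]]
      by (simp_all add: is_functor_concrete_category_iff[OF assms])
    note eq = eq[OF this]
    show ?R using F d eq L unfolding is_nat_trans_def by (auto simp: PiE_iff)
  next
    assume R: ?R
    then have F: "is_functor C (concrete_category Y U H) (src \<tau>)" "is_functor C (concrete_category Y U H) (tgt \<tau>)"
      by auto
    have o: "on_obj (src \<tau>) x \<in> Y" "on_obj (tgt \<tau>) x \<in> Y" if "x \<in> Obj C" for x
      using F that by (auto simp: is_functor_concrete_category_iff[OF assms] PiE_iff)
    have "src (on_arr (src \<tau>) f) = on_obj (src \<tau>) (Dom C f)" "src (dat \<tau> (Dom C f)) = on_obj (src \<tau>) (Dom C f)"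
      "tgt (dat \<tau> (Cod C f)) = tgt (on_arr (tgt \<tau>) f)" if "f \<in> Arr C" for f
      using F R that dom_in[OF that] cod_in[OF that] by (simp_all add: is_functor_concrete_category_iff[OF assms])
    note eq = eq[OF this]
    have "dat \<tau> \<in> Obj C \<rightarrow>\<^sub>E Arr (concrete_category Y U H)"
      using R o by (auto simp: PiE_iff concrete_category_def)
    moreover have "\<forall>x\<in>Obj C. Dom (concrete_category Y U H) (dat \<tau> x) = on_obj (src \<tau>) x \<and>
       Cod (concrete_category Y U H) (dat \<tau> x) = on_obj (tgt \<tau>) x"
      using R by (simp add: concrete_category_def)
    ultimately show ?L using F eq R unfolding is_nat_trans_def by blast
  qed
qed

section \<open>Simplicial sets and \<Gamma>-spaces elementwise\<close>

definition simplicial_set :: "'u sset \<Rightarrow> bool" where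
  "simplicial_set = is_functor (opposite Delta) set_cat"

lemma simplicial_set_iff:
  "simplicial_set A \<longleftrightarrow> on_arr A \<in> extensional (Arr Delta) \<and>
    (\<forall>\<theta>\<in>Arr Delta. src (on_arr A \<theta>) = on_obj A (tgt \<theta>) \<and> tgt (on_arr A \<theta>) = on_obj A (src \<theta>) \<and>
       dat (on_arr A \<theta>) \<in> on_obj A (tgt \<theta>) \<rightarrow>\<^sub>E on_obj A (src \<theta>)) \<and>
    (\<forall>m. \<forall>a\<in>on_obj A m. dat (on_arr A (Idn Delta m)) a = a) \<and>
    (\<forall>\<theta>\<in>Arr Delta. \<forall>\<phi>\<in>Arr Delta. tgt \<phi> = src \<theta> \<longrightarrow> (\<forall>a\<in>on_obj A (tgt \<theta>).
       dat (on_arr A (Cmp Delta \<theta> \<phi>)) a = dat (on_arr A \<phi>) (dat (on_arr A \<theta>) a)))"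
  unfolding simplicial_set_def set_cat_def
  by (subst is_functor_concrete_category_iff[OF category_opposite_Delta]) (auto simp: eq_commute)

definition sset_morphism :: "'u sset_map \<Rightarrow> bool" where
  "sset_morphism = is_nat_trans (opposite Delta) set_cat"

lemma sset_morphism_iff:
  "sset_morphism \<tau> \<longleftrightarrow> simplicial_set (src \<tau>) \<and> simplicial_set (tgt \<tau>) \<and>
    (\<forall>m. src (dat \<tau> m) = on_obj (src \<tau>) m \<and> tgt (dat \<tau> m) = on_obj (tgt \<tau>) m \<and>
       dat (dat \<tau> m) \<in> on_obj (src \<tau>) m \<rightarrow>\<^sub>E on_obj (tgt \<tau>) m) \<and>
    (\<forall>\<theta>\<in>Arr Delta. \<forall>a\<in>on_obj (src \<tau>) (tgt \<theta>).
       dat (dat \<tau> (src \<theta>)) (dat (on_arr (src \<tau>) \<theta>) a) = dat (on_arr (tgt \<tau>) \<theta>) (dat (dat \<tau> (tgt \<theta>)) a))"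
  unfolding sset_morphism_def simplicial_set_def set_cat_def
  by (subst is_nat_trans_concrete_category_iff[OF category_opposite_Delta]) (simp add: conj_assoc)

lemma simplicial_sets_simps:
  "Obj simplicial_sets = Collect simplicial_set" "Arr simplicial_sets = Collect sset_morphism"
  "Dom simplicial_sets = src" "Cod simplicial_sets = tgt"
  "Idn simplicial_sets = (\<lambda>A. \<lparr>src = A, dat = (\<lambda>m. Idn set_cat (on_obj A m)), tgt = A\<rparr>)"
  "Cmp simplicial_sets = (\<lambda>\<sigma> \<tau>. \<lparr>src = src \<tau>, dat = (\<lambda>m. Cmp set_cat (dat \<sigma> m) (dat \<tau> m)), tgt = tgt \<sigma>\<rparr>)"
  by (simp_all add: simplicial_sets_def functor_category_def simplicial_set_def sset_morphism_def restrict_def)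

lemma sset_morphism_eqI:
  assumes "sset_morphism \<sigma>" "sset_morphism \<tau>" "src \<sigma> = src \<tau>" "tgt \<sigma> = tgt \<tau>"
    and "\<And>m a. a \<in> on_obj (src \<tau>) m \<Longrightarrow> dat (dat \<sigma> m) a = dat (dat \<tau> m) a"
  shows "\<sigma> = \<tau>"
proof -
  have "dat (dat \<sigma> m) = dat (dat \<tau> m)" for m
    using assms by (intro PiE_ext[of _ "on_obj (src \<tau>) m" "\<lambda>_. on_obj (tgt \<tau>) m"]) (auto simp: sset_morphism_iff)
  then have "dat \<sigma> m = dat \<tau> m" for m
    using assms(1-4) by (intro arrow.equality) (auto simp: sset_morphism_iff)
  then show ?thesis using assms(3,4) by (intro arrow.equality) auto
qed

lemma dat_Cmp_simplicial_sets:
  assumes "sset_morphism \<tau>" "a \<in> on_obj (src \<tau>) m"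
  shows "dat (dat (Cmp simplicial_sets \<sigma> \<tau>) m) a = dat (dat \<sigma> m) (dat (dat \<tau> m) a)"
  using assms by (simp add: simplicial_sets_simps set_cat_def concrete_category_def sset_morphism_iff compose_def)

lemma Cmp_simplicial_sets_in:
  "\<lbrakk>sset_morphism \<tau>; sset_morphism \<sigma>; tgt \<tau> = src \<sigma>\<rbrakk> \<Longrightarrow> sset_morphism (Cmp simplicial_sets \<sigma> \<tau>)"
  using category.cmp_in[OF category_simplicial_sets, of \<tau> \<sigma>] by (simp add: simplicial_sets_simps(1-4))

lemma Idn_simplicial_sets_in: "simplicial_set A \<Longrightarrow> sset_morphism (Idn simplicial_sets A)"
  using category.idn_in[OF category_simplicial_sets, of A] by (simp add: simplicial_sets_simps(1-4))

definition gamma_functor :: "'u gamma_space \<Rightarrow> bool" where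
  "gamma_functor = is_functor Gamma_op simplicial_sets"

text \<open>The simplicial degree comes before the object of \<open>Gamma_op\<close>, so that
  \<open>level X m\<close> is the \<Gamma>-set in degree \<open>m\<close>.\<close>

abbreviation level :: "'u gamma_space \<Rightarrow> nat \<Rightarrow> nat \<Rightarrow> 'u set" where
  "level X m n \<equiv> on_obj (on_obj X n) m"

abbreviation level_act :: "'u gamma_space \<Rightarrow> nat \<Rightarrow> nat_arrow \<Rightarrow> 'u \<Rightarrow> 'u" where
  "level_act X m f \<equiv> dat (dat (on_arr X f) m)"

text \<open>Functoriality is stated for elements of the levels because the \<Gamma>-set arguments
  work in one simplicial degree at a time.\<close>

lemma gamma_functor_iff:
  "gamma_functor X \<longleftrightarrow> (\<forall>n. simplicial_set (on_obj X n)) \<and> on_arr X \<in> extensional (Arr Gamma_op) \<and>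
    (\<forall>f\<in>Arr Gamma_op. sset_morphism (on_arr X f) \<and>
       src (on_arr X f) = on_obj X (src f) \<and> tgt (on_arr X f) = on_obj X (tgt f)) \<and>
    (\<forall>n m. \<forall>x\<in>level X m n. level_act X m (Idn Gamma_op n) x = x) \<and>
    (\<forall>f\<in>Arr Gamma_op. \<forall>g\<in>Arr Gamma_op. tgt f = src g \<longrightarrow> (\<forall>m. \<forall>x\<in>level X m (src f).
        level_act X m (Cmp Gamma_op g f) x = level_act X m g (level_act X m f x)))"
    (is "?L \<longleftrightarrow> ?R")
proof -
  interpret category Gamma_op by (rule category_Gamma_op)
  show ?thesis
  proof
    assume L: ?L
    have m: "sset_morphism (on_arr X f)" "src (on_arr X f) = on_obj X (src f)" "tgt (on_arr X f) = on_obj X (tgt f)"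
      if "f \<in> Arr Gamma_op" for f
      using L that by (auto simp: gamma_functor_def is_functor_def simplicial_sets_simps(1-4))
    have i: "level_act X m (Idn Gamma_op n) x = x" if "x \<in> level X m n" for m n x
      using L that by (simp add: gamma_functor_def is_functor_def simplicial_sets_simps(5) set_cat_def concrete_category_def)
    have c: "level_act X m (Cmp Gamma_op g f) x = level_act X m g (level_act X m f x)"
      if "f \<in> Arr Gamma_op" "g \<in> Arr Gamma_op" "tgt f = src g" "x \<in> level X m (src f)" for f g m x
    proof -
      have "on_arr X (Cmp Gamma_op g f) = Cmp simplicial_sets (on_arr X g) (on_arr X f)"
        using L that by (simp add: gamma_functor_def is_functor_def)
      then show ?thesis using dat_Cmp_simplicial_sets[OF m(1)[OF that(1)]] m(2)[OF that(1)] that by simp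
    qed
    show ?R
      using L m i c
      by (auto simp: gamma_functor_def is_functor_def PiE_iff simplicial_sets_simps(1-4))
  next
    assume R: ?R
    then have m: "sset_morphism (on_arr X f)" "src (on_arr X f) = on_obj X (src f)" "tgt (on_arr X f) = on_obj X (tgt f)"
      if "f \<in> Arr Gamma_op" for f using that by auto
    have s: "simplicial_set (on_obj X n)" for n using R by auto
    have i: "on_arr X (Idn Gamma_op n) = Idn simplicial_sets (on_obj X n)" for n
    proof (rule sset_morphism_eqI)
      note a = m[OF idn_in, of n]
      show "sset_morphism (on_arr X (Idn Gamma_op n))" "sset_morphism (Idn simplicial_sets (on_obj X n))"
        "src (on_arr X (Idn Gamma_op n)) = src (Idn simplicial_sets (on_obj X n))"
        "tgt (on_arr X (Idn Gamma_op n)) = tgt (Idn simplicial_sets (on_obj X n))"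
        using a s Idn_simplicial_sets_in dom_idn[of n] cod_idn[of n] by (auto simp: simplicial_sets_simps)
    next
      fix l a assume "a \<in> on_obj (src (Idn simplicial_sets (on_obj X n))) l"
      then show "level_act X l (Idn Gamma_op n) a = dat (dat (Idn simplicial_sets (on_obj X n)) l) a"
        using R by (simp add: simplicial_sets_simps set_cat_def concrete_category_def)
    qed
    have c: "on_arr X (Cmp Gamma_op g f) = Cmp simplicial_sets (on_arr X g) (on_arr X f)"
      if fg: "f \<in> Arr Gamma_op" "g \<in> Arr Gamma_op" "tgt f = src g" for f g
    proof (rule sset_morphism_eqI)
      have gf: "Cmp Gamma_op g f \<in> Arr Gamma_op" using cmp_in fg by simp
      show "sset_morphism (on_arr X (Cmp Gamma_op g f))" using m gf by blast
      show "sset_morphism (Cmp simplicial_sets (on_arr X g) (on_arr X f))"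
        using m fg by (intro Cmp_simplicial_sets_in) auto
      show "src (on_arr X (Cmp Gamma_op g f)) = src (Cmp simplicial_sets (on_arr X g) (on_arr X f))"
        "tgt (on_arr X (Cmp Gamma_op g f)) = tgt (Cmp simplicial_sets (on_arr X g) (on_arr X f))"
        using m(2,3)[OF gf] m(2)[OF fg(1)] m(3)[OF fg(2)] dom_cmp[of f g] cod_cmp[of f g] fg
        by (simp_all add: simplicial_sets_simps)
      fix l a assume "a \<in> on_obj (src (Cmp simplicial_sets (on_arr X g) (on_arr X f))) l"
      then have a: "a \<in> on_obj (src (on_arr X f)) l" by (simp add: simplicial_sets_simps)
      show "level_act X l (Cmp Gamma_op g f) a = dat (dat (Cmp simplicial_sets (on_arr X g) (on_arr X f)) l) a"
        using R fg a m(2)[OF fg(1)] by (simp add: dat_Cmp_simplicial_sets[OF m(1)[OF fg(1)] a])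
    qed
    show ?L
      using R i c by (auto simp: gamma_functor_def is_functor_def PiE_iff simplicial_sets_simps(1-4))
  qed
qed

definition gamma_morphism :: "'u gamma_map \<Rightarrow> bool" where
  "gamma_morphism = is_nat_trans Gamma_op simplicial_sets"

lemma gamma_morphism_iff:
  "gamma_morphism \<tau> \<longleftrightarrow> gamma_functor (src \<tau>) \<and> gamma_functor (tgt \<tau>) \<and>
    (\<forall>n. sset_morphism (dat \<tau> n) \<and> src (dat \<tau> n) = on_obj (src \<tau>) n \<and> tgt (dat \<tau> n) = on_obj (tgt \<tau>) n) \<and>
    (\<forall>f\<in>Arr Gamma_op. \<forall>m. \<forall>x\<in>level (src \<tau>) m (src f).
       dat (dat (dat \<tau> (tgt f)) m) (level_act (src \<tau>) m f x) = level_act (tgt \<tau>) m f (dat (dat (dat \<tau> (src f)) m) x))"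
    (is "?L \<longleftrightarrow> ?R")
proof -
  have basic: "?L \<longleftrightarrow> gamma_functor (src \<tau>) \<and> gamma_functor (tgt \<tau>) \<and>
    (\<forall>n. sset_morphism (dat \<tau> n) \<and> src (dat \<tau> n) = on_obj (src \<tau>) n \<and> tgt (dat \<tau> n) = on_obj (tgt \<tau>) n) \<and>
    (\<forall>f\<in>Arr Gamma_op. Cmp simplicial_sets (dat \<tau> (tgt f)) (on_arr (src \<tau>) f) =
                 Cmp simplicial_sets (on_arr (tgt \<tau>) f) (dat \<tau> (src f)))"
    by (auto simp: gamma_morphism_def is_nat_trans_def gamma_functor_def simplicial_sets_simps(1-4) PiE_iff)
  have "Cmp simplicial_sets (dat \<tau> (tgt f)) (on_arr (src \<tau>) f) =
                 Cmp simplicial_sets (on_arr (tgt \<tau>) f) (dat \<tau> (src f)) \<longleftrightarrow>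
      (\<forall>m. \<forall>x\<in>level (src \<tau>) m (src f).
       dat (dat (dat \<tau> (tgt f)) m) (level_act (src \<tau>) m f x) = level_act (tgt \<tau>) m f (dat (dat (dat \<tau> (src f)) m) x))"
    if "gamma_functor (src \<tau>)" "gamma_functor (tgt \<tau>)" and f: "f \<in> Arr Gamma_op" and
     d: "\<And>n. sset_morphism (dat \<tau> n) \<and> src (dat \<tau> n) = on_obj (src \<tau>) n \<and> tgt (dat \<tau> n) = on_obj (tgt \<tau>) n" for f
  proof -
    have m: "sset_morphism (on_arr (src \<tau>) f)" "sset_morphism (on_arr (tgt \<tau>) f)"
      "src (on_arr (src \<tau>) f) = on_obj (src \<tau>) (src f)" "tgt (on_arr (src \<tau>) f) = on_obj (src \<tau>) (tgt f)"
      "src (on_arr (tgt \<tau>) f) = on_obj (tgt \<tau>) (src f)" "tgt (on_arr (tgt \<tau>) f) = on_obj (tgt \<tau>) (tgt f)"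
      using that(1,2) f by (simp_all add: gamma_functor_iff)
    have c: "dat (dat (Cmp simplicial_sets (dat \<tau> (tgt f)) (on_arr (src \<tau>) f)) l) x =
        dat (dat (dat \<tau> (tgt f)) l) (level_act (src \<tau>) l f x)"
      "dat (dat (Cmp simplicial_sets (on_arr (tgt \<tau>) f) (dat \<tau> (src f))) l) x =
        level_act (tgt \<tau>) l f (dat (dat (dat \<tau> (src f)) l) x)" if "x \<in> level (src \<tau>) l (src f)" for l x
      using that d m by (simp_all add: dat_Cmp_simplicial_sets)
    show ?thesis (is "?A = ?B \<longleftrightarrow> _")
    proof
      assume "?A = ?B"
      then show "\<forall>m. \<forall>x\<in>level (src \<tau>) m (src f). dat (dat (dat \<tau> (tgt f)) m) (level_act (src \<tau>) m f x) =
          level_act (tgt \<tau>) m f (dat (dat (dat \<tau> (src f)) m) x)"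
        using c by metis
    next
      assume *: "\<forall>m. \<forall>x\<in>level (src \<tau>) m (src f). dat (dat (dat \<tau> (tgt f)) m) (level_act (src \<tau>) m f x) =
          level_act (tgt \<tau>) m f (dat (dat (dat \<tau> (src f)) m) x)"
      show "?A = ?B"
      proof (rule sset_morphism_eqI)
        show "sset_morphism ?A" "sset_morphism ?B" using d m by (auto intro!: Cmp_simplicial_sets_in)
        show "src ?A = src ?B" "tgt ?A = tgt ?B" using d m by (simp_all add: simplicial_sets_simps)
        fix l x assume "x \<in> on_obj (src ?B) l"
        then have "x \<in> level (src \<tau>) l (src f)" using d by (simp add: simplicial_sets_simps)
        then show "dat (dat ?A l) x = dat (dat ?B l) x" using c * by simp
      qed
    qed
  qed
  then show ?thesis unfolding basic by blast
qed

section \<open>The underlying simplicial abelian group\<close>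

lemma Delta_arrow_simps [simp]:
  "Idn Delta m \<in> Arr Delta" "src (Idn Delta m) = m" "tgt (Idn Delta m) = m"
  "src (Cmp Delta \<theta> \<phi>) = src \<phi>" "tgt (Cmp Delta \<theta> \<phi>) = tgt \<theta>"
  by (auto simp: Delta_def concrete_category_def mono_on_def)

lemma Cmp_Delta_in [simp]:
  "\<lbrakk>\<theta> \<in> Arr Delta; \<phi> \<in> Arr Delta; tgt \<phi> = src \<theta>\<rbrakk> \<Longrightarrow> Cmp Delta \<theta> \<phi> \<in> Arr Delta"
  using category.cmp_in[OF category_Delta, of \<phi> \<theta>] by (simp add: Delta_def concrete_category_def)

definition simplicial_group :: "'u sab \<Rightarrow> bool" where
  "simplicial_group = is_functor (opposite Delta) ab_cat"

lemma simplicial_group_iff: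
  "simplicial_group A \<longleftrightarrow> (\<forall>m. comm_group (on_obj A m)) \<and> on_arr A \<in> extensional (Arr Delta) \<and>
    (\<forall>\<theta>\<in>Arr Delta. src (on_arr A \<theta>) = on_obj A (tgt \<theta>) \<and> tgt (on_arr A \<theta>) = on_obj A (src \<theta>) \<and>
       dat (on_arr A \<theta>) \<in> carrier (on_obj A (tgt \<theta>)) \<rightarrow>\<^sub>E carrier (on_obj A (src \<theta>)) \<and>
       dat (on_arr A \<theta>) \<in> hom (on_obj A (tgt \<theta>)) (on_obj A (src \<theta>))) \<and>
    (\<forall>m. \<forall>a\<in>carrier (on_obj A m). dat (on_arr A (Idn Delta m)) a = a) \<and>
    (\<forall>\<theta>\<in>Arr Delta. \<forall>\<phi>\<in>Arr Delta. tgt \<phi> = src \<theta> \<longrightarrow> (\<forall>a\<in>carrier (on_obj A (tgt \<theta>)).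
       dat (on_arr A (Cmp Delta \<theta> \<phi>)) a = dat (on_arr A \<phi>) (dat (on_arr A \<theta>) a)))"
  unfolding simplicial_group_def ab_cat_def
  by (subst is_functor_concrete_category_iff[OF category_opposite_Delta]) (auto simp: eq_commute)

definition simplicial_hom :: "'u sab_map \<Rightarrow> bool" where
  "simplicial_hom = is_nat_trans (opposite Delta) ab_cat"

lemma simplicial_hom_iff:
  "simplicial_hom \<tau> \<longleftrightarrow> simplicial_group (src \<tau>) \<and> simplicial_group (tgt \<tau>) \<and>
    (\<forall>m. src (dat \<tau> m) = on_obj (src \<tau>) m \<and> tgt (dat \<tau> m) = on_obj (tgt \<tau>) m \<and>
       dat (dat \<tau> m) \<in> carrier (on_obj (src \<tau>) m) \<rightarrow>\<^sub>E carrier (on_obj (tgt \<tau>) m) \<and>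
       dat (dat \<tau> m) \<in> hom (on_obj (src \<tau>) m) (on_obj (tgt \<tau>) m)) \<and>
    (\<forall>\<theta>\<in>Arr Delta. \<forall>a\<in>carrier (on_obj (src \<tau>) (tgt \<theta>)).
       dat (dat \<tau> (src \<theta>)) (dat (on_arr (src \<tau>) \<theta>) a) = dat (on_arr (tgt \<tau>) \<theta>) (dat (dat \<tau> (tgt \<theta>)) a))"
  unfolding simplicial_hom_def simplicial_group_def ab_cat_def
  by (subst is_nat_trans_concrete_category_iff[OF category_opposite_Delta]) (simp add: conj_assoc)

lemma simplicial_abelian_groups_simps:
  "Obj simplicial_abelian_groups = Collect simplicial_group" "Arr simplicial_abelian_groups = Collect simplicial_hom"
  "Dom simplicial_abelian_groups = src" "Cod simplicial_abelian_groups = tgt"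
  "Idn simplicial_abelian_groups = (\<lambda>A. \<lparr>src = A, dat = (\<lambda>m. Idn ab_cat (on_obj A m)), tgt = A\<rparr>)"
  "Cmp simplicial_abelian_groups = (\<lambda>\<sigma> \<tau>. \<lparr>src = src \<tau>, dat = (\<lambda>m. Cmp ab_cat (dat \<sigma> m) (dat \<tau> m)), tgt = tgt \<sigma>\<rparr>)"
  by (simp_all add: simplicial_abelian_groups_def functor_category_def simplicial_group_def simplicial_hom_def restrict_def)

lemma simplicial_hom_eqI:
  assumes "simplicial_hom \<sigma>" "simplicial_hom \<tau>" "src \<sigma> = src \<tau>" "tgt \<sigma> = tgt \<tau>"
    and "\<And>m a. a \<in> carrier (on_obj (src \<tau>) m) \<Longrightarrow> dat (dat \<sigma> m) a = dat (dat \<tau> m) a"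
  shows "\<sigma> = \<tau>"
proof -
  have "dat (dat \<sigma> m) = dat (dat \<tau> m)" for m
    using assms
    by (intro PiE_ext[of _ "carrier (on_obj (src \<tau>) m)" "\<lambda>_. carrier (on_obj (tgt \<tau>) m)"]) (auto simp: simplicial_hom_iff)
  then have "dat \<sigma> m = dat \<tau> m" for m
    using assms(1-4) by (intro arrow.equality) (auto simp: simplicial_hom_iff)
  then show ?thesis using assms(3,4) by (intro arrow.equality) auto
qed

lemma gamma_functor_act_in:
  "\<lbrakk>gamma_functor X; f \<in> Arr Gamma_op; x \<in> level X m (src f)\<rbrakk> \<Longrightarrow> level_act X m f x \<in> level X m (tgt f)"
  by (auto simp: gamma_functor_iff sset_morphism_iff PiE_iff)

text \<open>Arrows of \<open>Gamma_op\<close> act by simplicial maps; read the other way round,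
  simplicial operators are maps of \<Gamma>-sets.\<close>

lemma gamma_functor_natural:
  assumes "gamma_functor X" "f \<in> Arr Gamma_op" "\<theta> \<in> Arr Delta" "x \<in> level X (tgt \<theta>) (src f)"
  shows "dat (on_arr (on_obj X (tgt f)) \<theta>) (level_act X (tgt \<theta>) f x) =
     level_act X (src \<theta>) f (dat (on_arr (on_obj X (src f)) \<theta>) x)"
proof -
  have "sset_morphism (on_arr X f)" "src (on_arr X f) = on_obj X (src f)" "tgt (on_arr X f) = on_obj X (tgt f)"
    using assms by (auto simp: gamma_functor_iff)
  then show ?thesis using assms(3,4) by (auto simp: sset_morphism_iff)
qed

lemma simplicial_set_in:
  "\<lbrakk>simplicial_set A; \<theta> \<in> Arr Delta; x \<in> on_obj A (tgt \<theta>)\<rbrakk> \<Longrightarrow> dat (on_arr A \<theta>) x \<in> on_obj A (src \<theta>)"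
  by (auto simp: simplicial_set_iff PiE_iff)

section \<open>The Bousfield condition in each simplicial degree\<close>

lemma j_op_in: "k < n \<Longrightarrow> j_op n k \<in> Arr Gamma_op" "src (j_op n k) = n" "tgt (j_op n k) = 1"
  unfolding j_op_eq by (auto intro: indicator_arrow_in)

lemma bousfield_map_in:
  assumes "gamma_functor X" "x \<in> level X m n"
  shows "bousfield_map X n m x \<in> {..<n} \<rightarrow>\<^sub>E level X m 1"
proof -
  have "level_act X m (j_op n k) x \<in> level X m 1" if "k < n" for k
    using gamma_functor_act_in[OF assms(1) j_op_in(1)[OF that], of x m] assms(2)
    by (simp add: j_op_in(2,3) del: One_nat_def)
  then show ?thesis by (simp add: bousfield_map_def del: One_nat_def)
qed

lemma bousfield_map_natural:
  assumes X: "gamma_functor X" and \<theta>: "\<theta> \<in> Arr Delta" and x: "x \<in> level X (tgt \<theta>) n"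
  shows "bousfield_map X n (src \<theta>) (dat (on_arr (on_obj X n) \<theta>) x) =
     dat (on_arr (sset_power (on_obj X 1) n) \<theta>) (bousfield_map X n (tgt \<theta>) x)"
proof -
  have "dat (on_arr (sset_power (on_obj X 1) n) \<theta>) (bousfield_map X n (tgt \<theta>) x) =
    (\<lambda>k\<in>{..<n}. dat (on_arr (on_obj X 1) \<theta>) (level_act X (tgt \<theta>) (j_op n k) x))"
    using bousfield_map_in[OF X x] \<theta> by (simp add: sset_power_def bousfield_map_def cong: restrict_cong)
  also have "\<dots> = bousfield_map X n (src \<theta>) (dat (on_arr (on_obj X n) \<theta>) x)"
    unfolding bousfield_map_def
    using gamma_functor_natural[OF X j_op_in(1) \<theta>, of _ n x] x
    by (intro restrict_ext) (simp add: j_op_in(2,3) del: One_nat_def)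
  finally show ?thesis by simp
qed

text \<open>The degreewise inverse of a bijective simplicial map is again simplicial, so the
  isomorphism condition can be tested in each degree separately.\<close>

lemma strict_bousfield_iff:
  assumes X: "gamma_functor X"
  shows "strict_bousfield X \<longleftrightarrow> on_obj X 0 = Delta0 \<and>
    (\<forall>n\<ge>2. \<forall>m. bij_betw (bousfield_map X n m) (level X m n) ({..<n} \<rightarrow>\<^sub>E level X m 1))"
proof -
  have "simplicial_iso (on_obj X n) (sset_power (on_obj X 1) n) (bousfield_map X n) \<longleftrightarrow>
     (\<forall>m. bij_betw (bousfield_map X n m) (level X m n) ({..<n} \<rightarrow>\<^sub>E level X m 1))" for n
  proof -
    have po: "on_obj (sset_power (on_obj X 1) n) m = {..<n} \<rightarrow>\<^sub>E level X m 1" for m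
      by (simp add: sset_power_def)
    show ?thesis
    proof
    assume "simplicial_iso (on_obj X n) (sset_power (on_obj X 1) n) (bousfield_map X n)"
    then obtain \<psi> where \<psi>: "simplicial_map (sset_power (on_obj X 1) n) (on_obj X n) \<psi>"
      "\<forall>m. (\<forall>x\<in>level X m n. \<psi> m (bousfield_map X n m x) = x) \<and>
        (\<forall>y\<in>{..<n} \<rightarrow>\<^sub>E level X m 1. bousfield_map X n m (\<psi> m y) = y)"
      unfolding simplicial_iso_def po by blast
    then have p: "\<psi> m \<in> ({..<n} \<rightarrow>\<^sub>E level X m 1) \<rightarrow> level X m n" for m
      unfolding simplicial_map_def po by blast
    show "\<forall>m. bij_betw (bousfield_map X n m) (level X m n) ({..<n} \<rightarrow>\<^sub>E level X m 1)"
    proof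
      fix m
      show "bij_betw (bousfield_map X n m) (level X m n) ({..<n} \<rightarrow>\<^sub>E level X m 1)"
        by (rule bij_betwI[where g = "\<psi> m"]) (use p[of m] \<psi>(2) bousfield_map_in[OF X] in blast)+
    qed
  next
    assume b: "\<forall>m. bij_betw (bousfield_map X n m) (level X m n) ({..<n} \<rightarrow>\<^sub>E level X m 1)"
    define \<psi> where "\<psi> m = inv_into (level X m n) (bousfield_map X n m)" for m
    have l: "\<psi> m (bousfield_map X n m x) = x" if "x \<in> level X m n" for m x
      unfolding \<psi>_def by (rule bij_betw_inv_into_left[OF b[rule_format] that])
    have r: "bousfield_map X n m (\<psi> m y) = y" if "y \<in> {..<n} \<rightarrow>\<^sub>E level X m 1" for m y
      unfolding \<psi>_def by (rule bij_betw_inv_into_right[OF b[rule_format] that])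
    have pin: "\<psi> m y \<in> level X m n" if "y \<in> {..<n} \<rightarrow>\<^sub>E level X m 1" for m y
      unfolding \<psi>_def by (rule inv_into_into) (use b that in \<open>simp add: bij_betw_def\<close>)
    have s: "simplicial_set (on_obj X n)" using X by (simp add: gamma_functor_iff)
    have "simplicial_map (on_obj X n) (sset_power (on_obj X 1) n) (bousfield_map X n)"
      unfolding simplicial_map_def po using bousfield_map_in[OF X] bousfield_map_natural[OF X] by auto
    moreover have "simplicial_map (sset_power (on_obj X 1) n) (on_obj X n) \<psi>"
      unfolding simplicial_map_def po
    proof (intro conjI allI ballI)
      show "\<psi> m \<in> ({..<n} \<rightarrow>\<^sub>E level X m 1) \<rightarrow> level X m n" for m using pin by blast
      fix \<theta> y assume a: "\<theta> \<in> Arr (opposite Delta)" "y \<in> {..<n} \<rightarrow>\<^sub>E level X (Dom (opposite Delta) \<theta>) 1"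
      then have a': "\<theta> \<in> Arr Delta" "y \<in> {..<n} \<rightarrow>\<^sub>E level X (tgt \<theta>) 1" by simp_all
      have "dat (on_arr (sset_power (on_obj X 1) n) \<theta>) y =
          bousfield_map X n (src \<theta>) (dat (on_arr (on_obj X n) \<theta>) (\<psi> (tgt \<theta>) y))"
        using bousfield_map_natural[OF X a'(1) pin[OF a'(2)]] r[OF a'(2)] by simp
      then show "\<psi> (Cod (opposite Delta) \<theta>) (dat (on_arr (sset_power (on_obj X 1) n) \<theta>) y) =
         dat (on_arr (on_obj X n) \<theta>) (\<psi> (Dom (opposite Delta) \<theta>) y)"
        using l[OF simplicial_set_in[OF s a'(1) pin[OF a'(2)]]] by simp
    qed
    ultimately show "simplicial_iso (on_obj X n) (sset_power (on_obj X 1) n) (bousfield_map X n)"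
      unfolding simplicial_iso_def po using l r by blast
    qed
  qed
  then show ?thesis by (simp add: strict_bousfield_def)
qed

lemma strict_bousfield_gamma_spaces_simps:
  "X \<in> Obj strict_bousfield_gamma_spaces \<longleftrightarrow> gamma_functor X \<and> strict_bousfield X"
  "\<tau> \<in> Arr strict_bousfield_gamma_spaces \<longleftrightarrow> gamma_morphism \<tau> \<and> strict_bousfield (src \<tau>) \<and> strict_bousfield (tgt \<tau>)"
  "Dom strict_bousfield_gamma_spaces = src" "Cod strict_bousfield_gamma_spaces = tgt"
  "Idn strict_bousfield_gamma_spaces = (\<lambda>X. \<lparr>src = X, dat = (\<lambda>n. Idn simplicial_sets (on_obj X n)), tgt = X\<rparr>)"
  "Cmp strict_bousfield_gamma_spaces =
     (\<lambda>\<sigma> \<tau>. \<lparr>src = src \<tau>, dat = (\<lambda>n. Cmp simplicial_sets (dat \<sigma> n) (dat \<tau> n)), tgt = tgt \<sigma>\<rparr>)"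
  by (simp_all add: strict_bousfield_gamma_spaces_def full_subcategory_def functor_category_def
      gamma_functor_def gamma_morphism_def restrict_def)

lemma gamma_set_level:
  assumes "gamma_functor X" "strict_bousfield X"
  shows "gamma_set (level X m) (level_act X m)"
proof
  note b = assms(2)[unfolded strict_bousfield_iff[OF assms(1)]]
  show "\<exists>p. level X m 0 = {p}" using b by (simp add: Delta0_def)
  show "bij_betw (\<lambda>x. \<lambda>k\<in>{..<n}. level_act X m (j_op n k) x) (level X m n) ({..<n} \<rightarrow>\<^sub>E level X m 1)"
    if "2 \<le> n" for n using b that by (simp add: bousfield_map_def[abs_def])
next
  show "level_act X m f x \<in> level X m (tgt f)" if "f \<in> Arr Gamma_op" "x \<in> level X m (src f)" for f x
    by (rule gamma_functor_act_in[OF assms(1) that])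
qed (use assms(1) in \<open>auto simp: gamma_functor_iff\<close>)

section \<open>The functor to simplicial abelian groups is fully faithful\<close>

definition level_group :: "'u gamma_space \<Rightarrow> nat \<Rightarrow> 'u monoid" where
  "level_group X m = gamma_set.grp (level X m) (level_act X m)"

definition underlying_group :: "'u gamma_space \<Rightarrow> 'u sab" where
  "underlying_group X = \<lparr>on_obj = level_group X,
     on_arr = (\<lambda>\<theta>\<in>Arr Delta. \<lparr>src = level_group X (tgt \<theta>), dat = dat (on_arr (on_obj X 1) \<theta>), tgt = level_group X (src \<theta>)\<rparr>)\<rparr>"

definition underlying_hom :: "'u gamma_map \<Rightarrow> 'u sab_map" where
  "underlying_hom \<tau> = \<lparr>src = underlying_group (src \<tau>),
     dat = (\<lambda>m. \<lparr>src = level_group (src \<tau>) m, dat = dat (dat (dat \<tau> 1) m), tgt = level_group (tgt \<tau>) m\<rparr>),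
     tgt = underlying_group (tgt \<tau>)\<rparr>"

definition underlying_functor :: "('u gamma_space, 'u gamma_map, 'u sab, 'u sab_map) functr" where
  "underlying_functor = \<lparr>on_obj = restrict underlying_group (Obj strict_bousfield_gamma_spaces),
     on_arr = restrict underlying_hom (Arr strict_bousfield_gamma_spaces)\<rparr>"

lemma underlying_group_simps [simp]:
  "on_obj (underlying_group X) = level_group X"
  "\<theta> \<in> Arr Delta \<Longrightarrow> dat (on_arr (underlying_group X) \<theta>) = dat (on_arr (on_obj X 1) \<theta>)"
  by (simp_all add: underlying_group_def)

lemma carrier_level_group:
  "\<lbrakk>gamma_functor X; strict_bousfield X\<rbrakk> \<Longrightarrow> carrier (level_group X m) = level X m 1"
  unfolding level_group_def by (rule gamma_set.carrier_grp[OF gamma_set_level])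

text \<open>An operator \<theta> is a map from the \<Gamma>-set in degree
  \<open>tgt \<theta>\<close> to the one in degree \<open>src \<theta>\<close>, so
  \<open>natural_diff\<close> makes its component at 1 a homomorphism.\<close>

lemma simplicial_group_underlying_group:
  assumes X: "gamma_functor X" "strict_bousfield X"
  shows "simplicial_group (underlying_group X)"
proof -
  have s: "simplicial_set (on_obj X n)" for n using X by (simp add: gamma_functor_iff)
  have h: "dat (on_arr (on_obj X 1) \<theta>) \<in> hom (level_group X (tgt \<theta>)) (level_group X (src \<theta>))"
    if \<theta>: "\<theta> \<in> Arr Delta" for \<theta>
  proof -
    interpret gamma_set_pair "level X (tgt \<theta>)" "level_act X (tgt \<theta>)" "level X (src \<theta>)" "level_act X (src \<theta>)"
      by (simp add: gamma_set_pair_def gamma_set_level X)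
    have t: "dat (on_arr (on_obj X n) \<theta>) \<in> level X (tgt \<theta>) n \<rightarrow> level X (src \<theta>) n" for n
      using simplicial_set_in[OF s \<theta>] by blast
    show ?thesis
      unfolding level_group_def hom_iff_diff[OF t]
      by (intro ballI natural_diff[where t = "\<lambda>n. dat (on_arr (on_obj X n) \<theta>)"] t)
        (simp_all add: gamma_functor_natural[OF X(1) _ \<theta>])
  qed
  have "comm_group (level_group X m)" for m
    unfolding level_group_def by (rule gamma_set.comm_group_grp[OF gamma_set_level[OF X]])
  then show ?thesis
    unfolding simplicial_group_iff
    using s[of 1] h by (simp add: underlying_group_def carrier_level_group[OF X] simplicial_set_iff del: One_nat_def)
qed

lemma gamma_morphism_in:
  assumes "gamma_morphism \<tau>" "x \<in> level (src \<tau>) m n"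
  shows "dat (dat (dat \<tau> n) m) x \<in> level (tgt \<tau>) m n"
proof -
  have d: "sset_morphism (dat \<tau> n)" "src (dat \<tau> n) = on_obj (src \<tau>) n" "tgt (dat \<tau> n) = on_obj (tgt \<tau>) n"
    using assms(1) unfolding gamma_morphism_iff by blast+
  have "dat (dat (dat \<tau> n) m) \<in> level (src \<tau>) m n \<rightarrow>\<^sub>E level (tgt \<tau>) m n"
    using d(1) unfolding sset_morphism_iff d(2,3) by blast
  then show ?thesis using assms(2) by (rule PiE_mem)
qed

text \<open>The \<open>natural_diff\<close> argument again, now between two spaces in a fixed
  degree.\<close>

lemma simplicial_hom_underlying_hom:
  assumes \<tau>: "gamma_morphism \<tau>" and sb: "strict_bousfield (src \<tau>)" "strict_bousfield (tgt \<tau>)"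
  shows "simplicial_hom (underlying_hom \<tau>)"
proof -
  have g: "gamma_functor (src \<tau>)" "gamma_functor (tgt \<tau>)" using \<tau> by (auto simp: gamma_morphism_iff)
  have d: "sset_morphism (dat \<tau> 1)" "src (dat \<tau> 1) = on_obj (src \<tau>) 1" "tgt (dat \<tau> 1) = on_obj (tgt \<tau>) 1"
    using \<tau> by (auto simp: gamma_morphism_iff)
  have h: "dat (dat (dat \<tau> 1) m) \<in> hom (level_group (src \<tau>) m) (level_group (tgt \<tau>) m)" for m
  proof -
    interpret gamma_set_pair "level (src \<tau>) m" "level_act (src \<tau>) m" "level (tgt \<tau>) m" "level_act (tgt \<tau>) m"
      by (simp add: gamma_set_pair_def gamma_set_level g sb)
    have t: "dat (dat (dat \<tau> n) m) \<in> level (src \<tau>) m n \<rightarrow> level (tgt \<tau>) m n" for n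
      using gamma_morphism_in[OF \<tau>] by blast
    show ?thesis
      unfolding level_group_def hom_iff_diff[OF t]
      by (intro ballI natural_diff[where t = "\<lambda>n. dat (dat (dat \<tau> n) m)"] t)
        (use \<tau> in \<open>simp_all add: gamma_morphism_iff\<close>)
  qed
  show ?thesis
    unfolding simplicial_hom_iff
    using h d simplicial_group_underlying_group[OF g(1) sb(1)] simplicial_group_underlying_group[OF g(2) sb(2)] g sb
    by (simp add: underlying_hom_def sset_morphism_iff carrier_level_group del: One_nat_def)
qed

lemma is_functor_underlying_functor:
  "is_functor strict_bousfield_gamma_spaces simplicial_abelian_groups underlying_functor"
proof -
  interpret category strict_bousfield_gamma_spaces by (rule category_strict_bousfield_gamma_spaces)
  show ?thesis
    unfolding is_functor_def
  proof (intro conjI ballI impI)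
    show "on_obj underlying_functor \<in> Obj strict_bousfield_gamma_spaces \<rightarrow>\<^sub>E Obj simplicial_abelian_groups"
      by (auto simp: underlying_functor_def simplicial_abelian_groups_simps strict_bousfield_gamma_spaces_simps
          simplicial_group_underlying_group)
    show "on_arr underlying_functor \<in> Arr strict_bousfield_gamma_spaces \<rightarrow>\<^sub>E Arr simplicial_abelian_groups"
      by (auto simp: underlying_functor_def simplicial_abelian_groups_simps strict_bousfield_gamma_spaces_simps
          simplicial_hom_underlying_hom)
    fix \<tau> :: "'a gamma_map" assume t: "\<tau> \<in> Arr strict_bousfield_gamma_spaces"
    show "Dom simplicial_abelian_groups (on_arr underlying_functor \<tau>) =
         on_obj underlying_functor (Dom strict_bousfield_gamma_spaces \<tau>)"
      "Cod simplicial_abelian_groups (on_arr underlying_functor \<tau>) =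
         on_obj underlying_functor (Cod strict_bousfield_gamma_spaces \<tau>)"
      using t dom_in[OF t] cod_in[OF t]
      by (simp_all add: underlying_functor_def underlying_hom_def simplicial_abelian_groups_simps
          strict_bousfield_gamma_spaces_simps(3,4))
    fix \<sigma> :: "'a gamma_map" assume s: "\<sigma> \<in> Arr strict_bousfield_gamma_spaces"
      "Cod strict_bousfield_gamma_spaces \<tau> = Dom strict_bousfield_gamma_spaces \<sigma>"
    \<comment> \<open>Composites are restricted to the source in \<open>set_cat\<close> and to the
      carrier of the source in \<open>ab_cat\<close>; these are the same set.\<close>
    have c: "carrier (level_group (src \<tau>) m) = on_obj (src (dat \<tau> 1)) m"
      "src (dat (dat \<tau> 1) m) = on_obj (src (dat \<tau> 1)) m" for m
      using t by (auto simp: strict_bousfield_gamma_spaces_simps gamma_morphism_iff carrier_level_group sset_morphism_iff)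
    show "on_arr underlying_functor (Cmp strict_bousfield_gamma_spaces \<sigma> \<tau>) =
      Cmp simplicial_abelian_groups (on_arr underlying_functor \<sigma>) (on_arr underlying_functor \<tau>)"
      using cmp_in[OF t s] t s
      by (simp add: underlying_functor_def underlying_hom_def simplicial_abelian_groups_simps(6) fun_eq_iff
          strict_bousfield_gamma_spaces_simps(3-6) ab_cat_def concrete_category_def c
          simplicial_sets_simps(6) set_cat_def del: One_nat_def)
  next
    fix X :: "'a gamma_space" assume X: "X \<in> Obj strict_bousfield_gamma_spaces"
    then have c: "carrier (level_group X m) = level X m 1" for m
      by (simp add: strict_bousfield_gamma_spaces_simps carrier_level_group)
    show "on_arr underlying_functor (Idn strict_bousfield_gamma_spaces X) =
      Idn simplicial_abelian_groups (on_obj underlying_functor X)"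
      using idn_in[OF X] X
      by (simp add: underlying_functor_def underlying_hom_def underlying_group_def simplicial_abelian_groups_simps(5) fun_eq_iff
          strict_bousfield_gamma_spaces_simps(3-6) ab_cat_def concrete_category_def c
          simplicial_sets_simps(5) set_cat_def del: One_nat_def)
  qed
qed

lemma gamma_morphism_eqI:
  assumes "gamma_morphism \<sigma>" "gamma_morphism \<tau>" "src \<sigma> = src \<tau>" "tgt \<sigma> = tgt \<tau>"
    and "\<And>m n x. x \<in> level (src \<tau>) m n \<Longrightarrow> dat (dat (dat \<sigma> n) m) x = dat (dat (dat \<tau> n) m) x"
  shows "\<sigma> = \<tau>"
proof -
  have "dat \<sigma> n = dat \<tau> n" for n
    using assms by (intro sset_morphism_eqI) (auto simp: gamma_morphism_iff)
  then show ?thesis using assms(3,4) by (intro arrow.equality) auto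
qed

text \<open>In each degree both maps are the \<open>extension\<close> of the same component at
  1.\<close>

lemma underlying_hom_faithful:
  assumes \<sigma>: "gamma_morphism \<sigma>" and \<tau>: "gamma_morphism \<tau>" and st: "src \<sigma> = src \<tau>" "tgt \<sigma> = tgt \<tau>"
    and sb: "strict_bousfield (src \<tau>)" "strict_bousfield (tgt \<tau>)"
    and eq: "underlying_hom \<sigma> = underlying_hom \<tau>"
  shows "\<sigma> = \<tau>"
proof (rule gamma_morphism_eqI[OF \<sigma> \<tau> st])
  fix m n x assume x: "x \<in> level (src \<tau>) m n"
  have g: "gamma_functor (src \<tau>)" "gamma_functor (tgt \<tau>)" using \<tau> by (auto simp: gamma_morphism_iff)
  interpret gamma_set_pair "level (src \<tau>) m" "level_act (src \<tau>) m" "level (tgt \<tau>) m" "level_act (tgt \<tau>) m"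
    by (simp add: gamma_set_pair_def gamma_set_level g sb)
  have ext: "dat (dat (dat \<rho> n) m) x = extension (dat (dat (dat \<rho> 1) m)) n x"
    if \<rho>: "gamma_morphism \<rho>" "src \<rho> = src \<tau>" "tgt \<rho> = tgt \<tau>" for \<rho>
  proof (rule natural_eq_extension[where t = "\<lambda>n. dat (dat (dat \<rho> n) m)", OF _ _ x])
    show "dat (dat (dat \<rho> n) m) \<in> level (src \<tau>) m n \<rightarrow> level (tgt \<tau>) m n" for n
      using gamma_morphism_in[OF \<rho>(1)] \<rho>(2,3) by auto
    show "dat (dat (dat \<rho> (tgt f)) m) (level_act (src \<tau>) m f y) = level_act (tgt \<tau>) m f (dat (dat (dat \<rho> (src f)) m) y)"
      if "f \<in> Arr Gamma_op" "y \<in> level (src \<tau>) m (src f)" for f y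
      using \<rho> that by (auto simp: gamma_morphism_iff)
  qed
  have "dat (dat (dat \<sigma> 1) m) = dat (dat (dat \<tau> 1) m)"
    using arg_cong[OF eq, of "\<lambda>h. dat (dat h m)"] by (simp add: underlying_hom_def)
  then show "dat (dat (dat \<sigma> n) m) x = dat (dat (dat \<tau> n) m) x"
    using ext[OF \<sigma> st] ext[OF \<tau>] by simp
qed

text \<open>Each \<open>h m\<close> extends to a map of \<Gamma>-sets. That these extensions commute
  with simplicial operators is checked at initial segments, where it reduces to the naturality of
  \<psi>.\<close>

lemma underlying_hom_full:
  assumes X: "gamma_functor X" "strict_bousfield X" and Y: "gamma_functor Y" "strict_bousfield Y"
    and \<psi>: "simplicial_hom \<psi>" "src \<psi> = underlying_group X" "tgt \<psi> = underlying_group Y"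
  shows "\<exists>\<tau>. gamma_morphism \<tau> \<and> src \<tau> = X \<and> tgt \<tau> = Y \<and> underlying_hom \<tau> = \<psi>"
proof -
  define h where "h m = dat (dat \<psi> m)" for m
  define t where "t m = gamma_set_pair.extension (level_act X m) (level Y m) (level_act Y m) (h m)" for m
  have pair: "gamma_set_pair (level X m) (level_act X m) (level Y m) (level_act Y m)" for m
    by (simp add: gamma_set_pair_def gamma_set_level X Y)
  have hh: "h m \<in> hom (gamma_set.grp (level X m) (level_act X m)) (gamma_set.grp (level Y m) (level_act Y m))" for m
    using \<psi> by (simp add: simplicial_hom_iff h_def level_group_def)
  have hE: "h m \<in> level X m 1 \<rightarrow>\<^sub>E level Y m 1" for m
    using \<psi> by (simp add: simplicial_hom_iff h_def carrier_level_group X Y del: One_nat_def)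
  then have hin: "h m \<in> level X m 1 \<rightarrow> level Y m 1" for m by (auto simp: PiE_iff)
  have hnat: "h (src \<theta>) (dat (on_arr (on_obj X 1) \<theta>) a) = dat (on_arr (on_obj Y 1) \<theta>) (h (tgt \<theta>) a)"
    if "\<theta> \<in> Arr Delta" "a \<in> level X (tgt \<theta>) 1" for \<theta> a
    using \<psi> that by (simp add: simplicial_hom_iff h_def carrier_level_group X Y del: One_nat_def)
  have s: "simplicial_set (on_obj X n)" "simplicial_set (on_obj Y n)" for n
    using X Y by (auto simp: gamma_functor_iff)
  have tin: "t m n x \<in> level Y m n" if "x \<in> level X m n" for m n x
    unfolding t_def by (rule gamma_set_pair.extension_in[OF pair hin that])
  have t1: "t m 1 x = h m x" if "x \<in> level X m 1" for m x
    unfolding t_def by (rule gamma_set_pair.extension_one[OF pair hh that])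
  have tnat: "t m (tgt f) (level_act X m f x) = level_act Y m f (t m (src f) x)"
    if "f \<in> Arr Gamma_op" "x \<in> level X m (src f)" for m f x
    unfolding t_def by (rule gamma_set_pair.extension_natural[OF pair hh that])
  have tsimp: "t (src \<theta>) n (dat (on_arr (on_obj X n) \<theta>) x) = dat (on_arr (on_obj Y n) \<theta>) (t (tgt \<theta>) n x)"
    if \<theta>: "\<theta> \<in> Arr Delta" and x: "x \<in> level X (tgt \<theta>) n" for \<theta> n x
  proof -
    interpret P: gamma_set_pair "level X (src \<theta>)" "level_act X (src \<theta>)" "level Y (src \<theta>)" "level_act Y (src \<theta>)"
      by (rule pair)
    interpret Q: gamma_set_pair "level X (tgt \<theta>)" "level_act X (tgt \<theta>)" "level Y (tgt \<theta>)" "level_act Y (tgt \<theta>)"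
      by (rule pair)
    show ?thesis
      \<comment> \<open>Only the left side is unfolded: it is an extension in degree
        \<open>src \<theta>\<close>, and the right side is shown to have its defining
        property.\<close>
      unfolding t_def[of "src \<theta>"]
    proof (rule P.extension_unique)
      show "dat (on_arr (on_obj Y n) \<theta>) (t (tgt \<theta>) n x) \<in> level Y (src \<theta>) n"
        by (rule simplicial_set_in[OF s(2) \<theta> tin[OF x]])
      fix k assume k: "k < n"
      have T: "{1..k+1} \<subseteq> {1..n}" using k by auto
      note i = indicator_arrow_in[OF T]
      have "P.Y.val n {1..k+1} (dat (on_arr (on_obj Y n) \<theta>) (t (tgt \<theta>) n x)) =
          dat (on_arr (on_obj Y 1) \<theta>) (Q.Y.val n {1..k+1} (t (tgt \<theta>) n x))"
        using gamma_functor_natural[OF Y(1) i \<theta>, of "t (tgt \<theta>) n x"] tin[OF x]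
        by (simp add: P.Y.val_def Q.Y.val_def del: One_nat_def)
      also have "\<dots> = dat (on_arr (on_obj Y 1) \<theta>) (h (tgt \<theta>) (Q.X.val n {1..k+1} x))"
        unfolding t_def by (simp only: Q.val_extension_initial[OF hin x k])
      also have "\<dots> = h (src \<theta>) (dat (on_arr (on_obj X 1) \<theta>) (Q.X.val n {1..k+1} x))"
        by (rule hnat[OF \<theta> Q.X.val_in[OF x T], symmetric])
      also have "dat (on_arr (on_obj X 1) \<theta>) (Q.X.val n {1..k+1} x) =
          P.X.val n {1..k+1} (dat (on_arr (on_obj X n) \<theta>) x)"
        using gamma_functor_natural[OF X(1) i \<theta>, of x] x
        by (simp add: P.X.val_def Q.X.val_def del: One_nat_def)
      finally show "P.Y.val n {1..k+1} (dat (on_arr (on_obj Y n) \<theta>) (t (tgt \<theta>) n x)) =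
          h (src \<theta>) (P.X.val n {1..k+1} (dat (on_arr (on_obj X n) \<theta>) x))" .
    qed
  qed
  define \<tau> where "\<tau> = \<lparr>src = X, dat = (\<lambda>n. \<lparr>src = on_obj X n,
     dat = (\<lambda>m. \<lparr>src = level X m n, dat = restrict (t m n) (level X m n), tgt = level Y m n\<rparr>), tgt = on_obj Y n\<rparr>), tgt = Y\<rparr>"
  have \<tau>: "gamma_morphism \<tau>"
    unfolding gamma_morphism_iff sset_morphism_iff
    using X(1) Y(1) s tin tnat tsimp simplicial_set_in[OF s(1)] gamma_functor_act_in[OF X(1)]
    by (simp add: \<tau>_def)
  moreover have "underlying_hom \<tau> = \<psi>"
  proof (rule simplicial_hom_eqI[OF simplicial_hom_underlying_hom[OF \<tau>] \<psi>(1)])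
    show "strict_bousfield (src \<tau>)" "strict_bousfield (tgt \<tau>)" using X Y by (simp_all add: \<tau>_def)
    show "src (underlying_hom \<tau>) = src \<psi>" "tgt (underlying_hom \<tau>) = tgt \<psi>"
      using \<psi> by (simp_all add: \<tau>_def underlying_hom_def)
    fix m a assume "a \<in> carrier (on_obj (src \<psi>) m)"
    then have "a \<in> level X m 1" using \<psi> by (simp add: carrier_level_group X del: One_nat_def)
    then show "dat (dat (underlying_hom \<tau>) m) a = dat (dat \<psi> m) a"
      using t1 by (simp add: underlying_hom_def \<tau>_def h_def)
  qed
  ultimately show ?thesis by (intro exI[of _ \<tau>]) (simp add: \<tau>_def)
qed

section \<open>Essential surjectivity\<close>

text \<open>A bijection of the universe with its square absorbs one coordinate at a time. For empty
  \<open>I\<close> there is only one extensional function, so any \<open>e\<close> will do.\<close>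

lemma ex_inj_on_extensional:
  assumes inf: "infinite (UNIV :: 'u set)" and "finite I"
  shows "\<exists>e :: ('i \<Rightarrow> 'u) \<Rightarrow> 'u. inj_on e (extensional I)"
proof -
  obtain p :: "'u \<times> 'u \<Rightarrow> 'u" where "bij_betw p (UNIV \<times> UNIV) UNIV"
    using card_of_Times_same_infinite[OF inf] card_of_ordIso by blast
  then have p: "inj p" by (simp add: bij_betw_def)
  show ?thesis
    using \<open>finite I\<close>
  proof (induction I)
    case empty
    show ?case by (auto simp: inj_on_def extensional_def fun_eq_iff)
  next
    case (insert i I)
    then obtain e :: "('i \<Rightarrow> 'u) \<Rightarrow> 'u" where e: "inj_on e (extensional I)" by blast
    have "inj_on (\<lambda>f. p (f i, e (restrict f I))) (extensional (insert i I))"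
    proof (rule inj_onI)
      fix f g assume fg: "f \<in> extensional (insert i I)" "g \<in> extensional (insert i I)"
        "p (f i, e (restrict f I)) = p (g i, e (restrict g I))"
      then have *: "f i = g i" "e (restrict f I) = e (restrict g I)" using injD[OF p fg(3)] by auto
      have "restrict f I = restrict g I" using *(2) by (subst (asm) inj_on_eq_iff[OF e]) auto
      then have "f x = g x" if "x \<in> I" for x using that by (metis restrict_apply')
      then show "f = g" using fg(1,2) *(1) by (intro extensionalityI) auto
    qed
    then show ?case by blast
  qed
qed

section \<open>Additive functions on finite sets of subsets\<close>

text \<open>Such a function is determined by its values at singletons. Recording the values at all
  subsets lets a pointed map act by taking preimages, without any sums.\<close>

definition additive_functions :: "nat \<Rightarrow> ('a, 'b) monoid_scheme \<Rightarrow> (nat set \<Rightarrow> 'a) set" where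
  "additive_functions n G = {v \<in> extensional (Pow {1..n}).
     subtraction.additive (carrier G) (\<lambda>a b. b \<otimes>\<^bsub>G\<^esub> inv\<^bsub>G\<^esub> a) n v}"

lemma additive_functions_iff:
  assumes "comm_group G"
  shows "v \<in> additive_functions n G \<longleftrightarrow> v \<in> extensional (Pow {1..n}) \<and> (\<forall>T\<subseteq>{1..n}. v T \<in> carrier G) \<and>
    (\<forall>T U. T \<subseteq> U \<longrightarrow> U \<subseteq> {1..n} \<longrightarrow> v U \<otimes>\<^bsub>G\<^esub> inv\<^bsub>G\<^esub> v T = v (U - T))"
  by (simp add: additive_functions_def subtraction.additive_def[OF comm_group.subtraction_carrier[OF assms]])

lemma additive_functions_eqI:
  assumes G: "comm_group G" and vw: "v \<in> additive_functions n G" "w \<in> additive_functions n G"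
    and eq: "\<And>k. k < n \<Longrightarrow> v {1..k+1} = w {1..k+1}"
  shows "v = w"
proof (rule extensionalityI)
  show "v \<in> extensional (Pow {1..n})" "w \<in> extensional (Pow {1..n})" using vw by (auto simp: additive_functions_def)
  show "v T = w T" if "T \<in> Pow {1..n}" for T
    by (rule subtraction.additive_eqI[OF comm_group.subtraction_carrier[OF G], where P = v and Q = w and n = n])
      (use vw that eq in \<open>simp_all add: additive_functions_def\<close>)
qed

text \<open>Summing consecutive differences of the prescribed values over \<open>T\<close> is
  additive in \<open>T\<close>, and telescopes over initial segments.\<close>

lemma (in comm_group) ex_additive_function:
  assumes c: "\<And>k. k < n \<Longrightarrow> c k \<in> carrier G"
  shows "\<exists>v\<in>additive_functions n G. \<forall>k<n. v {1..k+1} = c k"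
proof -
  \<comment> \<open>\<open>c k\<close> belongs to {1..k+1}, so \<open>i\<close> contributes c (i -
    1) - c (i - 2). The case i = 1 is separate because truncated subtraction would make both indices
    0.\<close>
  define b where "b i = (if i = 1 then c 0 else c (i - 1) \<otimes> inv c (i - 2))" for i
  have b: "b i \<in> carrier G" if "i \<in> {1..n}" for i
    using that c by (auto simp: b_def)
  define v where "v = (\<lambda>T\<in>Pow {1..n}. finprod G b T)"
  have vT: "v T = finprod G b T" "v T \<in> carrier G" if "T \<subseteq> {1..n}" for T
    using that b by (auto simp: v_def intro!: finprod_closed)
  have "v U \<otimes> inv v T = v (U - T)" if TU: "T \<subseteq> U" "U \<subseteq> {1..n}" for T U
  proof -
    have *: "T \<subseteq> {1..n}" "U - T \<subseteq> {1..n}" "T \<union> (U - T) = U" using TU by auto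
    have "finprod G b (T \<union> (U - T)) = finprod G b T \<otimes> finprod G b (U - T)"
      using *(1,2) b finite_subset[OF *(1)] finite_subset[OF *(2)] by (intro finprod_Un_disjoint) auto
    then have "v U = v T \<otimes> v (U - T)" using * vT TU by simp
    moreover have "v T \<otimes> v (U - T) \<otimes> inv v T = v (U - T)"
      using vT(2)[OF *(1)] vT(2)[OF *(2)] by (simp add: m_comm[of "v T"] m_assoc)
    ultimately show ?thesis by simp
  qed
  then have "v \<in> additive_functions n G"
    using vT(2) by (simp add: additive_functions_iff[OF comm_group_axioms]) (simp add: v_def)
  moreover have "v {1..k+1} = c k" if "k < n" for k
    using that
  proof (induction k)
    case 0
    then show ?case using c[of 0] vT(1)[of "{1}"] by (simp add: b_def)
  next
    case (Suc k)
    have i: "{1..Suc k + 1} = insert (k + 2) {1..k+1}" by auto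
    have "v {1..Suc k + 1} = finprod G b (insert (k + 2) {1..k+1})"
      unfolding i[symmetric] using Suc.prems by (intro vT) auto
    also have "\<dots> = b (k + 2) \<otimes> finprod G b {1..k+1}"
      using Suc.prems b by (intro finprod_insert) auto
    also have "finprod G b {1..k+1} = c k" using Suc vT(1)[of "{1..k+1}"] by simp
    also have "b (k + 2) \<otimes> c k = c (Suc k)"
      using c[of k] c[of "Suc k"] Suc.prems by (simp add: b_def m_assoc)
    finally show ?case .
  qed
  ultimately show ?thesis by blast
qed

text \<open>Covariant in \<open>f\<close>, since functions on subsets are composed with the preimage
  map. For an additive function, the value at {j} is the sum of the values at the singletons in the
  fibre over j.\<close>

definition pull :: "nat_arrow \<Rightarrow> (nat set \<Rightarrow> 'a) \<Rightarrow> nat set \<Rightarrow> 'a" where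
  "pull f v = (\<lambda>T\<in>Pow {1..tgt f}. v {i \<in> {..src f}. dat f i \<in> T})"

lemma pull_in:
  assumes G: "comm_group G" and f: "f \<in> Arr Gamma_op" and v: "v \<in> additive_functions (src f) G"
  shows "pull f v \<in> additive_functions (tgt f) G"
  unfolding additive_functions_iff[OF G]
proof (intro conjI allI impI)
  note v' = v[unfolded additive_functions_iff[OF G]]
  show "pull f v \<in> extensional (Pow {1..tgt f})" by (simp add: pull_def)
  show "pull f v T \<in> carrier G" if "T \<subseteq> {1..tgt f}" for T
    using v' preimage_subset[OF f that] that by (simp add: pull_def)
  fix T U assume TU: "T \<subseteq> U" "U \<subseteq> {1..tgt f}"
  then have T: "T \<subseteq> {1..tgt f}" "U - T \<subseteq> {1..tgt f}" by auto
  have "{i \<in> {..src f}. dat f i \<in> U - T} = {i \<in> {..src f}. dat f i \<in> U} - {i \<in> {..src f}. dat f i \<in> T}"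
    by auto
  moreover have "{i \<in> {..src f}. dat f i \<in> T} \<subseteq> {i \<in> {..src f}. dat f i \<in> U}" using TU by auto
  ultimately show "pull f v U \<otimes>\<^bsub>G\<^esub> inv\<^bsub>G\<^esub> pull f v T = pull f v (U - T)"
    using v' preimage_subset[OF f TU(2)] TU T by (simp add: pull_def)
qed

lemma pull_Idn:
  assumes "v \<in> extensional (Pow {1..n})"
  shows "pull (Idn Gamma_op n) v = v"
proof (rule extensionalityI[OF _ assms])
  show "pull (Idn Gamma_op n) v \<in> extensional (Pow {1..n})"
    by (simp add: pull_def Gamma_op_def concrete_category_def)
  fix T assume T: "T \<in> Pow {1..n}"
  then have "{i \<in> {..n}. (if i \<le> n then i else undefined) \<in> T} = T" by auto
  then show "pull (Idn Gamma_op n) v T = v T"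
    using T by (simp add: pull_def Gamma_op_def concrete_category_def restrict_def)
qed

lemma pull_Cmp:
  assumes f: "f \<in> Arr Gamma_op" and g: "g \<in> Arr Gamma_op" "tgt f = src g"
  shows "pull (Cmp Gamma_op g f) v = pull g (pull f v)"
proof (rule extensionalityI[of _ "Pow {1..tgt g}"])
  have st: "src (Cmp Gamma_op g f) = src f" "tgt (Cmp Gamma_op g f) = tgt g"
    by (simp_all add: Gamma_op_def concrete_category_def)
  show "pull (Cmp Gamma_op g f) v \<in> extensional (Pow {1..tgt g})" "pull g (pull f v) \<in> extensional (Pow {1..tgt g})"
    by (simp_all add: pull_def st)
  fix T assume "T \<in> Pow {1..tgt g}"
  then have T: "T \<subseteq> {1..tgt g}" by simp
  have "{i \<in> {..src f}. dat (Cmp Gamma_op g f) i \<in> T} =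
     {i \<in> {..src f}. dat f i \<in> {i \<in> {..src g}. dat g i \<in> T}}"
    using f g(2) by (auto simp: mem_Arr_Gamma_op) (auto simp: Gamma_op_def concrete_category_def compose_def)
  then show "pull (Cmp Gamma_op g f) v T = pull g (pull f v) T"
    using T preimage_subset[OF g(1) T] by (simp add: pull_def st g(2))
qed

text \<open>When additive functions for n = 1 are identified with group elements by evaluation at
  {1}, the value of the \<Gamma>-set at \<open>T\<close> becomes evaluation at
  \<open>T\<close>.\<close>

lemma pull_indicator_arrow:
  assumes "T \<subseteq> {1..n}"
  shows "pull (indicator_arrow n T) v {1} = v T"
proof -
  have "pull (indicator_arrow n T) v {1} = v {i \<in> {..n}. dat (indicator_arrow n T) i \<in> {1}}"
    unfolding pull_def by simp
  also have "{i \<in> {..n}. dat (indicator_arrow n T) i \<in> {1}} = {i \<in> {..n}. i \<in> T}"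
    by (rule Collect_cong) (auto split: if_splits)
  also have "\<dots> = T" using assms by auto
  finally show ?thesis .
qed

definition push :: "('a \<Rightarrow> 'b) \<Rightarrow> nat \<Rightarrow> (nat set \<Rightarrow> 'a) \<Rightarrow> nat set \<Rightarrow> 'b" where
  "push h n v = (\<lambda>T\<in>Pow {1..n}. h (v T))"

lemma push_in:
  assumes GH: "comm_group G" "comm_group H" "h \<in> hom G H" and v: "v \<in> additive_functions n G"
  shows "push h n v \<in> additive_functions n H"
  unfolding additive_functions_iff[OF GH(2)]
proof (intro conjI allI impI)
  note v' = v[unfolded additive_functions_iff[OF GH(1)]]
  have g: "group G" "group H" using GH by (auto dest: comm_group.axioms)
  show "push h n v \<in> extensional (Pow {1..n})" by (simp add: push_def)
  show "push h n v T \<in> carrier H" if "T \<subseteq> {1..n}" for T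
    using v' that GH(3) by (auto simp: push_def hom_def)
  fix T U assume TU: "T \<subseteq> U" "U \<subseteq> {1..n}"
  then have T: "T \<subseteq> {1..n}" "U - T \<subseteq> {1..n}" by auto
  have "h (v U) \<otimes>\<^bsub>H\<^esub> inv\<^bsub>H\<^esub> h (v T) = h (v U \<otimes>\<^bsub>G\<^esub> inv\<^bsub>G\<^esub> v T)"
    using v' TU T by (intro group_hom_minus[OF g GH(3), symmetric]) auto
  then show "push h n v U \<otimes>\<^bsub>H\<^esub> inv\<^bsub>H\<^esub> push h n v T = push h n v (U - T)"
    using v' TU T by (simp add: push_def)
qed

text \<open>One composes with \<open>h\<close> after \<open>v\<close>, the other with preimages
  before it. Hence arrows of \<open>Gamma_op\<close> will act by simplicial maps.\<close>

lemma push_pull: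
  "f \<in> Arr Gamma_op \<Longrightarrow> push h (tgt f) (pull f v) = pull f (push h (src f) v)"
  using preimage_subset[of f] by (auto simp: push_def pull_def fun_eq_iff restrict_def)

section \<open>The \<Gamma>-space of a simplicial abelian group\<close>

text \<open>Since \<open>X(n)\<close> has to consist of elements of the universe, the additive functions are encoded
  by an injection \<open>e n\<close>. The requirement \<open>X(0) = \<Delta>[0]\<close> fixes the code of the only one for \<open>n = 0\<close>.\<close>

locale additive_gamma_space =
  fixes A :: "'u sab" and e :: "nat \<Rightarrow> (nat set \<Rightarrow> 'u) \<Rightarrow> 'u"
  assumes A: "simplicial_group A"
    and inj_e: "n \<noteq> 0 \<Longrightarrow> inj_on (e n) (extensional (Pow {1..n}))"
    and e_0: "e 0 v = undefined"
begin

abbreviation "AF n m \<equiv> additive_functions n (on_obj A m)"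
definition "lev n m = e n ` AF n m"
definition "dec n m = inv_into (AF n m) (e n)"

lemma comm_group_A: "comm_group (on_obj A m)"
  using A by (simp add: simplicial_group_iff)

text \<open>For n = 0 the code is constant, but there are no initial segments to compare, so any two
  additive functions are equal.\<close>

lemma inj_on_e: "inj_on (e n) (AF n m)"
proof (cases "n = 0")
  case True
  show ?thesis
    by (rule inj_onI, rule additive_functions_eqI[OF comm_group_A]) (auto simp: True)
next
  case False
  show ?thesis by (rule inj_on_subset[OF inj_e[OF False]]) (auto simp: additive_functions_def)
qed

lemma e_in: "v \<in> AF n m \<Longrightarrow> e n v \<in> lev n m"
  by (simp add: lev_def)

lemma dec_e: "v \<in> AF n m \<Longrightarrow> dec n m (e n v) = v"
  unfolding dec_def by (rule inv_into_f_f[OF inj_on_e])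

lemma levE: assumes "a \<in> lev n m" obtains v where "v \<in> AF n m" "a = e n v" "dec n m a = v"
  using assms dec_e by (auto simp: lev_def)

definition space_obj :: "nat \<Rightarrow> 'u sset" where
  "space_obj n = \<lparr>on_obj = lev n,
     on_arr = (\<lambda>\<theta>\<in>Arr Delta. \<lparr>src = lev n (tgt \<theta>),
        dat = (\<lambda>a\<in>lev n (tgt \<theta>). e n (push (dat (on_arr A \<theta>)) n (dec n (tgt \<theta>) a))), tgt = lev n (src \<theta>)\<rparr>)\<rparr>"

definition space_arr :: "nat_arrow \<Rightarrow> 'u sset_map" where
  "space_arr f = \<lparr>src = space_obj (src f), dat = (\<lambda>m. \<lparr>src = lev (src f) m,
      dat = (\<lambda>a\<in>lev (src f) m. e (tgt f) (pull f (dec (src f) m a))), tgt = lev (tgt f) m\<rparr>),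
     tgt = space_obj (tgt f)\<rparr>"

definition space :: "'u gamma_space" where
  "space = \<lparr>on_obj = space_obj, on_arr = restrict space_arr (Arr Gamma_op)\<rparr>"

text \<open>Every simplex is a code \<open>e n v\<close>; this rule and \<open>arr_e\<close> turn
  claims about the coded space into claims about \<open>push\<close> and
  \<open>pull\<close>.\<close>

lemma face_e:
  assumes "\<theta> \<in> Arr Delta" "v \<in> AF n (tgt \<theta>)"
  shows "dat (on_arr (space_obj n) \<theta>) (e n v) = e n (push (dat (on_arr A \<theta>)) n v)"
  using assms by (simp add: space_obj_def e_in dec_e)

lemma arr_e:
  assumes "v \<in> AF (src f) m"
  shows "dat (dat (space_arr f) m) (e (src f) v) = e (tgt f) (pull f v)"
  using assms by (simp add: space_arr_def e_in dec_e)

lemma push_face_in: "\<lbrakk>\<theta> \<in> Arr Delta; v \<in> AF n (tgt \<theta>)\<rbrakk> \<Longrightarrow> push (dat (on_arr A \<theta>)) n v \<in> AF n (src \<theta>)"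
  using A by (intro push_in[OF comm_group_A comm_group_A]) (auto simp: simplicial_group_iff)

lemma pull_arr_in: "\<lbrakk>f \<in> Arr Gamma_op; v \<in> AF (src f) m\<rbrakk> \<Longrightarrow> pull f v \<in> AF (tgt f) m"
  by (rule pull_in[OF comm_group_A])

lemma AF_in: "\<lbrakk>v \<in> AF n m; T \<subseteq> {1..n}\<rbrakk> \<Longrightarrow> v T \<in> carrier (on_obj A m)"
  by (simp add: additive_functions_iff[OF comm_group_A])

lemma AF_extensional: "v \<in> AF n m \<Longrightarrow> v \<in> extensional (Pow {1..n})"
  by (simp add: additive_functions_def)

lemma on_obj_space_obj [simp]: "on_obj (space_obj n) = lev n"
  by (simp add: space_obj_def)

lemma simplicial_set_space_obj: "simplicial_set (space_obj n)"
proof -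
  have 1: "dat (on_arr (space_obj n) \<theta>) \<in> lev n (tgt \<theta>) \<rightarrow>\<^sub>E lev n (src \<theta>)" if \<theta>: "\<theta> \<in> Arr Delta" for \<theta>
  proof (rule PiE_I)
    fix a assume "a \<in> lev n (tgt \<theta>)"
    then obtain v where v: "v \<in> AF n (tgt \<theta>)" "a = e n v" using levE by blast
    show "dat (on_arr (space_obj n) \<theta>) a \<in> lev n (src \<theta>)"
      unfolding v(2) face_e[OF \<theta> v(1)] by (rule e_in[OF push_face_in[OF \<theta> v(1)]])
  qed (simp add: space_obj_def \<theta>)
  have 2: "dat (on_arr (space_obj n) (Idn Delta m)) a = a" if a: "a \<in> lev n m" for m a
  proof -
    obtain v where v: "v \<in> AF n m" "a = e n v" using levE[OF a] by blast
    have "push (dat (on_arr A (Idn Delta m))) n v = v"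
      using A AF_in[OF v(1)] AF_extensional[OF v(1)]
      by (intro extensionalityI[of _ "Pow {1..n}"]) (auto simp: push_def simplicial_group_iff)
    then show ?thesis using face_e[of "Idn Delta m" v n] v by simp
  qed
  have 3: "dat (on_arr (space_obj n) (Cmp Delta \<theta> \<phi>)) a =
      dat (on_arr (space_obj n) \<phi>) (dat (on_arr (space_obj n) \<theta>) a)"
    if \<theta>: "\<theta> \<in> Arr Delta" and \<phi>: "\<phi> \<in> Arr Delta" "tgt \<phi> = src \<theta>" and a: "a \<in> lev n (tgt \<theta>)" for \<theta> \<phi> a
  proof -
    obtain v where v: "v \<in> AF n (tgt \<theta>)" "a = e n v" using levE[OF a] by blast
    have p: "push (dat (on_arr A \<theta>)) n v \<in> AF n (tgt \<phi>)" using push_face_in[OF \<theta> v(1)] \<phi>(2) by simp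
    have "push (dat (on_arr A (Cmp Delta \<theta> \<phi>))) n v = push (dat (on_arr A \<phi>)) n (push (dat (on_arr A \<theta>)) n v)"
      using A AF_in[OF v(1)] \<theta> \<phi> by (auto simp: push_def simplicial_group_iff fun_eq_iff)
    moreover have "v \<in> AF n (tgt (Cmp Delta \<theta> \<phi>))" using v by simp
    ultimately show ?thesis
      unfolding v(2) face_e[OF \<theta> v(1)] face_e[OF \<phi>(1) p]
      using face_e[OF Cmp_Delta_in[OF \<theta> \<phi>]] by simp
  qed
  show ?thesis
    unfolding simplicial_set_iff using 1 2 3 by (simp add: space_obj_def)
qed

lemma sset_morphism_space_arr:
  assumes f: "f \<in> Arr Gamma_op"
  shows "sset_morphism (space_arr f)"
proof -
  have st: "src (space_arr f) = space_obj (src f)" "tgt (space_arr f) = space_obj (tgt f)"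
    "src (dat (space_arr f) m) = lev (src f) m" "tgt (dat (space_arr f) m) = lev (tgt f) m" for m
    by (simp_all add: space_arr_def)
  have 1: "dat (dat (space_arr f) m) \<in> lev (src f) m \<rightarrow>\<^sub>E lev (tgt f) m" for m
  proof (rule PiE_I)
    fix a assume "a \<in> lev (src f) m"
    then obtain v where v: "v \<in> AF (src f) m" "a = e (src f) v" using levE by blast
    show "dat (dat (space_arr f) m) a \<in> lev (tgt f) m"
      unfolding v(2) arr_e[OF v(1)] by (rule e_in[OF pull_arr_in[OF f v(1)]])
  qed (simp add: space_arr_def)
  have 2: "dat (dat (space_arr f) (src \<theta>)) (dat (on_arr (space_obj (src f)) \<theta>) a) =
      dat (on_arr (space_obj (tgt f)) \<theta>) (dat (dat (space_arr f) (tgt \<theta>)) a)"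
    if \<theta>: "\<theta> \<in> Arr Delta" and a: "a \<in> lev (src f) (tgt \<theta>)" for \<theta> a
  proof -
    obtain v where v: "v \<in> AF (src f) (tgt \<theta>)" "a = e (src f) v" using levE[OF a] by blast
    show ?thesis
      unfolding v(2) face_e[OF \<theta> v(1)] arr_e[OF v(1)] arr_e[OF push_face_in[OF \<theta> v(1)]]
        face_e[OF \<theta> pull_arr_in[OF f v(1)]] push_pull[OF f] ..
  qed
  show ?thesis
    unfolding sset_morphism_iff st using 1 2 simplicial_set_space_obj by simp
qed

lemma on_arr_space: "f \<in> Arr Gamma_op \<Longrightarrow> on_arr space f = space_arr f"
  by (simp add: space_def)

lemma on_obj_space [simp]: "on_obj space = space_obj"
  by (simp add: space_def)

lemma gamma_functor_space: "gamma_functor space"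
proof -
  have st: "src (space_arr f) = space_obj (src f)" "tgt (space_arr f) = space_obj (tgt f)" for f
    by (simp_all add: space_arr_def)
  have i: "Idn Gamma_op n \<in> Arr Gamma_op" "src (Idn Gamma_op n) = n" "tgt (Idn Gamma_op n) = n" for n
    using category.idn_in[OF category_Gamma_op, of n] by (simp_all) (simp_all add: Gamma_op_def concrete_category_def)
  have 2: "dat (dat (space_arr (Idn Gamma_op n)) m) a = a" if a: "a \<in> lev n m" for n m a
  proof -
    obtain v where v: "v \<in> AF n m" "a = e n v" using levE[OF a] by blast
    then show ?thesis
      using arr_e[of v "Idn Gamma_op n" m] by (simp add: i pull_Idn[OF AF_extensional[OF v(1)]])
  qed
  have 3: "dat (dat (space_arr (Cmp Gamma_op g f)) m) a = dat (dat (space_arr g) m) (dat (dat (space_arr f) m) a)"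
    if f: "f \<in> Arr Gamma_op" and g: "g \<in> Arr Gamma_op" "tgt f = src g" and a: "a \<in> lev (src f) m" for f g m a
  proof -
    obtain v where v: "v \<in> AF (src f) m" "a = e (src f) v" using levE[OF a] by blast
    have p: "pull f v \<in> AF (src g) m" using pull_arr_in[OF f v(1)] g(2) by simp
    have "src (Cmp Gamma_op g f) = src f" "tgt (Cmp Gamma_op g f) = tgt g"
      by (simp_all add: Gamma_op_def concrete_category_def)
    then show ?thesis
      using arr_e[of v "Cmp Gamma_op g f" m] arr_e[OF v(1)] arr_e[OF p] v by (simp add: pull_Cmp[OF f g] g(2))
  qed
  have c: "Cmp Gamma_op g f \<in> Arr Gamma_op"
    if "f \<in> Arr Gamma_op" "g \<in> Arr Gamma_op" "tgt f = src g" for f g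
    using category.cmp_in[OF category_Gamma_op, of f g] that by simp
  show ?thesis
    unfolding gamma_functor_iff
    using 2 3 i c simplicial_set_space_obj sset_morphism_space_arr
    by (simp add: on_arr_space st) (simp add: space_def)
qed

lemma space_obj_0: "space_obj 0 = Delta0"
proof -
  interpret G: comm_group "on_obj A m" for m by (rule comm_group_A)
  have l: "lev 0 m = {undefined}" for m
    using G.ex_additive_function[of 0] by (auto simp: lev_def e_0)
  show ?thesis by (auto simp: space_obj_def Delta0_def l e_0 fun_eq_iff restrict_def)
qed

lemma val_e:
  assumes "v \<in> AF n m" "T \<subseteq> {1..n}"
  shows "level_act space m (indicator_arrow n T) (e n v) = e 1 (pull (indicator_arrow n T) v)"
    "pull (indicator_arrow n T) v \<in> AF 1 m"
  using arr_e[of v "indicator_arrow n T" m] pull_arr_in[OF indicator_arrow_in[OF assms(2)], of v m] assms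
  by (simp_all add: on_arr_space indicator_arrow_in)

lemma AF_1_eqI: "\<lbrakk>v \<in> AF 1 m; w \<in> AF 1 m; v {1} = w {1}\<rbrakk> \<Longrightarrow> v = w"
  by (rule additive_functions_eqI[OF comm_group_A]) auto

text \<open>Up to codes, the Bousfield map records the values of \<open>v\<close> at initial
  segments. It is injective by \<open>additive_functions_eqI\<close> and surjective by
  \<open>ex_additive_function\<close>.\<close>

lemma strict_bousfield_space: "strict_bousfield space"
  unfolding strict_bousfield_iff[OF gamma_functor_space]
proof (intro conjI allI impI)
  show "on_obj space 0 = Delta0" by (simp add: space_obj_0)
  fix n m :: nat
  interpret G: comm_group "on_obj A m" by (rule comm_group_A)
  have T: "{1..k+1} \<subseteq> {1..n}" if "k < n" for k using that by auto
  have bm: "bousfield_map space n m (e n v) = (\<lambda>k\<in>{..<n}. e 1 (pull (indicator_arrow n {1..k+1}) v))"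
    if "v \<in> AF n m" for v
    unfolding bousfield_map_def by (rule restrict_ext) (use val_e(1)[OF that T] in \<open>simp add: j_op_eq\<close>)
  show "bij_betw (bousfield_map space n m) (level space m n) ({..<n} \<rightarrow>\<^sub>E level space m 1)"
    unfolding bij_betw_def
  proof (intro conjI)
    show "inj_on (bousfield_map space n m) (level space m n)"
    proof (rule inj_onI)
      fix a b assume ab: "a \<in> level space m n" "b \<in> level space m n"
        and eq: "bousfield_map space n m a = bousfield_map space n m b"
      obtain v where v: "v \<in> AF n m" "a = e n v" using levE[of a n m] ab by auto
      obtain w where w: "w \<in> AF n m" "b = e n w" using levE[of b n m] ab by auto
      have "v = w"
      proof (rule additive_functions_eqI[OF comm_group_A v(1) w(1)])
        fix k assume k: "k < n"
        have "e 1 (pull (indicator_arrow n {1..k+1}) v) = e 1 (pull (indicator_arrow n {1..k+1}) w)"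
          using fun_cong[OF eq, of k] k by (simp add: v(2) w(2) bm[OF v(1)] bm[OF w(1)])
        then have "pull (indicator_arrow n {1..k+1}) v = pull (indicator_arrow n {1..k+1}) w"
          by (rule inj_onD[OF inj_on_e]) (rule val_e(2)[OF v(1) T[OF k]] val_e(2)[OF w(1) T[OF k]])+
        then show "v {1..k+1} = w {1..k+1}"
          using pull_indicator_arrow[OF T[OF k]] by metis
      qed
      then show "a = b" by (simp add: v w)
    qed
    show "bousfield_map space n m ` level space m n = {..<n} \<rightarrow>\<^sub>E level space m 1"
    proof (intro equalityI subsetI)
      fix y assume "y \<in> bousfield_map space n m ` level space m n"
      then show "y \<in> {..<n} \<rightarrow>\<^sub>E level space m 1" using bousfield_map_in[OF gamma_functor_space] by blast
    next
      fix y assume y: "y \<in> {..<n} \<rightarrow>\<^sub>E level space m 1"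
      have d: "dec 1 m (y k) \<in> AF 1 m \<and> y k = e 1 (dec 1 m (y k))" if "k < n" for k
      proof -
        have "y k \<in> lev 1 m" using y that by auto
        then show ?thesis using levE by metis
      qed
      \<comment> \<open>\<open>y k\<close> codes an additive function for n = 1, whose value at {1}
        is the group element it stands for.\<close>
      have c: "dec 1 m (y k) {1} \<in> carrier (on_obj A m)" if "k < n" for k
        using d[OF that] by (intro AF_in) auto
      obtain v where v: "v \<in> AF n m" "\<forall>k<n. v {1..k+1} = dec 1 m (y k) {1}"
        using G.ex_additive_function[of n "\<lambda>k. dec 1 m (y k) {1}", OF c] by blast
      have "y = bousfield_map space n m (e n v)"
        unfolding bm[OF v(1)]
      proof (rule extensionalityI)
        show "y \<in> extensional {..<n}" using y by (simp add: PiE_iff)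
        fix k assume "k \<in> {..<n}"
        then have k: "k < n" by simp
        have "pull (indicator_arrow n {1..k+1}) v = dec 1 m (y k)"
          using val_e(2)[OF v(1) T[OF k]] d[OF k] pull_indicator_arrow[OF T[OF k], of v] v(2) k
          by (intro AF_1_eqI) auto
        then show "y k = (\<lambda>k\<in>{..<n}. e 1 (pull (indicator_arrow n {1..k+1}) v)) k"
          using d[OF k] k by simp
      qed simp
      then show "y \<in> bousfield_map space n m ` level space m n" using e_in[OF v(1)] by simp
    qed
  qed
qed

text \<open>Decoding followed by evaluation at {1}. The group of the constructed space consists of
  codes, which is why a comparison map is needed.\<close>

definition comparison :: "'u sab_map" where
  "comparison = \<lparr>src = underlying_group space,
     dat = (\<lambda>m. \<lparr>src = level_group space m, dat = (\<lambda>a\<in>lev 1 m. dec 1 m a {1}), tgt = on_obj A m\<rparr>), tgt = A\<rparr>"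

lemma comparison_e: "v \<in> AF 1 m \<Longrightarrow> dat (dat comparison m) (e 1 v) = v {1}"
  by (simp add: comparison_def e_in dec_e del: One_nat_def)

lemma bij_betw_comparison: "bij_betw (dat (dat comparison m)) (lev 1 m) (carrier (on_obj A m))"
proof -
  interpret G: comm_group "on_obj A m" by (rule comm_group_A)
  have "\<exists>a\<in>lev 1 m. dat (dat comparison m) a = c" if c: "c \<in> carrier (on_obj A m)" for c
  proof -
    obtain v where v: "v \<in> AF 1 m" "\<forall>k<1. v {1..k+1} = c"
      using G.ex_additive_function[of 1 "\<lambda>_. c", OF c] by blast
    then show ?thesis using comparison_e[OF v(1)] e_in[OF v(1)] by (intro bexI[of _ "e 1 v"]) auto
  qed
  moreover have "dat (dat comparison m) a \<in> carrier (on_obj A m)" if a: "a \<in> lev 1 m" for a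
  proof -
    obtain v where v: "v \<in> AF 1 m" "a = e 1 v" using levE[OF a] by blast
    show ?thesis unfolding v(2) comparison_e[OF v(1)] by (rule AF_in[OF v(1)]) simp
  qed
  moreover have "a = b" if ab: "a \<in> lev 1 m" "b \<in> lev 1 m" and eq: "dat (dat comparison m) a = dat (dat comparison m) b" for a b
  proof -
    obtain v where v: "v \<in> AF 1 m" "a = e 1 v" using levE[OF ab(1)] by blast
    obtain w where w: "w \<in> AF 1 m" "b = e 1 w" using levE[OF ab(2)] by blast
    have "v {1} = w {1}" using eq unfolding v(2) w(2) comparison_e[OF v(1)] comparison_e[OF w(1)] .
    then show "a = b" using AF_1_eqI[OF v(1) w(1)] v w by simp
  qed
  ultimately show ?thesis unfolding bij_betw_def inj_on_def by blast
qed

text \<open>A difference in the group of the space is read off from an element of its second level.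
  That element codes some \<open>v\<close>, its values correspond to those of \<open>v\<close> by
  \<open>cv\<close>, and \<open>v\<close> is additive.\<close>

lemma comparison_hom: "dat (dat comparison m) \<in> hom (level_group space m) (on_obj A m)"
proof -
  interpret G: comm_group "on_obj A m" by (rule comm_group_A)
  interpret X: gamma_set "level space m" "level_act space m"
    by (rule gamma_set_level[OF gamma_functor_space strict_bousfield_space])
  have g: "group X.grp" using X.comm_group_grp by (rule comm_group.axioms)
  have s: "level space m n = lev n m" for n by simp
  have cv: "dat (dat comparison m) (X.val n T (e n v)) = v T" if "v \<in> AF n m" "T \<subseteq> {1..n}" for v n T
    unfolding X.val_def val_e(1)[OF that] comparison_e[OF val_e(2)[OF that]] by (rule pull_indicator_arrow[OF that(2)])
  show ?thesis
    unfolding level_group_def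
  proof (rule hom_if_minus[OF g G.is_group])
    show "dat (dat comparison m) \<in> carrier X.grp \<rightarrow> carrier (on_obj A m)"
      unfolding X.carrier_grp unfolding s by (rule bij_betw_imp_funcset[OF bij_betw_comparison])
    fix a b assume "a \<in> carrier X.grp" "b \<in> carrier X.grp"
    then have ab: "a \<in> level space m 1" "b \<in> level space m 1" unfolding X.carrier_grp .
    obtain x where x: "x \<in> level space m 2" "X.val 2 {1} x = a" "X.val 2 {1,2} x = b"
      using X.ex_2[OF ab] by blast
    obtain v where v: "v \<in> AF 2 m" "x = e 2 v" using levE[OF x(1)[unfolded s]] by blast
    have d: "{1,2} - {1} = {2::nat}" by auto
    have "X.diff a b = X.val 2 {2} x"
      using X.diff_val[OF x(1), of "{1}" "{1,2}"] unfolding x(2,3) d by simp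
    moreover have "v {1,2} \<otimes>\<^bsub>on_obj A m\<^esub> inv\<^bsub>on_obj A m\<^esub> v {1} = v ({1,2} - {1})"
      using v(1) unfolding additive_functions_iff[OF comm_group_A] by simp
    ultimately show "dat (dat comparison m) (b \<otimes>\<^bsub>X.grp\<^esub> inv\<^bsub>X.grp\<^esub> a) =
        dat (dat comparison m) b \<otimes>\<^bsub>on_obj A m\<^esub> inv\<^bsub>on_obj A m\<^esub> dat (dat comparison m) a"
      using cv[OF v(1), of "{1}"] cv[OF v(1), of "{1,2}"] cv[OF v(1), of "{2}"]
      unfolding X.diff_grp[OF ab, symmetric] v(2)[symmetric] x(2,3) d by simp
  qed
qed

lemma simplicial_hom_comparison: "simplicial_hom comparison"
proof -
  have c: "carrier (level_group space m) = lev 1 m" for m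
    using carrier_level_group[OF gamma_functor_space strict_bousfield_space] by simp
  have nat: "dat (dat comparison (src \<theta>)) (dat (on_arr (space_obj 1) \<theta>) a) = dat (on_arr A \<theta>) (dat (dat comparison (tgt \<theta>)) a)"
    if \<theta>: "\<theta> \<in> Arr Delta" and a: "a \<in> lev 1 (tgt \<theta>)" for \<theta> a
  proof -
    obtain v where v: "v \<in> AF 1 (tgt \<theta>)" "a = e 1 v" using levE[OF a] by blast
    show ?thesis
      unfolding v(2) face_e[OF \<theta> v(1)] comparison_e[OF v(1)] comparison_e[OF push_face_in[OF \<theta> v(1)]]
      by (simp add: push_def)
  qed
  have st: "src comparison = underlying_group space" "tgt comparison = A"
    "src (dat comparison m) = level_group space m" "tgt (dat comparison m) = on_obj A m" for m
    by (simp_all add: comparison_def)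
  have E: "dat (dat comparison m) \<in> lev 1 m \<rightarrow>\<^sub>E carrier (on_obj A m)" for m
    using bij_betw_comparison[of m] by (auto simp: bij_betw_def PiE_iff) (simp add: comparison_def)
  show ?thesis
    unfolding simplicial_hom_iff st
    using simplicial_group_underlying_group[OF gamma_functor_space strict_bousfield_space] A E comparison_hom nat
    by (simp add: st c del: One_nat_def)
qed

end

section \<open>Degreewise isomorphisms and the equivalence\<close>

text \<open>The degreewise inverses respect products and simplicial operators, since both sides of
  each equation have the same image under the bijective \<tau>. Restricting them makes them
  extensional, as arrows must be.\<close>

lemma is_iso_simplicial_hom:
  assumes \<tau>: "simplicial_hom \<tau>"
    and bij: "\<And>m. bij_betw (dat (dat \<tau> m)) (carrier (on_obj (src \<tau>) m)) (carrier (on_obj (tgt \<tau>) m))"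
  shows "is_iso simplicial_abelian_groups \<tau>"
proof -
  interpret category simplicial_abelian_groups by (rule category_simplicial_abelian_groups)
  note t = \<tau>[unfolded simplicial_hom_iff]
  define C where "C m = carrier (on_obj (src \<tau>) m)" for m
  define D where "D m = carrier (on_obj (tgt \<tau>) m)" for m
  define i where "i m = inv_into (C m) (dat (dat \<tau> m))" for m
  note bij = bij[folded C_def D_def]
  have i_in: "i m b \<in> C m" and r: "dat (dat \<tau> m) (i m b) = b" if "b \<in> D m" for m b
    using bij_betw_inv_into_right[OF bij that] bij_betw_apply[OF bij_betw_inv_into[OF bij] that] by (simp_all add: i_def)
  have l: "i m (dat (dat \<tau> m) a) = a" and t_in: "dat (dat \<tau> m) a \<in> D m" if "a \<in> C m" for m a
    using bij_betw_inv_into_left[OF bij that] bij_betw_apply[OF bij that] by (simp_all add: i_def)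
  have gr: "comm_group (on_obj (src \<tau>) m)" "comm_group (on_obj (tgt \<tau>) m)" for m
    using t by (simp_all add: simplicial_group_iff)
  define \<rho> where "\<rho> = \<lparr>src = tgt \<tau>, dat = (\<lambda>m. \<lparr>src = on_obj (tgt \<tau>) m, dat = restrict (i m) (D m),
     tgt = on_obj (src \<tau>) m\<rparr>), tgt = src \<tau>\<rparr>"
  have hom: "restrict (i m) (D m) \<in> hom (on_obj (tgt \<tau>) m) (on_obj (src \<tau>) m)" for m
  proof -
    interpret G: comm_group "on_obj (src \<tau>) m" by (rule gr)
    interpret H: comm_group "on_obj (tgt \<tau>) m" by (rule gr)
    show ?thesis
    proof (rule homI; fold D_def C_def)
      fix a b assume ab: "a \<in> D m" "b \<in> D m"
      have "dat (dat \<tau> m) (i m a \<otimes>\<^bsub>on_obj (src \<tau>) m\<^esub> i m b) = a \<otimes>\<^bsub>on_obj (tgt \<tau>) m\<^esub> b"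
        using t i_in[OF ab(1)] i_in[OF ab(2)] r ab by (simp add: hom_def C_def)
      moreover have "i m a \<otimes>\<^bsub>on_obj (src \<tau>) m\<^esub> i m b \<in> C m"
        using i_in[OF ab(1)] i_in[OF ab(2)] by (simp add: C_def)
      ultimately have "i m (a \<otimes>\<^bsub>on_obj (tgt \<tau>) m\<^esub> b) = i m a \<otimes>\<^bsub>on_obj (src \<tau>) m\<^esub> i m b"
        using l by metis
      then show "restrict (i m) (D m) (a \<otimes>\<^bsub>on_obj (tgt \<tau>) m\<^esub> b) =
         restrict (i m) (D m) a \<otimes>\<^bsub>on_obj (src \<tau>) m\<^esub> restrict (i m) (D m) b"
        using ab by (simp add: D_def)
    qed (simp add: i_in)
  qed
  have A: "dat (on_arr (src \<tau>) \<theta>) a \<in> C (src \<theta>)" if "\<theta> \<in> Arr Delta" "a \<in> C (tgt \<theta>)" for \<theta> a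
    using t that by (auto simp: simplicial_group_iff C_def PiE_iff)
  have B: "dat (on_arr (tgt \<tau>) \<theta>) a \<in> D (src \<theta>)" if "\<theta> \<in> Arr Delta" "a \<in> D (tgt \<theta>)" for \<theta> a
    using t that by (auto simp: simplicial_group_iff D_def PiE_iff)
  have nat: "i (src \<theta>) (dat (on_arr (tgt \<tau>) \<theta>) b) = dat (on_arr (src \<tau>) \<theta>) (i (tgt \<theta>) b)"
    if \<theta>: "\<theta> \<in> Arr Delta" and b: "b \<in> D (tgt \<theta>)" for \<theta> b
  proof -
    have "dat (on_arr (tgt \<tau>) \<theta>) b = dat (dat \<tau> (src \<theta>)) (dat (on_arr (src \<tau>) \<theta>) (i (tgt \<theta>) b))"
      using t \<theta> i_in[OF b] r[OF b] by (simp add: C_def)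
    then show ?thesis using l[OF A[OF \<theta> i_in[OF b]]] by simp
  qed
  have \<rho>: "simplicial_hom \<rho>"
    unfolding simplicial_hom_iff
    using t hom i_in B nat by (simp add: \<rho>_def flip: C_def D_def)
  show ?thesis
  proof (rule is_isoI[where x = "src \<tau>" and y = "tgt \<tau>"])
    show h: "in_hom simplicial_abelian_groups (src \<tau>) (tgt \<tau>) \<tau>" "in_hom simplicial_abelian_groups (tgt \<tau>) (src \<tau>) \<rho>"
      using \<tau> \<rho> by (simp_all add: in_hom_def simplicial_abelian_groups_simps(1-4)) (simp_all add: \<rho>_def)
    have s: "src (dat \<tau> m) = on_obj (src \<tau>) m" "tgt (dat \<tau> m) = on_obj (tgt \<tau>) m" for m using t by auto
    show "Cmp simplicial_abelian_groups \<rho> \<tau> = Idn simplicial_abelian_groups (src \<tau>)"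
      by (auto simp: simplicial_abelian_groups_simps(5,6) \<rho>_def ab_cat_def concrete_category_def compose_def fun_eq_iff s
          restrict_def l t_in simp flip: C_def D_def)
    show "Cmp simplicial_abelian_groups \<tau> \<rho> = Idn simplicial_abelian_groups (tgt \<tau>)"
      by (auto simp: simplicial_abelian_groups_simps(5,6) \<rho>_def ab_cat_def concrete_category_def compose_def fun_eq_iff s
          restrict_def r i_in simp flip: C_def D_def)
  qed
qed

theorem theorem7p2:
  assumes "infinite (UNIV :: 'u set)"
  shows "equivalent_categories
    (strict_bousfield_gamma_spaces :: ('u gamma_space, 'u gamma_map) category)
    (simplicial_abelian_groups :: ('u sab, 'u sab_map) category)"
proof (rule equivalent_categoriesI)
  show "category (strict_bousfield_gamma_spaces :: ('u gamma_space, 'u gamma_map) category)"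
    by (rule category_strict_bousfield_gamma_spaces)
  show "category (simplicial_abelian_groups :: ('u sab, 'u sab_map) category)"
    by (rule category_simplicial_abelian_groups)
  show "is_functor strict_bousfield_gamma_spaces simplicial_abelian_groups
     (underlying_functor :: ('u gamma_space, 'u gamma_map, 'u sab, 'u sab_map) functr)"
    by (rule is_functor_underlying_functor)
next
  fix X Y :: "'u gamma_space" and \<psi>
  assume XY: "X \<in> Obj strict_bousfield_gamma_spaces" "Y \<in> Obj strict_bousfield_gamma_spaces"
    and "in_hom simplicial_abelian_groups (on_obj underlying_functor X) (on_obj underlying_functor Y) \<psi>"
  then have "simplicial_hom \<psi>" "src \<psi> = underlying_group X" "tgt \<psi> = underlying_group Y"
    by (simp_all add: in_hom_def simplicial_abelian_groups_simps(1-4) underlying_functor_def)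
  then obtain \<tau> where "gamma_morphism \<tau>" "src \<tau> = X" "tgt \<tau> = Y" "underlying_hom \<tau> = \<psi>"
    using underlying_hom_full XY[unfolded strict_bousfield_gamma_spaces_simps(1)] by blast
  then show "\<exists>\<tau>. in_hom strict_bousfield_gamma_spaces X Y \<tau> \<and> on_arr underlying_functor \<tau> = \<psi>"
    using XY by (intro exI[of _ \<tau>])
      (simp add: in_hom_def strict_bousfield_gamma_spaces_simps(1-4) underlying_functor_def)
next
  fix X Y :: "'u gamma_space" and \<sigma> \<tau>
  assume h: "in_hom strict_bousfield_gamma_spaces X Y \<sigma>" "in_hom strict_bousfield_gamma_spaces X Y \<tau>"
    and eq: "on_arr underlying_functor \<sigma> = on_arr underlying_functor \<tau>"
  have "underlying_hom \<sigma> = underlying_hom \<tau>"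
    using h eq by (simp add: in_hom_def underlying_functor_def)
  with h show "\<sigma> = \<tau>"
    by (intro underlying_hom_faithful) (auto simp: in_hom_def strict_bousfield_gamma_spaces_simps(1-4))
next
  fix A :: "'u sab" assume "A \<in> Obj simplicial_abelian_groups"
  then have A: "simplicial_group A" by (simp add: simplicial_abelian_groups_simps)
  have "\<exists>e :: (nat set \<Rightarrow> 'u) \<Rightarrow> 'u. inj_on e (extensional (Pow {1..n}))" for n
    by (rule ex_inj_on_extensional[OF assms]) simp
  then obtain e0 :: "nat \<Rightarrow> (nat set \<Rightarrow> 'u) \<Rightarrow> 'u" where e0: "\<And>n. inj_on (e0 n) (extensional (Pow {1..n}))"
    by metis
  \<comment> \<open>The injection is overridden at n = 0, where \<open>Delta0\<close> dictates the
    code; with only one additive function there, nothing is lost.\<close>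
  define e where "e n v = (if n = 0 then undefined else e0 n v)" for n v
  interpret additive_gamma_space A e
  proof
    show "inj_on (e n) (extensional (Pow {1..n}))" if "n \<noteq> 0" for n
      using e0[of n] that by (simp add: e_def[abs_def])
  qed (simp_all add: A e_def)
  have sp: "space \<in> Obj strict_bousfield_gamma_spaces"
    using gamma_functor_space strict_bousfield_space by (simp add: strict_bousfield_gamma_spaces_simps(1))
  have st: "src comparison = underlying_group space" "tgt comparison = A" by (simp_all add: comparison_def)
  have "is_iso simplicial_abelian_groups comparison"
    using bij_betw_comparison carrier_level_group[OF gamma_functor_space strict_bousfield_space]
    by (intro is_iso_simplicial_hom[OF simplicial_hom_comparison]) (simp add: st)
  moreover have "in_hom simplicial_abelian_groups (on_obj underlying_functor space) A comparison"
    using sp simplicial_hom_comparison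
    by (simp add: in_hom_def simplicial_abelian_groups_simps(1-4) underlying_functor_def st)
  ultimately show "\<exists>X\<in>Obj strict_bousfield_gamma_spaces. \<exists>g. is_iso simplicial_abelian_groups g \<and>
     in_hom simplicial_abelian_groups (on_obj underlying_functor X) A g"
    using sp by blast
qed

end
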